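(* Let $d \geq 3$ be an integer. For $n \geq 0$, let $C_d(n)$ denote the coefficient of $x_1^n x_2^n \cdots x_d^n$ in the power series expansion at the origin of the rational function \[ A_d(x_1,\ldots,x_d) = \left(1 - \sum_{i=2}^d (i-1)\, e_i(x_1,\ldots,x_d)\right)^{-1} \prod_{i=1}^d \frac{x_i}{1-x_i}, \] where $e_i(x_1,\ldots,x_d) = \sum_{1 \le r_1 < \cdots < r_i \le d} x_{r_1}\cdots x_{r_i}$ is the $i$th elementary symmetric polynomial. (Equivalently, $C_d(n)$ is the number of simple singular vector tuples of a generic $d$-dimensional $n \times \cdots \times n$ complex tensor.) Then, as $n \to \infty$, \[ C_d(n) = \frac{(d-1)^{d-1}}{(2\pi)^{(d-1)/2}\, d^{(d-2)/2}\, (d-2)^{(3d-1)/2}} \, \big((d-1)^d\big)^n \, n^{(1-d)/2} \left(1 + O\!\left(\frac{1}{n}\right)\right). \]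
   Context: By a result of Friedland–Ottaviani together with Ekhad–Zeilberger, the coefficient of $x_1^{m_1}\cdots x_d^{m_d}$ in $A_d$ equals the number of simple singular vector tuples of a generic $m_1\times\cdots\times m_d$ complex tensor; $C_d(n)$ is the diagonal ("cubical") case $m_1=\cdots=m_d=n$. *)

theory Defs
  imports Complex_Main "HOL-Library.Landau_Symbols"
begin

text \<open>Formal power series in the variables x_0, x_1, ... (we use x_0..x_(d-1) for the
paper's x_1..x_d), represented by their coefficient functions on exponent vectors
(nat => nat).  Only finitely supported exponent vectors are relevant.\<close>

type_synonym mps = "(nat \<Rightarrow> nat) \<Rightarrow> real"

definition mps_mult :: "mps \<Rightarrow> mps \<Rightarrow> mps" where
  "mps_mult f g m = (\<Sum>a\<in>{a. \<forall>i. a i \<le> m i}. f a * g (\<lambda>i. m i - a i))"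

definition mps_one :: mps where
  "mps_one m = (if m = (\<lambda>_. 0) then 1 else 0)"

definition mps_pow :: "mps \<Rightarrow> nat \<Rightarrow> mps" where
  "mps_pow f k = (mps_mult f ^^ k) mps_one"

definition esym :: "nat \<Rightarrow> nat \<Rightarrow> mps" where
  "esym d i m = (if \<exists>S. S \<subseteq> {..<d} \<and> card S = i \<and> m = (\<lambda>j. if j \<in> S then 1 else 0)
                 then 1 else 0)"

definition Pser :: "nat \<Rightarrow> mps" where
  "Pser d m = (\<Sum>i\<in>{2..d}. real (i - 1) * esym d i m)"

text \<open>(1 - P)^{-1} for a series P without constant term, as the geometric series
sum_k P^k; at an exponent vector m in d variables only k <= |m| contribute.\<close>
definition inv_one_minus :: "nat \<Rightarrow> mps \<Rightarrow> mps" where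
  "inv_one_minus d P m = (\<Sum>k\<le>(\<Sum>i<d. m i). mps_pow P k m)"

text \<open>x_i / (1 - x_i) = sum_{k >= 1} x_i^k.\<close>
definition geomX :: "nat \<Rightarrow> mps" where
  "geomX i m = (if 1 \<le> m i \<and> (\<forall>j. j \<noteq> i \<longrightarrow> m j = 0) then 1 else 0)"

definition prod_geomX :: "nat \<Rightarrow> mps" where
  "prod_geomX d = foldr mps_mult (map geomX [0..<d]) mps_one"

definition A_ser :: "nat \<Rightarrow> mps" where
  "A_ser d = mps_mult (inv_one_minus d (Pser d)) (prod_geomX d)"

definition C :: "nat \<Rightarrow> nat \<Rightarrow> real" where
  "C d n = A_ser d (\<lambda>i. if i < d then n else 0)"

end

theory Submission
  imports Defs "HOL-Probability.Probability" "HOL-Complex_Analysis.Complex_Analysis"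
begin

text \<open>The denominator of \<open>A\<^sub>d\<close> factors as \<open>(\<Prod>i. 1 + x\<^sub>i) * (1 - (\<Sum>i. x\<^sub>i / (1 + x\<^sub>i)))\<close>.
  Writing the inverse of the second factor as \<open>\<integral> exp (- t) * (\<Prod>i. exp (t x\<^sub>i / (1 + x\<^sub>i))) dt\<close>
  separates the variables, and \<open>C d n\<close> becomes the integral of \<open>exp (- t) * f\<^sub>n(t) ^ d\<close> over
  \<open>t \<ge> 0\<close>, where \<open>f\<^sub>n\<close> is a sum of Laguerre polynomials. A Cauchy integral for \<open>f\<^sub>n(t)\<close> on the
  circle of radius \<open>1 / (d - 1)\<close> shows that \<open>exp (- t / d) * f\<^sub>n(t)\<close> is, after centring \<open>t\<close> at
  \<open>n d\<^sup>2 / (d - 1)\<close> and scaling by \<open>\<surd>n\<close>, a Gaussian plus an odd correction of relative order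
  \<open>1 / \<surd>n\<close> plus an error of relative order \<open>1 / n\<close>. In the \<open>d\<close>-th power the odd correction
  integrates to zero to first order, which leaves the relative error \<open>O(1 / n)\<close>.\<close>

subsection \<open>An integral formula for the coefficients\<close>

text \<open>With \<open>E(u) = prod (1 + u x_i)\<close>, the sum of \<open>(i - 1) e_i\<close> over
  \<open>i >= 2\<close> is \<open>E'(1) - E(1) + 1\<close>; this is the source of the factorisation.
  It is not carried out on series in several variables: on coefficients it becomes the recursion
  \<open>Q = 1 + P Q\<close>, which is an integration by parts for products of Laguerre polynomials,
  the derivative in \<open>t\<close> playing the part of \<open>E'\<close>. The radius and the
  centre come from the exponent \<open>- t / d + t z / (1 + z) - n ln z\<close>: it is stationary in
  \<open>t\<close> when \<open>z / (1 + z) = 1 / d\<close>, that is \<open>z = 1 / (d - 1)\<close>,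
  and then stationary in \<open>z\<close> when \<open>t = n (1 + z)^2 / z\<close>. For
  \<open>d >= 3\<close> the radius is at most 1/2, which keeps the circle away from the poles at 1
  and -1. The expansion is uniform only while the shift \<open>s\<close> of the scaled variable is
  at most a multiple of \<open>sqrt n\<close>, but \<open>t\<close> runs over a half line. A second
  bound, exponential in \<open>s\<close> and uniform in \<open>n\<close>, covers the rest, including
  \<open>t\<close> near 0, where the circle integral does not yet concentrate.\<close>

definition expint :: "real poly \<Rightarrow> real" where
  "expint p = (LINT t|lborel. indicator {0..} t * (exp (-t) * poly p t))"

lemma has_bochner_integral_power_exp:
  "has_bochner_integral lborel (\<lambda>t::real. indicator {0..} t * (exp (-t) * t ^ k)) (fact k)"
proof (rule has_bochner_integral_nn_integral)
  have "(\<integral>\<^sup>+ t. ennreal (indicator {0..} t * (exp (-t) * t ^ k)) \<partial>lborel)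
        = (\<integral>\<^sup>+ t. ennreal (t ^ k * exp (-t)) * indicator {0..} t \<partial>lborel)"
    by (intro nn_integral_cong) (auto simp: indicator_def mult_ac)
  then show "(\<integral>\<^sup>+ t. ennreal (indicator {0..} t * (exp (-t) * t ^ k)) \<partial>lborel) = ennreal (fact k)"
    by (simp add: nn_intergal_power_times_exp_Ici)
qed (auto simp: indicator_def)

lemma integrable_poly_exp:
  "integrable lborel (\<lambda>t::real. indicator {0..} t * (exp (-t) * poly p t))"
proof -
  have "integrable lborel (\<lambda>t. \<Sum>i\<le>degree p. coeff p i * (indicator {0..} t * (exp (-t) * t ^ i)))"
    using has_bochner_integral_power_exp
    by (intro Bochner_Integration.integrable_sum integrable_mult_right)
       (auto simp: has_bochner_integral_iff)
  then show ?thesis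
    by (simp add: poly_altdef sum_distrib_left mult_ac)
qed

lemma expint_add: "expint (p + q) = expint p + expint q"
  using integrable_poly_exp[of p] integrable_poly_exp[of q]
  by (simp add: expint_def distrib_left)

lemma expint_diff: "expint (p - q) = expint p - expint q"
  using integrable_poly_exp[of p] integrable_poly_exp[of q]
  by (simp add: expint_def right_diff_distrib)

lemma expint_monom: "expint (monom c k) = c * fact k"
  using has_bochner_integral_mult_right[OF has_bochner_integral_power_exp[of k], of c]
  by (simp add: expint_def poly_monom has_bochner_integral_iff mult_ac)

lemma expint_sum: "expint (\<Sum>i\<in>A. f i) = (\<Sum>i\<in>A. expint (f i))"
  by (induction A rule: infinite_finite_induct) (simp_all add: expint_add, simp_all add: expint_def)

lemma expint_smult: "expint (smult c p) = c * expint p"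
  by (simp add: expint_def mult.left_commute)

text \<open>Integration by parts on the half line, checked on monomials, where it amounts to
  \<open>k! = k * (k - 1)!\<close> for \<open>k > 0\<close>.\<close>

lemma expint_diff_pderiv: "expint (p - pderiv p) = poly p 0"
proof -
  have *: "expint (monom c k - pderiv (monom c k)) = poly (monom c k) 0" for c k
    by (cases k) (simp_all add: expint_diff expint_monom pderiv_monom poly_monom)
  have "p = (\<Sum>i\<le>degree p. monom (coeff p i) i)"
    by (simp add: poly_as_sum_of_monoms)
  \<comment> \<open>A separate \<open>q\<close> with free coefficients, because rewriting
    \<open>p\<close> by its own monomial sum would loop: the coefficients in that sum mention
    \<open>p\<close>.\<close>
  moreover have "expint (q - pderiv q) = poly q 0" if "q = (\<Sum>i\<le>n. monom (c i) i)" for q n c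
    
  proof -
    have "pderiv q = (\<Sum>i\<le>n. pderiv (monom (c i) i))"
      unfolding that by (induction n) (simp_all add: pderiv_add)
    then have "q - pderiv q = (\<Sum>i\<le>n. monom (c i) i - pderiv (monom (c i) i))"
      unfolding that by (simp add: sum_subtractf)
    then have "expint (q - pderiv q) = (\<Sum>i\<le>n. poly (monom (c i) i) 0)"
      by (simp only: expint_sum *)
    then show ?thesis by (simp add: that poly_sum)
  qed
  ultimately show ?thesis by blast
qed

text \<open>These are the Laguerre polynomials up to the sign \<open>(-1)\<^sup>n\<close>; their generating function is
  \<open>exp (t x / (1 + x)) / (1 + x)\<close>.\<close>

definition laguerre :: "nat \<Rightarrow> real poly" where
  "laguerre n = (\<Sum>k\<le>n. monom ((-1) ^ (n + k) * real (n choose k) / fact k) k)"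

lemma coeff_laguerre: "coeff (laguerre n) k = (-1) ^ (n + k) * real (n choose k) / fact k"
  by (auto simp: laguerre_def coeff_sum)

lemma laguerre_0: "laguerre 0 = 1"
  by (rule poly_eqI) (auto simp: coeff_laguerre coeff_1 split: nat.split)

text \<open>If \<open>G\<close> is the generating function, then
  \<open>(1 + x) G = exp (t x / (1 + x))\<close> has \<open>t\<close>-derivative \<open>x G\<close>
  and value 1 at \<open>t = 0\<close>. Comparing coefficients of \<open>x^(n+1)\<close> gives this
  lemma and the next one.\<close>

lemma pderiv_laguerre: "pderiv (laguerre (Suc n) + laguerre n) = laguerre n"
proof (rule poly_eqI)
  fix k
  show "coeff (pderiv (laguerre (Suc n) + laguerre n)) k = coeff (laguerre n) k"
    by (simp add: coeff_pderiv coeff_laguerre divide_simps del: of_nat_Suc)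
       (simp add: algebra_simps)
qed

lemma poly_laguerre_0: "poly (laguerre (Suc n) + laguerre n) 0 = 0"
  by (simp add: poly_0_coeff_0 coeff_laguerre)

text \<open>Both sides are the derivative at \<open>u = 1\<close> of the product of all
  \<open>u * f x + g x\<close>: after expansion over subsets the term of \<open>X\<close> carries
  \<open>u ^ card X\<close>, while the product rule differentiates one factor at a time.\<close>

lemma sum_card_prod_derivation:
  fixes f g :: "'i \<Rightarrow> 'a::{comm_ring_1}"
  assumes "finite A"
  shows "(\<Sum>X\<in>Pow A. of_nat (card X) * ((\<Prod>x\<in>X. f x) * (\<Prod>x\<in>A-X. g x)))
       = (\<Sum>i\<in>A. f i * (\<Prod>x\<in>A-{i}. f x + g x))"
  using assms
proof (induction A rule: finite_induct)
  case empty
  then show ?case by simp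
next
  case (insert a A)
  have inj: "inj_on (insert a) (Pow A)"
    using insert.hyps by (auto simp: inj_on_def)
  have disj: "Pow A \<inter> insert a ` Pow A = {}"
    using insert.hyps by auto
  let ?h = "\<lambda>A X. (\<Prod>x\<in>X. f x) * (\<Prod>x\<in>A-X. g x)"
  have 1: "?h (insert a A) X = g a * ?h A X" if "X \<subseteq> A" for X
  proof -
    have "insert a A - X = insert a (A - X)" "a \<notin> A - X" "finite (A - X)"
      using that insert.hyps by auto
    then show ?thesis by (simp add: mult_ac)
  qed
  have 2: "?h (insert a A) (insert a X) = f a * ?h A X" if "X \<subseteq> A" for X
  proof -
    have "insert a A - insert a X = A - X" "a \<notin> X" "finite X"
      using that insert.hyps by (auto intro: finite_subset)
    then show ?thesis by (simp add: mult_ac)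
  qed
  have 3: "card (insert a X) = Suc (card X)" if "X \<subseteq> A" for X
    using that insert.hyps by (subst card_insert_disjoint) (auto intro: finite_subset)
  have "(\<Sum>X\<in>Pow (insert a A). of_nat (card X) * ?h (insert a A) X)
      = (\<Sum>X\<in>Pow A. of_nat (card X) * ?h (insert a A) X)
        + (\<Sum>X\<in>Pow A. of_nat (card (insert a X)) * ?h (insert a A) (insert a X))"
    unfolding Pow_insert using insert.hyps
    by (subst sum.union_disjoint[OF _ _ disj]) (auto simp: sum.reindex[OF inj])
  also have "\<dots> = (\<Sum>X\<in>Pow A. of_nat (card X) * (g a * ?h A X))
        + (\<Sum>X\<in>Pow A. (1 + of_nat (card X)) * (f a * ?h A X))"
    by (intro arg_cong2[where f = "(+)"] sum.cong refl) (auto simp only: 1 2 3 Pow_iff of_nat_Suc)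
  also have "\<dots> = (f a + g a) * (\<Sum>X\<in>Pow A. of_nat (card X) * ?h A X) + f a * (\<Sum>X\<in>Pow A. ?h A X)"
    by (simp add: sum_distrib_left sum.distrib[symmetric] algebra_simps)
  also have "(\<Sum>X\<in>Pow A. ?h A X) = (\<Prod>x\<in>A. f x + g x)"
    using insert.hyps by (simp add: prod_add)
  also have "(f a + g a) * (\<Sum>X\<in>Pow A. of_nat (card X) * ?h A X)
      = (\<Sum>i\<in>A. f i * (\<Prod>x\<in>insert a A-{i}. f x + g x))"
    unfolding insert.IH sum_distrib_left
  proof (intro sum.cong refl)
    fix i assume "i \<in> A"
    then have "insert a A - {i} = insert a (A - {i})" "a \<notin> A - {i}"
      using insert.hyps by auto
    then show "(f a + g a) * (f i * (\<Prod>x\<in>A-{i}. f x + g x)) = f i * (\<Prod>x\<in>insert a A-{i}. f x + g x)"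
      using insert.hyps by (simp add: mult_ac)
  qed
  finally show ?case
    using insert.hyps by (simp add: add.commute)
qed

lemma pderiv_prod_fun:
  fixes f :: "'i \<Rightarrow> real poly"
  assumes "finite A"
  shows "pderiv (\<Prod>x\<in>A. f x) = (\<Sum>i\<in>A. pderiv (f i) * (\<Prod>x\<in>A-{i}. f x))"
  using pderiv_prod[of f A] assms by (simp add: mult.commute)

section \<open>Multiplication by the series \<open>Pser d\<close> on exponent vectors\<close>

definition indvec :: "nat set \<Rightarrow> nat \<Rightarrow> nat" where
  "indvec S = (\<lambda>j. if j \<in> S then 1 else 0)"

lemma indvec_eq_iff [simp]: "indvec S = indvec T \<longleftrightarrow> S = T"
proof
  assume "indvec S = indvec T"
  then have "indvec S j = indvec T j" for j by simp
  then have "j \<in> S \<longleftrightarrow> j \<in> T" for j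
    by (simp add: indvec_def split: if_splits) (metis zero_neq_one)
  then show "S = T" by blast
qed simp

text \<open>For the empty set \<open>card S - 1\<close> would be -1, so the missing constant term
  needs its own case; a singleton gets 0 from the formula, in agreement with a sum that starts at
  2.\<close>

lemma Pser_indvec:
  assumes "S \<subseteq> {..<d}"
  shows "Pser d (indvec S) = (if card S = 0 then 0 else real (card S) - 1)"
proof -
  have card: "card S \<le> d"
    using card_mono[OF _ assms] by simp
  have "esym d i (indvec S) = (if i = card S then 1 else 0)" for i
    using assms unfolding esym_def indvec_def[symmetric] by auto
  then have "Pser d (indvec S) = (\<Sum>i\<in>{2..d}. if i = card S then real (card S - 1) else 0)"
    unfolding Pser_def by (intro sum.cong) auto
  also have "\<dots> = (if card S = 0 then 0 else real (card S) - 1)"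
    using card by (auto simp: of_nat_diff)
  finally show ?thesis .
qed

lemma Pser_nonzeroD:
  assumes "Pser d a \<noteq> 0"
  obtains S where "S \<subseteq> {..<d}" "a = indvec S" "card S \<ge> 2"
proof -
  obtain i where i: "i \<in> {2..d}" "esym d i a \<noteq> 0"
    using assms unfolding Pser_def by (metis (no_types, lifting) mult_eq_0_iff sum.neutral)
  then show ?thesis
    using that by (auto simp: esym_def indvec_def[abs_def] split: if_splits)
qed

text \<open>Exponent vectors of monomials in \<open>d\<close> variables. The restriction matters
  because \<open>mps_mult\<close> sums over all vectors below \<open>m\<close>, and a sum over an
  infinite set is 0 by convention.\<close>

definition supported :: "nat \<Rightarrow> (nat \<Rightarrow> nat) \<Rightarrow> bool" where
  "supported d m \<longleftrightarrow> (\<forall>i\<ge>d. m i = 0)"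

lemma finite_below:
  assumes "supported d m"
  shows "finite {a. \<forall>i. a i \<le> (m i::nat)}"
proof -
  have "finite {f. \<forall>i. (i \<in> {..<d} \<longrightarrow> f i \<in> {..Max (m ` {..<d})}) \<and> (i \<notin> {..<d} \<longrightarrow> f i = (0::nat))}"
    by (intro finite_set_of_finite_funs) auto
  moreover have "{a. \<forall>i. a i \<le> m i} \<subseteq> \<dots>"
  proof (intro subsetI CollectI allI conjI impI)
    fix a i assume "a \<in> {a. \<forall>i. a i \<le> m i}" and i: "i \<in> {..<d}"
    then have a: "\<forall>i. a i \<le> m i" by simp
    have "m i \<le> Max (m ` {..<d})" using i by (intro Max_ge) auto
    then show "a i \<in> {..Max (m ` {..<d})}" using a le_trans by blast
  next
    fix a i assume "a \<in> {a. \<forall>i. a i \<le> m i}" "i \<notin> {..<d}"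
    then show "a i = 0" using assms unfolding supported_def
      by (metis (no_types, lifting) le_zero_eq lessThan_iff mem_Collect_eq not_le)
  qed
  ultimately show ?thesis by (rule rev_finite_subset)
qed

text \<open>All monomials of \<open>Pser d\<close> are squarefree, so subsets replace the summation
  vectors. Keeping \<open>S\<close> inside the support of \<open>m\<close> makes the truncated
  subtraction \<open>m i - indvec S i\<close> exact.\<close>

lemma Pser_mult_eq:
  assumes m: "supported d m"
  shows "mps_mult (Pser d) Q m
       = (\<Sum>S\<in>Pow {i\<in>{..<d}. m i \<noteq> 0}. (if S = {} then 0 else real (card S) - 1) * Q (\<lambda>i. m i - indvec S i))"
proof -
  let ?P = "Pow {i\<in>{..<d}. m i \<noteq> 0}"
  have inj: "inj_on indvec ?P" by (auto simp: inj_on_def)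
  have sub: "indvec ` ?P \<subseteq> {a. \<forall>i. a i \<le> m i}"
    by (auto simp: indvec_def)
  have "mps_mult (Pser d) Q m = (\<Sum>a\<in>indvec ` ?P. Pser d a * Q (\<lambda>i. m i - a i))"
    unfolding mps_mult_def
  proof (rule sum.mono_neutral_right[OF finite_below[OF m] sub])
    show "\<forall>a\<in>{a. \<forall>i. a i \<le> m i} - indvec ` ?P. Pser d a * Q (\<lambda>i. m i - a i) = 0"
    proof
      fix a assume a: "a \<in> {a. \<forall>i. a i \<le> m i} - indvec ` ?P"
      have "Pser d a = 0"
      proof (rule ccontr)
        assume "Pser d a \<noteq> 0"
        then obtain S where S: "S \<subseteq> {..<d}" "a = indvec S" by (rule Pser_nonzeroD)
        have "m i \<noteq> 0" if "i \<in> S" for i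
          using a that S(2) by (auto simp: indvec_def dest!: spec[of _ i])
        then have "S \<in> ?P" using S(1) by auto
        with S(2) a show False by blast
      qed
      then show "Pser d a * Q (\<lambda>i. m i - a i) = 0" by simp
    qed
  qed
  also have "\<dots> = (\<Sum>S\<in>?P. Pser d (indvec S) * Q (\<lambda>i. m i - indvec S i))"
    by (subst sum.reindex[OF inj]) simp
  also have "\<dots> = (\<Sum>S\<in>?P. (if S = {} then 0 else real (card S) - 1) * Q (\<lambda>i. m i - indvec S i))"
  proof (intro sum.cong refl)
    fix S assume "S \<in> ?P"
    then have "S \<subseteq> {..<d}" "finite S" by (auto intro: finite_subset)
    then show "Pser d (indvec S) * Q (\<lambda>i. m i - indvec S i)
             = (if S = {} then 0 else real (card S) - 1) * Q (\<lambda>i. m i - indvec S i)"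
      by (simp add: Pser_indvec)
  qed
  finally show ?thesis .
qed

text \<open>The predicted coefficient at \<open>m\<close> of the inverse of
  \<open>1 - Pser d\<close>: the variables separate under the integral and each contributes one
  Laguerre polynomial.\<close>

definition lagprod :: "nat \<Rightarrow> mps" where
  "lagprod d m = expint (\<Prod>i<d. laguerre (m i))"

text \<open>This is \<open>Q = 1 + P Q\<close> read at \<open>m\<close>. For the product
  \<open>p\<close> of the sums \<open>laguerre (m i) + laguerre (m i - 1)\<close>, every factor has
  derivative \<open>laguerre (m i - 1)\<close>. Hence \<open>p - pderiv p\<close> expands over
  subsets \<open>S\<close> with weight \<open>1 - card S\<close>, and its integral is the value of
  \<open>p\<close> at 0, which is 1 for \<open>m = 0\<close> and 0 otherwise.\<close>

lemma lagprod_rec: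
  assumes m: "supported d m"
  shows "lagprod d m = mps_one m + mps_mult (Pser d) (lagprod d) m"
proof -
  let ?I = "{..<d}" and ?N = "{i\<in>{..<d}. m i \<noteq> 0}"
  define A where "A i = laguerre (m i)" for i
  \<comment> \<open>At \<open>m i = 0\<close> this stands for the coefficient of index -1, hence 0;
    the factor \<open>B i + A i\<close> is then the constant 1, and its derivative is still
    \<open>B i\<close>.\<close>
  define B where "B i = (if m i = 0 then 0 else laguerre (m i - 1))" for i
  define h where "h S = (\<Prod>i\<in>S. B i) * (\<Prod>i\<in>?I-S. A i)" for S
  define p where "p = (\<Prod>i<d. B i + A i)"
  have pd: "pderiv (B i + A i) = B i" for i
    using pderiv_laguerre[of "m i - 1"]
    by (cases "m i") (auto simp: A_def B_def laguerre_0 add.commute)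
  have p0: "poly p 0 = mps_one m"
  proof -
    have "poly (B i + A i) 0 = (if m i = 0 then 1 else 0)" for i
      using poly_laguerre_0[of "m i - 1"]
      by (cases "m i") (auto simp: A_def B_def laguerre_0 add.commute)
    then have "poly p 0 = (\<Prod>i<d. if m i = 0 then 1 else 0)"
      unfolding p_def poly_prod by simp
    also have "\<dots> = mps_one m"
    proof (cases "m = (\<lambda>_. 0)")
      case False
      then obtain i where "m i \<noteq> 0" by auto
      moreover from this have "i < d" using m not_less by (auto simp: supported_def)
      ultimately have "(\<Prod>i<d. if m i = 0 then 1 else 0) = (0::real)"
        by (auto intro!: prod_zero)
      then show ?thesis using False by (simp add: mps_one_def)
    qed (simp add: mps_one_def)
    finally show ?thesis .
  qed
  have hS: "expint (h S) = lagprod d (\<lambda>i. m i - indvec S i)" if "S \<subseteq> ?N" for S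
  proof -
    have "S \<subseteq> ?I" using that by auto
    have "(\<Prod>i<d. laguerre (m i - indvec S i)) = (\<Prod>i\<in>S \<union> (?I - S). laguerre (m i - indvec S i))"
      using \<open>S \<subseteq> ?I\<close> by (simp add: Un_absorb1)
    also have "\<dots> = (\<Prod>i\<in>S. laguerre (m i - indvec S i)) * (\<Prod>i\<in>?I-S. laguerre (m i - indvec S i))"
      using \<open>S \<subseteq> ?I\<close> by (intro prod.union_disjoint) (auto intro: finite_subset)
    also have "\<dots> = h S"
      unfolding h_def using that
      by (intro arg_cong2[where f = "(*)"] prod.cong refl) (auto simp: A_def B_def indvec_def)
    finally show ?thesis by (simp add: lagprod_def)
  qed
  have h0: "h S = 0" if "S \<subseteq> ?I" "\<not> S \<subseteq> ?N" for S
  proof -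
    have "\<exists>i\<in>S. B i = 0" "finite S"
      using that by (auto simp: B_def intro: finite_subset)
    then have "prod B S = 0" by (meson prod_zero)
    then show ?thesis by (simp add: h_def)
  qed
  have "p - pderiv p = (\<Sum>S\<in>Pow ?I. h S) - (\<Sum>S\<in>Pow ?I. of_nat (card S) * h S)"
    unfolding p_def h_def
    by (subst pderiv_prod_fun, simp, subst sum_card_prod_derivation, simp, subst prod_add) (simp_all add: pd)
  also have "\<dots> = (\<Sum>S\<in>Pow ?I. smult (1 - real (card S)) (h S))"
    by (simp add: sum_subtractf[symmetric] smult_diff_left of_nat_poly)
  also have "\<dots> = (\<Sum>S\<in>Pow ?N. smult (1 - real (card S)) (h S))"
    by (rule sum.mono_neutral_right) (auto simp: h0)
  finally have "poly p 0 = (\<Sum>S\<in>Pow ?N. (1 - real (card S)) * expint (h S))"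
    unfolding expint_diff_pderiv[symmetric] by (simp add: expint_sum expint_smult)
  also have "\<dots> = (\<Sum>S\<in>Pow ?N. (1 - real (card S)) * lagprod d (\<lambda>i. m i - indvec S i))"
    by (intro sum.cong refl) (simp add: hS)
  \<comment> \<open>The empty set has weight 1 and returns \<open>lagprod d m\<close> itself; every
    other weight is the negative of a coefficient of \<open>Pser d\<close>.\<close>
  also have "\<dots> = (\<Sum>S\<in>Pow ?N. (if S = {} then lagprod d m else 0)
        - (if S = {} then 0 else real (card S) - 1) * lagprod d (\<lambda>i. m i - indvec S i))"
    by (intro sum.cong refl) (auto simp: algebra_simps indvec_def)
  also have "\<dots> = lagprod d m - mps_mult (Pser d) (lagprod d) m"
    by (simp add: sum_subtractf Pser_mult_eq[OF m])
  finally show ?thesis using p0 by simp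
qed

lemma sum_diff_indvec_less:
  assumes "supported d m" "S \<subseteq> {i\<in>{..<d}. m i \<noteq> 0}" "S \<noteq> {}"
  shows "(\<Sum>i<d. m i - indvec S i) < (\<Sum>i<d. m i)"
proof -
  obtain i where i: "i \<in> S" using assms(3) by blast
  show ?thesis
  proof (rule sum_strict_mono_ex1)
    show "\<exists>i\<in>{..<d}. m i - indvec S i < m i"
      using i assms(2) by (intro bexI[of _ i]) (auto simp: indvec_def)
  qed auto
qed

lemma mps_pow_Suc: "mps_pow f (Suc k) = mps_mult f (mps_pow f k)"
  by (simp add: mps_pow_def)

lemma mps_mult_sum_right: "mps_mult f (\<lambda>m. \<Sum>k\<in>K. g k m) m = (\<Sum>k\<in>K. mps_mult f (g k) m)"
  unfolding mps_mult_def by (simp add: sum_distrib_left sum.swap[of _ K])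

text \<open>The recursion determines its solution because \<open>Pser d\<close> has no constant
  term: each unfolding lowers the total degree, and the truncated geometric series unfolds in the
  same way.\<close>

lemma inv_one_minus_Pser:
  assumes "supported d m"
  shows "inv_one_minus d (Pser d) m = lagprod d m"
proof -
  \<comment> \<open>An arbitrary bound \<open>K\<close> in place of the total degree lets all
    vectors \<open>m - indvec S\<close> share one truncated series in the induction step, whatever
    the size of \<open>S\<close>.\<close>
  have "lagprod d m = (\<Sum>k\<le>K. mps_pow (Pser d) k m)" if "supported d m" "(\<Sum>i<d. m i) \<le> K" for K m
    using that
  proof (induction K arbitrary: m)
    case 0
    then have "m = (\<lambda>_. 0)"
      by (intro ext) (metis (no_types) bot_nat_0.extremum_uniqueI finite_lessThan lessThan_iff
          not_le sum_nonneg_eq_0_iff supported_def zero_le)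
    moreover have "lagprod d (\<lambda>_. 0) = 1"
      using expint_monom[of 1 0] by (simp add: lagprod_def laguerre_0 flip: one_pCons)
    ultimately show ?case by (simp add: mps_pow_def mps_one_def)
  next
    case (Suc K)
    have "lagprod d m = mps_one m + mps_mult (Pser d) (lagprod d) m"
      by (rule lagprod_rec) fact
    also have "mps_mult (Pser d) (lagprod d) m
        = mps_mult (Pser d) (\<lambda>m. \<Sum>k\<le>K. mps_pow (Pser d) k m) m"
      unfolding Pser_mult_eq[OF Suc.prems(1)]
    proof (intro sum.cong refl)
      fix S assume S: "S \<in> Pow {i\<in>{..<d}. m i \<noteq> 0}"
      show "(if S = {} then 0 else real (card S) - 1) * lagprod d (\<lambda>i. m i - indvec S i)
          = (if S = {} then 0 else real (card S) - 1) * (\<Sum>k\<le>K. mps_pow (Pser d) k (\<lambda>i. m i - indvec S i))"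
      \<comment> \<open>For empty \<open>S\<close> the degree does not drop, but there the weight is
        0.\<close>
      proof (cases "S = {}")
        case False
        have "(\<Sum>i<d. m i - indvec S i) < (\<Sum>i<d. m i)"
          using S False Suc.prems by (intro sum_diff_indvec_less) auto
        then have "lagprod d (\<lambda>i. m i - indvec S i) = (\<Sum>k\<le>K. mps_pow (Pser d) k (\<lambda>i. m i - indvec S i))"
          using Suc.prems by (intro Suc.IH) (auto simp: supported_def)
        then show ?thesis by simp
      qed simp
    qed
    also have "\<dots> = (\<Sum>k\<le>K. mps_pow (Pser d) (Suc k) m)"
      by (simp add: mps_mult_sum_right mps_pow_Suc)
    also have "mps_one m + \<dots> = (\<Sum>k\<le>Suc K. mps_pow (Pser d) k m)"
      unfolding sum.atMost_Suc_shift by (simp add: mps_pow_def)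
    finally show ?case .
  qed
  from this[OF assms order_refl] show ?thesis
    by (simp add: inv_one_minus_def)
qed

section \<open>The factors \<open>x / (1 - x)\<close> and the diagonal coefficient\<close>

lemma foldr_geomX:
  assumes "distinct xs" "supported d b"
  shows "foldr mps_mult (map geomX xs) mps_one b
       = (if (\<forall>i\<in>set xs. b i \<ge> 1) \<and> (\<forall>i. i \<notin> set xs \<longrightarrow> b i = 0) then 1 else 0)"
  using assms
proof (induction xs arbitrary: b)
  case Nil
  have "b = (\<lambda>_. 0) \<longleftrightarrow> (\<forall>i. b i = 0)" by auto
  then show ?case by (simp add: mps_one_def)
next
  case (Cons x xs)
  define G where "G = foldr mps_mult (map geomX xs) mps_one"
  \<comment> \<open>The remaining factors do not involve the variable \<open>x\<close>, so
    \<open>geomX x\<close> has to absorb the whole exponent \<open>b x\<close>: a single vector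
    survives in the convolution.\<close>
  define a0 where "a0 = (\<lambda>i. if i = x then b x else 0)"
  have G: "G (\<lambda>i. b i - a i)
       = (if (\<forall>i\<in>set xs. b i - a i \<ge> 1) \<and> (\<forall>i. i \<notin> set xs \<longrightarrow> b i - a i = 0) then 1 else 0)" for a
    unfolding G_def using Cons.prems by (intro Cons.IH) (auto simp: supported_def)
  have "mps_mult (geomX x) G b = (\<Sum>a\<in>{a0}. geomX x a * G (\<lambda>i. b i - a i))"
    unfolding mps_mult_def
  proof (rule sum.mono_neutral_right[OF finite_below[OF Cons.prems(2)]])
    show "\<forall>a\<in>{a. \<forall>i. a i \<le> b i} - {a0}. geomX x a * G (\<lambda>i. b i - a i) = 0"
    proof
      fix a assume a: "a \<in> {a. \<forall>i. a i \<le> b i} - {a0}"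
      show "geomX x a * G (\<lambda>i. b i - a i) = 0"
      proof (rule ccontr)
        assume "geomX x a * G (\<lambda>i. b i - a i) \<noteq> 0"
        then have "1 \<le> a x" "\<forall>j. j \<noteq> x \<longrightarrow> a j = 0" "\<forall>i. i \<notin> set xs \<longrightarrow> b i - a i = 0"
          unfolding G geomX_def by (auto split: if_splits)
        moreover have "x \<notin> set xs" using Cons.prems by simp
        ultimately have "a = a0" using a unfolding a0_def by (intro ext) (auto intro: le_antisym)
        with a show False by simp
      qed
    qed
  qed (auto simp: a0_def)
  also have "\<dots> = (if (\<forall>i\<in>set (x # xs). b i \<ge> 1) \<and> (\<forall>i. i \<notin> set (x # xs) \<longrightarrow> b i = 0) then 1 else 0)"
    using Cons.prems(1) by (auto simp: G geomX_def a0_def split: if_splits)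
  finally show ?case by (simp add: G_def)
qed

text \<open>Each factor \<open>x_i / (1 - x_i)\<close> uses at least one power of \<open>x_i\<close>
  and admits every larger one with coefficient 1. The diagonal coefficient is therefore a sum over
  all exponents strictly below \<open>n\<close>, and a sum of products over a box is a product of
  sums.\<close>

lemma C_eq_expint: "C d n = expint ((\<Sum>j<n. laguerre j) ^ d)"
proof -
  let ?m = "\<lambda>i. if i < d then n else 0"
  have m: "supported d ?m" by (simp add: supported_def)
  define E where "E = {a. \<forall>i. (i < d \<longrightarrow> a i < n) \<and> (\<not> i < d \<longrightarrow> a i = 0)}"
  \<comment> \<open>Vectors in \<open>E\<close> are 0 outside the \<open>d\<close> variables,
    elements of \<open>PiE\<close> are \<open>undefined\<close> there; restriction is the bijection
    between the two conventions.\<close>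
  have EI: "(\<lambda>a. restrict a {..<d}) ` E = PiE {..<d} (\<lambda>_. {..<n})"
  proof (intro equalityI subsetI)
    fix g assume g: "g \<in> PiE {..<d} (\<lambda>_. {..<n})"
    show "g \<in> (\<lambda>a. restrict a {..<d}) ` E"
    proof (rule image_eqI)
      show "g = restrict (\<lambda>i. if i < d then g i else 0) {..<d}"
        using g by (auto simp: fun_eq_iff PiE_def extensional_def)
      show "(\<lambda>i. if i < d then g i else 0) \<in> E"
        using g by (auto simp: E_def)
    qed
  qed (auto simp: E_def PiE_def)
  have inj: "inj_on (\<lambda>a. restrict a {..<d}) E"
  proof (rule inj_onI, rule ext)
    fix a b i assume ab: "a \<in> E" "b \<in> E" "restrict a {..<d} = restrict b {..<d}"
    then show "a i = b i"
      by (cases "i < d") (auto simp: E_def restrict_def dest: fun_cong[of _ _ i])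
  qed
  have "C d n = (\<Sum>a\<in>{a. \<forall>i. a i \<le> ?m i}. lagprod d a * (if a \<in> E then 1 else 0))"
    unfolding C_def A_ser_def mps_mult_def
  proof (intro sum.cong refl arg_cong2[where f = "(*)"])
    fix a assume a: "a \<in> {a. \<forall>i. a i \<le> ?m i}"
    then have sa: "supported d a" by (auto simp: supported_def not_le split: if_splits) (metis le_zero_eq linorder_not_less)
    show "inv_one_minus d (Pser d) a = lagprod d a"
      by (rule inv_one_minus_Pser[OF sa])
    have "prod_geomX d (\<lambda>i. ?m i - a i)
        = (if (\<forall>i\<in>{..<d}. ?m i - a i \<ge> 1) \<and> (\<forall>i. i \<notin> {..<d} \<longrightarrow> ?m i - a i = 0) then 1 else 0)"
      unfolding prod_geomX_def
      by (subst foldr_geomX[where d = d]) (auto simp: supported_def)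
    also have "\<dots> = (if a \<in> E then 1 else 0)"
      using sa by (auto simp: E_def supported_def Suc_le_eq)
    finally show "prod_geomX d (\<lambda>i. ?m i - a i) = (if a \<in> E then 1 else 0)" .
  qed
  also have "\<dots> = (\<Sum>a\<in>E. lagprod d a)"
  proof -
    have "E \<subseteq> {a. \<forall>i. a i \<le> ?m i}" by (auto simp: E_def intro: less_imp_le)
    then have "(\<Sum>a\<in>E. lagprod d a) = (\<Sum>a\<in>{a. \<forall>i. a i \<le> ?m i}. if a \<in> E then lagprod d a else 0)"
      using finite_below[OF m] by (subst sum.inter_restrict[symmetric]) (auto simp: Int_absorb1)
    then show ?thesis by (simp add: if_distrib cong: if_cong)
  qed
  also have "\<dots> = (\<Sum>a\<in>E. expint (\<Prod>i<d. laguerre (restrict a {..<d} i)))"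
    by (simp add: lagprod_def)
  also have "\<dots> = expint (\<Sum>g\<in>PiE {..<d} (\<lambda>_. {..<n}). \<Prod>i<d. laguerre (g i))"
    unfolding expint_sum EI[symmetric] by (subst sum.reindex[OF inj]) simp
  also have "\<dots> = expint ((\<Sum>j<n. laguerre j) ^ d)"
    by (subst prod_sum_PiE[symmetric]) auto
  finally show ?thesis .
qed

subsection \<open>Cauchy integrals for sums of Laguerre polynomials\<close>

text \<open>\<open>circlepath\<close> starts at angle 0. Starting at \<open>-pi\<close> instead puts
  the saddle point, at angle 0, into the interior of the interval of integration.\<close>

lemma shiftpath_circlepath: "shiftpath (1/2) (circlepath z r) = part_circlepath z r (-pi) pi"
proof
  fix x :: real
  define w where "w = 2 * complex_of_real pi * \<i> * of_real x"
  have 1: "exp (w + of_real pi * \<i>) = - exp w" "exp (w - of_real pi * \<i>) = - exp w"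
    by (simp_all add: exp_add exp_diff)
  have 2: "2 * of_real pi * \<i> * of_real (1/2 + x) = w + of_real pi * \<i>"
    "2 * of_real pi * \<i> * of_real (1/2 + x - 1) = w - of_real pi * \<i>"
    "\<i> * of_real (linepath (-pi) pi x) = w - of_real pi * \<i>"
    by (simp_all add: w_def linepath_def algebra_simps)
  show "shiftpath (1/2) (circlepath z r) x = part_circlepath z r (-pi) pi x"
    by (simp only: shiftpath_def circlepath part_circlepath_def 1 2 if_cancel)
qed

lemma Cauchy_coefficient_integral:
  fixes f :: "complex \<Rightarrow> complex"
  assumes f: "f holomorphic_on ball 0 R" and r: "0 < r" "r < R"
  shows "(deriv ^^ k) f 0 / fact k
       = (1 / (2 * pi)) * (LINT \<theta>:{-pi..pi}|lborel. f (of_real r * cis \<theta>) / (of_real r * cis \<theta>) ^ k)"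
proof -
  let ?I = "(2 * pi * \<i>) / (fact k) * (deriv ^^ k) f 0"
  have sub: "cball 0 r \<subseteq> ball (0::complex) R" using r by auto
  have cont: "continuous_on {-pi..pi} (\<lambda>\<theta>. f (of_real r * cis \<theta>) / (of_real r * cis \<theta>) ^ k)"
  proof (intro continuous_intros)
    show "continuous_on {-pi..pi} (\<lambda>\<theta>. f (of_real r * cis \<theta>))"
      using r by (intro continuous_on_compose2[OF holomorphic_on_imp_continuous_on[OF f]] continuous_intros)
        (auto simp: norm_mult)
  qed (use r in auto)
  have "((\<lambda>u. f u / (u-0) ^ (Suc k)) has_contour_integral ?I) (circlepath 0 r)"
    using f r sub by (intro Cauchy_has_contour_integral_higher_derivative_circlepath
        holomorphic_on_imp_continuous_on) (auto intro: holomorphic_on_subset)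
  then have "((\<lambda>u. f u / u ^ (Suc k)) has_contour_integral ?I) (shiftpath (1/2) (circlepath 0 r))"
    by (intro has_contour_integral_shiftpath) auto
  then have "((\<lambda>\<theta>. f (of_real r * cis \<theta>) / (of_real r * cis \<theta>) ^ Suc k * r * \<i> * cis \<theta>) has_integral ?I) {-pi..pi}"
    unfolding shiftpath_circlepath by (subst (asm) has_contour_integral_part_circlepath_iff) auto
  then have "((\<lambda>\<theta>. \<i> * (f (of_real r * cis \<theta>) / (of_real r * cis \<theta>) ^ k)) has_integral ?I) {-pi..pi}"
    by (rule has_integral_eq[rotated]) (use r in \<open>simp add: field_simps\<close>)
  from has_integral_mult_right[OF this, of "- \<i>"]
  have "((\<lambda>\<theta>. f (of_real r * cis \<theta>) / (of_real r * cis \<theta>) ^ k) has_integral (- \<i> * ?I)) {-pi..pi}"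
    by (simp add: mult.assoc[symmetric])
  then have "integral {-pi..pi} (\<lambda>\<theta>. f (of_real r * cis \<theta>) / (of_real r * cis \<theta>) ^ k) = - \<i> * ?I"
    by (rule integral_unique)
  moreover have "(LINT \<theta>:{-pi..pi}|lborel. f (of_real r * cis \<theta>) / (of_real r * cis \<theta>) ^ k)
      = integral {-pi..pi} (\<lambda>\<theta>. f (of_real r * cis \<theta>) / (of_real r * cis \<theta>) ^ k)"
    by (rule set_borel_integral_eq_integral(2)[OF borel_integrable_atLeastAtMost'[OF cont]])
  ultimately have "(LINT \<theta>:{-pi..pi}|lborel. f (of_real r * cis \<theta>) / (of_real r * cis \<theta>) ^ k)
      = (- (\<i> * \<i>)) * (2 * pi / fact k * (deriv ^^ k) f 0)"
    by (simp add: field_simps del: i_squared i_times_eq_iff)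
  then show ?thesis by simp
qed

text \<open>The series is \<open>x^k / (1 + x)^(k+1)\<close>. After multiplication by
  \<open>1 + x\<close> the passage from \<open>k\<close> to \<open>k + 1\<close> is Pascal's
  rule.\<close>

lemma fps_power_times_inverse:
  fixes U V :: "complex fps"
  defines "V \<equiv> inverse (1 + fps_X)"
  defines "U \<equiv> fps_X * V"
  shows "U ^ k * V = Abs_fps (\<lambda>n. (-1) ^ (n + k) * of_nat (n choose k))"
proof -
  define B :: "nat \<Rightarrow> complex fps" where "B k = Abs_fps (\<lambda>n. (-1) ^ (n + k) * of_nat (n choose k))" for k
  have V: "V * (1 + fps_X) = 1"
    unfolding V_def by (rule inverse_mult_eq_1) simp
  have X: "fps_nth ((1 + fps_X) * F) n = fps_nth F n + (if n = 0 then 0 else fps_nth F (n - 1))" for F :: "complex fps" and n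
    by (simp add: distrib_right)
  have "(1 + fps_X) * B 0 = 1"
  proof (rule fps_ext)
    show "fps_nth ((1 + fps_X) * B 0) n = fps_nth 1 n" for n
      unfolding X by (cases n) (auto simp: B_def)
  qed
  then have B0: "B 0 = V" using V by (metis mult.assoc mult.commute mult_1)
  have BS: "B (Suc k) = U * B k" for k
  proof -
    have "(1 + fps_X) * B (Suc k) = fps_X * B k"
    proof (rule fps_ext)
      show "fps_nth ((1 + fps_X) * B (Suc k)) n = fps_nth (fps_X * B k) n" for n
        unfolding X by (cases n) (auto simp: B_def algebra_simps)
    qed
    then have "V * ((1 + fps_X) * B (Suc k)) = V * (fps_X * B k)" by simp
    then have "(V * (1 + fps_X)) * B (Suc k) = (fps_X * V) * B k" by (simp only: mult_ac)
    then show ?thesis unfolding V U_def by simp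
  qed
  have "U ^ k * V = B k"
    by (induction k) (simp_all add: B0 BS mult.assoc)
  then show ?thesis by (simp add: B_def)
qed

lemma laguerre_generating:
  fixes t :: real
  shows "(fps_exp (of_real t) oo (fps_X * inverse (1 + fps_X))) * inverse (1 + fps_X)
       = Abs_fps (\<lambda>n. complex_of_real (poly (laguerre n) t))"
proof (rule fps_ext)
  fix n
  let ?V = "inverse (1 + fps_X) :: complex fps"
  let ?U = "fps_X * ?V"
  let ?e = "fps_exp (complex_of_real t)"
  have U: "fps_nth (?U ^ i) m = 0" if "m < i" for i m
    using startsby_zero_power_prefix[of ?U i] that by auto
  have "fps_nth ((?e oo ?U) * ?V) n = (\<Sum>m=0..n. (\<Sum>i=0..m. fps_nth ?e i * fps_nth (?U ^ i) m) * fps_nth ?V (n - m))"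
    by (simp add: fps_mult_nth fps_compose_nth)
  \<comment> \<open>\<open>?U ^ i\<close> starts at degree \<open>i\<close>, so the inner sum may
    run up to \<open>n\<close> for every \<open>m\<close>; the two sums become independent and can
    be exchanged.\<close>
  also have "\<dots> = (\<Sum>m=0..n. (\<Sum>i=0..n. fps_nth ?e i * fps_nth (?U ^ i) m) * fps_nth ?V (n - m))"
    by (intro sum.cong refl arg_cong2[where f = "(*)"] sum.mono_neutral_left) (auto simp: U)
  also have "\<dots> = (\<Sum>i=0..n. fps_nth ?e i * fps_nth (?U ^ i * ?V) n)"
    unfolding sum_distrib_right fps_mult_nth sum_distrib_left
    by (subst sum.swap) (simp add: mult.assoc)
  also have "\<dots> = (\<Sum>i\<le>n. of_real t ^ i / fact i * ((-1) ^ (n + i) * of_nat (n choose i)))"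
    unfolding fps_power_times_inverse by (simp add: atLeast0AtMost)
  also have "\<dots> = complex_of_real (poly (laguerre n) t)"
    by (simp add: laguerre_def poly_sum poly_monom mult_ac)
  finally show "fps_nth ((?e oo ?U) * ?V) n = fps_nth (Abs_fps (\<lambda>n. complex_of_real (poly (laguerre n) t))) n"
    by simp
qed

text \<open>The factor \<open>1 / (1 - z)\<close> turns coefficients into partial sums.\<close>

lemma laguerre_sum_coefficient:
  fixes t :: real
  defines "F \<equiv> \<lambda>z::complex. exp (of_real t * (z * inverse (1 + z))) * inverse (1 + z) * inverse (1 - z)"
  shows "(deriv ^^ n) F 0 / fact n = complex_of_real (poly (\<Sum>j\<le>n. laguerre j) t)"
proof -
  have *: "F has_fps_expansion (fps_exp (of_real t) oo (fps_X * inverse (1 + fps_X))) * inverse (1 + fps_X) * inverse (1 - fps_X)"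
    unfolding F_def
    by (intro fps_expansion_intros has_fps_expansion_compose[OF has_fps_expansion_exp, unfolded o_def]) auto
  have inv: "inverse (1 - fps_X :: complex fps) = Abs_fps (\<lambda>_. 1)"
    by (rule fps_inverse_one_minus_fps_X)
  have "(deriv ^^ n) F 0 / fact n = fps_nth (Abs_fps (\<lambda>n. complex_of_real (poly (laguerre n) t)) * Abs_fps (\<lambda>_. 1)) n"
    using fps_nth_fps_expansion[OF *, of n] unfolding laguerre_generating inv by simp
  also have "\<dots> = complex_of_real (poly (\<Sum>j\<le>n. laguerre j) t)"
    by (simp add: fps_mult_nth poly_sum atLeast0AtMost)
  finally show ?thesis .
qed

text \<open>The top index of the sum is \<open>n - 1\<close>. The power of \<open>z\<close> saved
  there goes into the amplitude \<open>z / (1 - z^2)\<close>, so that the part with large parameters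
  is exactly \<open>exp (t z / (1 + z)) / z^n\<close>.\<close>

lemma laguerre_sum_integral:
  assumes r: "0 < r" "r < 1" and n: "n > 0"
  shows "complex_of_real (poly (\<Sum>j<n. laguerre j) t)
       = (1 / (2 * pi)) * (LINT \<theta>:{-pi..pi}|lborel.
           (let z = of_real r * cis \<theta> in exp (of_real t * (z / (1 + z))) * (z / (1 - z\<^sup>2)) / z ^ n))"
proof -
  obtain k where k: "n = Suc k" using n by (cases n) auto
  define F where "F z = exp (of_real t * (z * inverse (1 + z))) * inverse (1 + z) * inverse (1 - z)" for z :: complex
  have nz: "1 + z \<noteq> 0" "1 - z \<noteq> 0" if "norm z < 1" for z :: complex
    using that by (auto simp: add_eq_0_iff)
  have hol: "F holomorphic_on ball 0 1"
    unfolding F_def using nz by (intro holomorphic_intros) auto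
  have "complex_of_real (poly (\<Sum>j<n. laguerre j) t) = (deriv ^^ k) F 0 / fact k"
    using laguerre_sum_coefficient[of k t] by (simp add: F_def[abs_def] k lessThan_Suc_atMost)
  also have "\<dots> = (1 / (2 * pi)) * (LINT \<theta>:{-pi..pi}|lborel. F (of_real r * cis \<theta>) / (of_real r * cis \<theta>) ^ k)"
    by (rule Cauchy_coefficient_integral[OF hol r])
  also have "(\<lambda>\<theta>. F (of_real r * cis \<theta>) / (of_real r * cis \<theta>) ^ k)
      = (\<lambda>\<theta>. let z = of_real r * cis \<theta> in exp (of_real t * (z / (1 + z))) * (z / (1 - z\<^sup>2)) / z ^ n)"
  proof
    fix \<theta>
    define z where "z = of_real r * cis \<theta>"
    have z: "norm z = r" using r by (simp add: z_def norm_mult)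
    then have "z \<noteq> 0" "1 + z \<noteq> 0" "1 - z \<noteq> 0" using r nz[of z] by auto
    moreover have "1 - z\<^sup>2 = (1 + z) * (1 - z)" by (simp add: algebra_simps power2_eq_square)
    ultimately have "F z / z ^ k = exp (of_real t * (z / (1 + z))) * (z / (1 - z\<^sup>2)) / z ^ n"
      unfolding F_def k by (simp add: divide_simps)
    then show "F (of_real r * cis \<theta>) / (of_real r * cis \<theta>) ^ k = (let z = of_real r * cis \<theta> in exp (of_real t * (z / (1 + z))) * (z / (1 - z\<^sup>2)) / z ^ n)"
      unfolding Let_def z_def .
  qed
  finally show ?thesis .
qed

subsection \<open>Gaussian integrals and elementary estimates\<close>

lemma has_bochner_integral_gaussian:
  assumes "k > 0"
  shows "has_bochner_integral lborel (\<lambda>y::real. exp (- (k * y\<^sup>2))) (sqrt (pi / k))"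
proof -
  define \<sigma> where "\<sigma> = sqrt (1 / (2 * k))"
  have \<sigma>: "\<sigma> > 0" "\<sigma>\<^sup>2 = 1 / (2 * k)" using assms by (auto simp: \<sigma>_def)
  have "has_bochner_integral lborel (\<lambda>y. sqrt (pi / k) * normal_density 0 \<sigma> y) (sqrt (pi / k) * 1)"
    using \<sigma> by (intro has_bochner_integral_mult_right) (auto simp: has_bochner_integral_iff)
  also have "(\<lambda>y. sqrt (pi / k) * normal_density 0 \<sigma> y) = (\<lambda>y. exp (- (k * y\<^sup>2)))"
    using assms by (auto simp: normal_density_def \<sigma>(2) fun_eq_iff)
  finally show ?thesis by simp
qed

text \<open>The characteristic function of the standard normal law after scaling by
  \<open>sqrt \<beta>\<close>.\<close>

lemma gaussian_fourier:
  fixes \<beta> x :: real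
  assumes "\<beta> > 0"
  shows "(LINT y|lborel. exp (\<i> * of_real (x * y) - of_real (\<beta> * y\<^sup>2 / 2)))
       = complex_of_real (sqrt (2 * pi / \<beta>) * exp (- x\<^sup>2 / (2 * \<beta>)))"
proof -
  let ?c = "sqrt \<beta>"
  have c: "?c > 0" "?c\<^sup>2 = \<beta>" using assms by auto
  have "complex_of_real (exp (- (x / ?c)\<^sup>2 / 2)) = char std_normal_distribution (x / ?c)"
    by (simp add: char_std_normal_distribution)
  also have "\<dots> = (LINT y|lborel. std_normal_density y *\<^sub>R iexp (x / ?c * y))"
    unfolding char_def by (subst integral_density) (auto simp: normal_density_nonneg)
  also have "\<dots> = ?c * (LINT y|lborel. std_normal_density (0 + ?c * y) *\<^sub>R iexp (x / ?c * (0 + ?c * y)))"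
    using c by (subst lborel_integral_real_affine[where t = 0 and c = ?c]) (auto simp: scaleR_conv_of_real)
  also have "(\<lambda>y. std_normal_density (0 + ?c * y) *\<^sub>R iexp (x / ?c * (0 + ?c * y)))
      = (\<lambda>y. of_real (1 / sqrt (2 * pi)) * exp (\<i> * of_real (x * y) - of_real (\<beta> * y\<^sup>2 / 2)))"
  proof
    fix y :: real
    have "x / ?c * (0 + ?c * y) = x * y" "(0 + ?c * y)\<^sup>2 = \<beta> * y\<^sup>2"
      using c by (auto simp: power_mult_distrib)
    moreover have "complex_of_real ?c ^ 2 = of_real \<beta>" using c(2) by (metis of_real_power)
    ultimately show "std_normal_density (0 + ?c * y) *\<^sub>R iexp (x / ?c * (0 + ?c * y))
      = of_real (1 / sqrt (2 * pi)) * exp (\<i> * of_real (x * y) - of_real (\<beta> * y\<^sup>2 / 2))"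
      unfolding std_normal_density_def exp_diff
      by (simp add: scaleR_conv_of_real exp_minus exp_of_real[symmetric] field_simps)
  qed
  finally have "complex_of_real (exp (- x\<^sup>2 / (2 * \<beta>)))
      = of_real (?c / sqrt (2 * pi)) * (LINT y|lborel. exp (\<i> * of_real (x * y) - of_real (\<beta> * y\<^sup>2 / 2)))"
    using c by (simp add: power_divide mult.commute)
  moreover have "sqrt (2 * pi / \<beta>) * (?c / sqrt (2 * pi)) = 1"
    using c assms by (simp add: real_sqrt_divide)
  then have "complex_of_real (sqrt (2 * pi / \<beta>)) * of_real (?c / sqrt (2 * pi)) = 1"
    by (metis of_real_1 of_real_mult)
  ultimately show ?thesis
    by (simp add: mult.assoc[symmetric])
qed

lemma power_le_exp_abs:
  assumes "k > 0"
  shows "\<exists>M>0. \<forall>s::real. (1 + \<bar>s\<bar>) ^ m \<le> M * exp (k * \<bar>s\<bar>)"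
proof (cases "m = 0")
  case True
  then show ?thesis using assms by (intro exI[of _ 1]) auto
next
  case False
  \<comment> \<open>Makes \<open>1 + |s|\<close> at most \<open>M * (1 + k * |s| / m)\<close>, hence
    at most \<open>M * exp (k * |s| / m)\<close>; then take \<open>m\<close>-th powers.\<close>
  define M where "M = max 1 (real m / k)"
  have M: "M \<ge> 1" "M * (k / m) \<ge> 1" 
    using False assms by (auto simp: M_def max_def field_simps)
  show ?thesis
  proof (intro exI[of _ "M ^ m"] conjI allI)
    fix s :: real
    have "1 * \<bar>s\<bar> \<le> M * (k / m) * \<bar>s\<bar>"
      using M(2) by (intro mult_right_mono) auto
    then have "1 + \<bar>s\<bar> \<le> M * (1 + k * \<bar>s\<bar> / m)"
      using M(1) by (simp add: distrib_left)
    also have "\<dots> \<le> M * exp (k * \<bar>s\<bar> / m)"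
      using M(1) by (intro mult_left_mono) (auto intro: exp_ge_add_one_self)
    finally have "(1 + \<bar>s\<bar>) ^ m \<le> (M * exp (k * \<bar>s\<bar> / m)) ^ m"
      by (intro power_mono) auto
    also have "\<dots> = M ^ m * exp (k * \<bar>s\<bar>)"
      using False by (simp add: power_mult_distrib exp_of_nat_mult[symmetric])
    finally show "(1 + \<bar>s\<bar>) ^ m \<le> M ^ m * exp (k * \<bar>s\<bar>)" .
  qed (use M in auto)
qed

lemma integrable_exp_neg_abs:
  assumes "k > 0"
  shows "integrable lborel (\<lambda>s::real. exp (- (k * \<bar>s\<bar>)))"
proof -
  have "has_bochner_integral lborel (\<lambda>t::real. indicator {0..} t *\<^sub>R exp (- \<bar>t\<bar>)) 1"
    using has_bochner_integral_power_exp[of 0]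
    by (rule has_bochner_integral_cong[THEN iffD1, rotated -1]) (auto simp: indicator_def)
  then have "has_bochner_integral lborel (\<lambda>t::real. exp (- \<bar>t\<bar>)) (2 * 1)"
    using has_bochner_integral_even_function[of "\<lambda>t::real. exp (- \<bar>t\<bar>)" 1] by simp
  then have "integrable lborel (\<lambda>t::real. exp (- \<bar>t\<bar>))"
    by (simp add: has_bochner_integral_iff)
  from lborel_integrable_real_affine[OF this, of k 0] show ?thesis
    using assms by (simp add: abs_mult)
qed

lemma integrable_power_exp_neg_abs:
  assumes "k > 0"
  shows "integrable lborel (\<lambda>s::real. (1 + \<bar>s\<bar>) ^ m * exp (- (k * \<bar>s\<bar>)))"
proof -
  obtain M where M: "M > 0" "\<And>s::real. (1 + \<bar>s\<bar>) ^ m \<le> M * exp (k / 2 * \<bar>s\<bar>)"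
    using power_le_exp_abs[of "k / 2" m] assms by auto
  show ?thesis
  proof (rule Bochner_Integration.integrable_bound)
    show "integrable lborel (\<lambda>s::real. M * exp (- (k / 2 * \<bar>s\<bar>)))"
      using assms by (intro integrable_mult_right integrable_exp_neg_abs) auto
    show "AE s in lborel. norm ((1 + \<bar>s\<bar>) ^ m * exp (- (k * \<bar>s\<bar>))) \<le> norm (M * exp (- (k / 2 * \<bar>s\<bar>)))"
    proof (rule AE_I2)
      fix s :: real
      have "(1 + \<bar>s\<bar>) ^ m * exp (- (k * \<bar>s\<bar>)) \<le> M * exp (k / 2 * \<bar>s\<bar>) * exp (- (k * \<bar>s\<bar>))"
        by (intro mult_right_mono M) auto
      also have "\<dots> = M * exp (- (k / 2 * \<bar>s\<bar>))"
        by (simp add: mult.assoc exp_add[symmetric])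
      finally show "norm ((1 + \<bar>s\<bar>) ^ m * exp (- (k * \<bar>s\<bar>))) \<le> norm (M * exp (- (k / 2 * \<bar>s\<bar>)))"
        using M(1) by (simp add: abs_mult)
    qed
  qed auto
qed

lemma exp_neg_square_le_exp_neg_abs:
  fixes y :: real
  assumes "k > 0" "l > 0"
  shows "exp (- (k * y\<^sup>2)) \<le> exp (l\<^sup>2 / (4 * k)) * exp (- (l * \<bar>y\<bar>))"
proof -
  have "0 \<le> k * (\<bar>y\<bar> - l / (2 * k))\<^sup>2" using assms by simp
  also have "\<dots> = k * y\<^sup>2 - l * \<bar>y\<bar> + l\<^sup>2 / (4 * k)"
    using assms by (simp add: power2_diff power_divide) (simp add: field_simps power2_eq_square)
  finally show ?thesis by (simp add: exp_add[symmetric])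
qed

lemma integrable_power_gaussian:
  assumes "k > 0"
  shows "integrable lborel (\<lambda>y::real. (1 + \<bar>y\<bar>) ^ m * exp (- (k * y\<^sup>2)))"
proof (rule Bochner_Integration.integrable_bound)
  show "integrable lborel (\<lambda>y::real. exp (1\<^sup>2 / (4 * k)) * ((1 + \<bar>y\<bar>) ^ m * exp (- (1 * \<bar>y\<bar>))))"
    by (intro integrable_mult_right integrable_power_exp_neg_abs) auto
  show "AE y in lborel. norm ((1 + \<bar>y\<bar>) ^ m * exp (- (k * y\<^sup>2)))
      \<le> norm (exp (1\<^sup>2 / (4 * k)) * ((1 + \<bar>y\<bar>) ^ m * exp (- (1 * \<bar>y\<bar>))))"
  proof (rule AE_I2)
    fix y :: real
    have "(1 + \<bar>y\<bar>) ^ m * exp (- (k * y\<^sup>2)) \<le> (1 + \<bar>y\<bar>) ^ m * (exp (1\<^sup>2 / (4 * k)) * exp (- (1 * \<bar>y\<bar>)))"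
      using assms by (intro mult_left_mono exp_neg_square_le_exp_neg_abs) auto
    then show "norm ((1 + \<bar>y\<bar>) ^ m * exp (- (k * y\<^sup>2)))
      \<le> norm (exp (1\<^sup>2 / (4 * k)) * ((1 + \<bar>y\<bar>) ^ m * exp (- (1 * \<bar>y\<bar>))))"
      by (simp add: abs_mult mult_ac)
  qed
qed auto

text \<open>The half plane \<open>Re z <= ln B\<close> is convex, so \<open>B\<close> bounds
  \<open>exp\<close> on the whole segment from \<open>w0\<close> to \<open>w\<close>. In the
  application \<open>B\<close> is a Gaussian in \<open>y\<close>, and the error inherits its
  decay.\<close>

lemma exp_second_order_bound:
  fixes w w0 :: complex
  assumes "norm (exp w) \<le> B" "norm (exp w0) \<le> B"
  shows "norm (exp w - exp w0 - (w - w0) * exp w0) \<le> B * (norm (w - w0))\<^sup>2"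
proof -
  have B: "0 < B" using assms(1) by (metis norm_exp_eq_Re exp_gt_zero less_le_trans)
  have "closed_segment w0 w \<subseteq> {z. Re z \<le> ln B}"
    using assms B by (intro closed_segment_subset convex_halfspace_Re_le) (auto simp: ln_ge_iff)
  then have *: "norm (exp z) \<le> B" if "z \<in> closed_segment w0 w" for z
    using that B by (auto simp: ln_ge_iff)
  have "norm (exp w - (\<Sum>i\<le>1. exp w0 * (w - w0) ^ i / fact i)) \<le> B * norm (w - w0) ^ Suc 1 / fact 1"
    by (rule field_Taylor[where S = "closed_segment w0 w" and f = "\<lambda>_. exp" and n = 1])
      (auto intro!: derivative_eq_intros * simp del: norm_exp_eq_Re)
  then show ?thesis by (simp add: algebra_simps power2_eq_square)
qed

text \<open>By compactness of the segment one constant serves all angles, not only those near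
  0.\<close>

lemma Taylor_imaginary_axis:
  fixes F :: "complex \<Rightarrow> complex"
  assumes F: "F holomorphic_on S" and S: "open S" "closed_segment (- (\<i> * of_real L)) (\<i> * of_real L) \<subseteq> S" and L: "L > 0"
  shows "\<exists>M\<ge>0. \<forall>\<theta>. \<bar>\<theta>\<bar> \<le> L \<longrightarrow>
    norm (F (\<i> * of_real \<theta>) - (\<Sum>k\<le>n. (deriv ^^ k) F 0 * (\<i> * of_real \<theta>) ^ k / fact k)) \<le> M * \<bar>\<theta>\<bar> ^ Suc n"
proof -
  let ?A = "closed_segment (- (\<i> * of_real L)) (\<i> * of_real L)"
  have hol: "(deriv ^^ k) F holomorphic_on S" for k
    using F S(1) by (rule holomorphic_higher_deriv)
  have "compact ((deriv ^^ Suc n) F ` ?A)"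
    by (intro compact_continuous_image holomorphic_on_imp_continuous_on holomorphic_on_subset[OF hol S(2)])
      (rule compact_segment)
  then obtain B where B: "\<And>z. z \<in> ?A \<Longrightarrow> norm ((deriv ^^ Suc n) F z) \<le> B"
    using compact_imp_bounded bounded_iff by (metis image_eqI)
  have mem: "\<i> * of_real \<theta> \<in> ?A" if "\<bar>\<theta>\<bar> \<le> L" for \<theta>
  proof -
    have "\<i> * of_real \<theta> = (1 - (\<theta> + L) / (2 * L)) *\<^sub>R (- (\<i> * of_real L)) + ((\<theta> + L) / (2 * L)) *\<^sub>R (\<i> * of_real L)"
      using L by (simp add: complex_eq_iff field_simps)
    moreover have "0 \<le> (\<theta> + L) / (2 * L)" "(\<theta> + L) / (2 * L) \<le> 1"
      using L that by (auto simp: field_simps)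
    ultimately show ?thesis unfolding closed_segment_def by blast
  qed
  show ?thesis
  proof (intro exI[of _ "max B 0"] conjI allI impI)
    fix \<theta> :: real assume \<theta>: "\<bar>\<theta>\<bar> \<le> L"
    have "norm ((deriv ^^ 0) F (\<i> * of_real \<theta>) - (\<Sum>k\<le>n. (deriv ^^ k) F 0 * (\<i> * of_real \<theta> - 0) ^ k / fact k))
        \<le> max B 0 * norm (\<i> * of_real \<theta> - 0) ^ Suc n / fact n"
    proof (rule field_Taylor[where S = ?A])
      fix i x assume "x \<in> ?A" "i \<le> n"
      then have "x \<in> S" using S by blast
      then have "((deriv ^^ i) F has_field_derivative deriv ((deriv ^^ i) F) x) (at x)"
        using hol S(1) holomorphic_derivI by blast
      then show "((deriv ^^ i) F has_field_derivative (deriv ^^ Suc i) F x) (at x within ?A)"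
        by (simp add: has_field_derivative_at_within)
    next
      fix x assume "x \<in> ?A"
      then show "norm ((deriv ^^ Suc n) F x) \<le> max B 0" using B by (meson max.coboundedI1)
    next
      show "0 \<in> ?A" using mem[of 0] L by simp
    qed (use mem \<theta> in auto)
    also have "\<dots> \<le> max B 0 * norm (\<i> * of_real \<theta> - 0) ^ Suc n"
      using mult_left_mono[of 1 "fact n :: real" "max B 0 * norm (\<i> * of_real \<theta> - 0) ^ Suc n"]
      by (simp add: divide_le_eq fact_ge_1 mult_ac del: power_Suc)
    finally show "norm (F (\<i> * of_real \<theta>) - (\<Sum>k\<le>n. (deriv ^^ k) F 0 * (\<i> * of_real \<theta>) ^ k / fact k))
        \<le> max B 0 * \<bar>\<theta>\<bar> ^ Suc n"
      by (simp add: norm_mult)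
  qed auto
qed

text \<open>Jordan's inequality \<open>sin (x / 2) >= x / pi\<close> on \<open>[0, pi]\<close>, from
  concavity of the sine, squared.\<close>

lemma one_minus_cos_ge:
  fixes \<theta> :: real
  assumes "\<bar>\<theta>\<bar> \<le> pi"
  shows "1 - cos \<theta> \<ge> 2 * \<theta>\<^sup>2 / pi\<^sup>2"
proof -
  have *: "x / pi \<le> sin (x / 2)" if "0 \<le> x" "x \<le> pi" for x
  proof -
    have "concave_on {0..pi/2} sin"
      by (rule f''_le0_imp_concave[where f' = cos and f'' = "\<lambda>x. - sin x"])
        (auto intro!: derivative_eq_intros sin_ge_zero)
    from concave_onD[OF this, of "x / pi" 0 "pi / 2"] show ?thesis
      using that by (simp add: mult_ac)
  qed
  have "2 * (\<bar>\<theta>\<bar> / pi)\<^sup>2 \<le> 2 * (sin (\<bar>\<theta>\<bar> / 2))\<^sup>2"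
    using *[of "\<bar>\<theta>\<bar>"] assms by (intro mult_left_mono power_mono) auto
  also have "\<dots> = 1 - cos \<bar>\<theta>\<bar>"
    using cos_double_sin[of "\<bar>\<theta>\<bar> / 2"] by simp
  finally show ?thesis by (simp add: power_divide)
qed

text \<open>The real part equals \<open>r / (1 + r)\<close> minus
  \<open>r (1 - r) (1 - cos \<theta>) / ((1 + r) |1 + z|^2)\<close>, and
  \<open>|1 + z| <= 1 + r\<close>. The quadratic decay holds on the full circle, so arcs far from
  the saddle point need no separate treatment.\<close>

lemma Re_div_one_plus_cis:
  fixes r \<theta> :: real
  assumes r: "0 < r" "r < 1" and \<theta>: "\<bar>\<theta>\<bar> \<le> pi"
  defines "z \<equiv> of_real r * cis \<theta>"
  shows "Re (z / (1 + z)) \<le> r / (1 + r) - 2 * r * (1 - r) / ((1 + r) ^ 3 * pi\<^sup>2) * \<theta>\<^sup>2"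
proof -
  define c where "c = cos \<theta>"
  define N where "N = 1 + 2 * r * c + r\<^sup>2"
  have c: "-1 \<le> c" "c \<le> 1" by (auto simp: c_def)
  have N1: "(1 - r)\<^sup>2 \<le> N" "N \<le> (1 + r)\<^sup>2"
    using mult_left_mono[of "-1" c "2*r"] mult_left_mono[of c 1 "2*r"] c r
    by (auto simp: N_def power2_eq_square algebra_simps)
  have N0: "N > 0" using N1(1) r by (smt (verit) zero_less_power2)
  have "N = (1 + r * cos \<theta>)\<^sup>2 + (r * sin \<theta>)\<^sup>2"
    using sin_cos_squared_add[of \<theta>] unfolding N_def c_def by algebra
  then have "Re (z / (1 + z)) = (r * c * (1 + r * c) + r * sin \<theta> * (r * sin \<theta>)) / N"
    by (simp add: Re_divide z_def c_def power2_eq_square)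
  also have "r * c * (1 + r * c) + r * sin \<theta> * (r * sin \<theta>) = r * c + r\<^sup>2"
    using sin_cos_squared_add[of \<theta>] unfolding c_def by algebra
  also have "(r * c + r\<^sup>2) / N = r / (1 + r) - r * (1 - r) * (1 - c) / ((1 + r) * N)"
    using r N0 by (simp add: divide_simps) (simp add: N_def power2_eq_square algebra_simps)
  finally have 1: "Re (z / (1 + z)) = r / (1 + r) - r * (1 - r) * (1 - c) / ((1 + r) * N)" .
  have "r * (1 - r) * (2 * \<theta>\<^sup>2 / pi\<^sup>2) / ((1 + r) * (1 + r)\<^sup>2) \<le> r * (1 - r) * (1 - c) / ((1 + r) * N)"
    using r N0 N1 c one_minus_cos_ge[OF \<theta>] unfolding c_def[symmetric]
    by (intro frac_le mult_left_mono mult_nonneg_nonneg mult_pos_pos) auto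
  also have "r * (1 - r) * (2 * \<theta>\<^sup>2 / pi\<^sup>2) / ((1 + r) * (1 + r)\<^sup>2) = 2 * r * (1 - r) / ((1 + r) ^ 3 * pi\<^sup>2) * \<theta>\<^sup>2"
    by (simp add: power3_eq_cube power2_eq_square mult_ac)
  finally show ?thesis using 1 by linarith
qed

subsection \<open>Exponential decay of the rescaled integrand\<close>

locale cubical =
  fixes d :: nat
  assumes d: "d \<ge> 3"
begin

text \<open>The radius with \<open>rho / (1 + rho) = 1 / d\<close>: at \<open>z = rho\<close> the
  factor \<open>exp (- t / d)\<close> cancels \<open>exp (t z / (1 + z))\<close> for every
  \<open>t\<close>.\<close>

definition rho :: real where "rho = 1 / (real d - 1)"

text \<open>The derivative of \<open>r / (1 + r)\<close> with respect to \<open>ln r\<close> at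
  \<open>r = rho\<close>.\<close>

definition alpha :: real where "alpha = rho / (1 + rho)\<^sup>2"

definition lag_sum :: "nat \<Rightarrow> real \<Rightarrow> real" where
  "lag_sum n t = poly (\<Sum>j<n. laguerre j) t"

definition stretch :: "nat \<Rightarrow> real \<Rightarrow> real" where
  "stretch n s = real n / alpha + s * sqrt (real n)"

text \<open>\<open>1 / alpha\<close> is the value of \<open>t / n\<close> whose saddle point is \<open>rho\<close>; the \<open>d\<close>-th power of
  \<open>tilted n\<close> is the rescaled integrand, normalised to be of order one.\<close>

definition tilted :: "nat \<Rightarrow> real \<Rightarrow> real" where
  "tilted n s = (if stretch n s \<ge> 0 then sqrt (real n) * rho ^ n * exp (- (stretch n s / d)) * lag_sum n (stretch n s) else 0)"

lemma rho: "rho > 0" "rho \<le> 1 / 2" "rho < 1" "rho / (1 + rho) = 1 / d"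
  using d by (auto simp: rho_def field_simps)

lemma alpha_pos: "alpha > 0"
  using rho by (simp add: alpha_def)

text \<open>The second bound gains \<open>sqrt t\<close> from a Gaussian in the angle of width about
  \<open>1 / sqrt t\<close>; the first, from the length of the interval alone, is still useful when
  \<open>t\<close> is small. A whole range of radii is allowed so that the radius can be tilted
  around \<open>rho\<close>.\<close>

lemma lag_sum_bound:
  "\<exists>K>0. \<forall>n>0. \<forall>t\<ge>0. \<forall>r. 3 * rho / 4 \<le> r \<and> r \<le> 2 / 3 \<longrightarrow>
      \<bar>lag_sum n t\<bar> \<le> K * (exp (t * (r / (1 + r))) / r ^ n) \<and>
      \<bar>lag_sum n t\<bar> * sqrt t \<le> K * (exp (t * (r / (1 + r))) / r ^ n)"
proof -
  \<comment> \<open>From \<open>2 r (1 - r) >= 2 (3 rho / 4) (1 / 3) = rho / 2\<close> and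
    \<open>(1 + r)^3 <= 10\<close>.\<close>
  define c where "c = rho / (20 * pi\<^sup>2)"
  have c: "c > 0" using rho by (simp add: c_def)
  \<comment> \<open>\<open>6 / 5\<close> bounds the amplitude: \<open>|z| <= 2/3\<close> and
    \<open>|1 - z^2| >= 5/9\<close>. The two entries of the maximum belong to the two
    bounds.\<close>
  define K where "K = max (6 / 5) (6 / 5 * (1 / (2 * pi)) * sqrt (pi / c))"
  show ?thesis
  proof (intro exI[of _ K] conjI allI impI)
    show "K > 0" by (simp add: K_def)
  next
    fix n t r assume n: "n > (0::nat)" and t: "t \<ge> (0::real)" and r: "3 * rho / 4 \<le> r \<and> r \<le> 2 / 3"
    define E where "E = exp (t * (r / (1 + r))) / r ^ n"
    have r0: "0 < r" "r < 1" using r rho by auto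
    have E: "E > 0" using r0 by (simp add: E_def)
    define h where "h \<theta> = (let z = of_real r * cis \<theta> in exp (of_real t * (z / (1 + z))) * (z / (1 - z\<^sup>2)) / z ^ n)" for \<theta>
    have cr: "c \<le> 2 * r * (1 - r) / ((1 + r) ^ 3 * pi\<^sup>2)"
    proof -
      have "(1 + r) ^ 3 \<le> (5/3) ^ 3" using r r0 by (intro power_mono) auto
      then have "(1 + r) ^ 3 \<le> 10" by (simp add: power3_eq_cube)
      then have "(rho / 2) / (10 * pi\<^sup>2) \<le> (2 * r * (1 - r)) / ((1 + r) ^ 3 * pi\<^sup>2)"
        using r r0 rho mult_mono[of "3 * rho / 4" r "1/3" "1 - r"] by (intro frac_le mult_right_mono) auto
      then show ?thesis by (simp add: c_def)
    qed
    have bnd: "norm (indicator {-pi..pi} \<theta> *\<^sub>R h \<theta>) \<le> indicator {-pi..pi} \<theta> * (6 / 5 * E * exp (- (t * c * \<theta>\<^sup>2)))" for \<theta>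
    proof (cases "\<bar>\<theta>\<bar> \<le> pi")
      case True
      define z where "z = of_real r * cis \<theta>"
      have z: "norm z = r" using r0 by (simp add: z_def norm_mult)
      have "Re (z / (1 + z)) \<le> r / (1 + r) - 2 * r * (1 - r) / ((1 + r) ^ 3 * pi\<^sup>2) * \<theta>\<^sup>2"
        unfolding z_def by (rule Re_div_one_plus_cis) (use r0 True in auto)
      also have "\<dots> \<le> r / (1 + r) - c * \<theta>\<^sup>2"
        using cr by (intro diff_left_mono mult_right_mono) auto
      finally have tRe: "t * Re (z / (1 + z)) \<le> t * (r / (1 + r) - c * \<theta>\<^sup>2)"
        using t by (rule mult_left_mono)
      have 1: "norm (exp (of_real t * (z / (1 + z)))) \<le> exp (t * (r / (1 + r))) * exp (- (t * c * \<theta>\<^sup>2))"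
      proof -
        have "norm (exp (of_real t * w)) = exp (t * Re w)" for w by simp
        moreover note tRe
        moreover have "t * (r / (1 + r) - c * \<theta>\<^sup>2) = t * (r / (1 + r)) + - (t * c * \<theta>\<^sup>2)"
          by (simp add: right_diff_distrib)
        ultimately show ?thesis unfolding exp_add[symmetric] by (simp only: exp_le_cancel_iff)
      qed
      have "1 - r\<^sup>2 \<le> norm (1 - z\<^sup>2)"
        using norm_triangle_ineq2[of 1 "z\<^sup>2"] z by (simp add: norm_power)
      moreover have "r\<^sup>2 \<le> (2/3)\<^sup>2" using r r0 by (intro power_mono) auto
      then have "5/9 \<le> 1 - r\<^sup>2" by (simp add: power2_eq_square)
      ultimately have "r / norm (1 - z\<^sup>2) \<le> (2/3) / (5/9)"
        using r r0 by (intro frac_le) auto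
      then have 2: "norm (z / (1 - z\<^sup>2)) \<le> 6/5"
        by (simp add: norm_divide z)
      have "norm (h \<theta>) = norm (exp (of_real t * (z / (1 + z)))) * norm (z / (1 - z\<^sup>2)) / r ^ n"
        unfolding h_def Let_def z_def[symmetric] by (simp add: norm_mult norm_divide norm_power z del: norm_exp_eq_Re)
      also have "\<dots> \<le> (exp (t * (r / (1 + r))) * exp (- (t * c * \<theta>\<^sup>2))) * (6/5) / r ^ n"
        using r0 by (intro divide_right_mono mult_mono 1 2) auto
      finally have "norm (h \<theta>) \<le> 6 / 5 * E * exp (- (t * c * \<theta>\<^sup>2))"
        by (simp add: E_def)
      then show ?thesis using True by (auto simp: indicator_def)
    qed (auto simp: indicator_def)
    have "\<bar>lag_sum n t\<bar> = norm (complex_of_real (lag_sum n t))" by simp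
    also have "\<dots> = norm (of_real (1 / (2 * pi)) * (LINT \<theta>|lborel. indicator {-pi..pi} \<theta> *\<^sub>R h \<theta>))"
      unfolding lag_sum_def laguerre_sum_integral[OF r0 n] h_def set_lebesgue_integral_def by simp
    also have "\<dots> = 1 / (2 * pi) * norm (LINT \<theta>|lborel. indicator {-pi..pi} \<theta> *\<^sub>R h \<theta>)"
      by (simp add: norm_mult norm_divide)
    also have "\<dots> \<le> 1 / (2 * pi) * (LINT \<theta>|lborel. norm (indicator {-pi..pi} \<theta> *\<^sub>R h \<theta>))"
      by (intro mult_left_mono integral_norm_bound) auto
    finally have Lh: "\<bar>lag_sum n t\<bar> \<le> 1 / (2 * pi) * (LINT \<theta>|lborel. norm (indicator {-pi..pi} \<theta> *\<^sub>R h \<theta>))" .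
    have "(LINT \<theta>|lborel. norm (indicator {-pi..pi} \<theta> *\<^sub>R h \<theta>)) \<le> (LINT \<theta>|lborel. indicator {-pi..pi} \<theta> * (6 / 5 * E))"
    proof (rule integral_mono')
      show "integrable lborel (\<lambda>\<theta>. indicator {-pi..pi} \<theta> * (6 / 5 * E))"
        by (intro integrable_mult_left integrable_real_indicator) (auto simp: emeasure_lborel_Icc_eq)
      show "norm (indicator {-pi..pi} \<theta> *\<^sub>R h \<theta>) \<le> indicator {-pi..pi} \<theta> * (6 / 5 * E)" for \<theta>
      proof -
        have "6 / 5 * E * exp (- (t * c * \<theta>\<^sup>2)) \<le> 6 / 5 * E * 1"
          using t c E by (intro mult_left_mono) auto
        then have "indicator {-pi..pi} \<theta> * (6 / 5 * E * exp (- (t * c * \<theta>\<^sup>2))) \<le> indicator {-pi..pi} \<theta> * (6 / 5 * E)"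
          by (intro mult_left_mono) auto
        with bnd show ?thesis by (rule order_trans)
      qed
    qed (use E in auto)
    also have "\<dots> = 2 * pi * (6 / 5 * E)"
      by simp
    finally have "\<bar>lag_sum n t\<bar> \<le> 1 / (2 * pi) * (2 * pi * (6 / 5 * E))"
      using Lh by (meson mult_left_mono order_trans pi_ge_zero zero_le_divide_1_iff zero_le_mult_iff zero_le_numeral)
    also have "\<dots> = 6 / 5 * E" by simp
    also have "\<dots> \<le> K * E" using E by (intro mult_right_mono) (auto simp: K_def)
    finally show "\<bar>lag_sum n t\<bar> \<le> K * (exp (t * (r / (1 + r))) / r ^ n)" by (simp add: E_def)
    show "\<bar>lag_sum n t\<bar> * sqrt t \<le> K * (exp (t * (r / (1 + r))) / r ^ n)"
    proof (cases "t = 0")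
      case True
      then show ?thesis using r0 by (simp add: K_def)
    next
      case False
      then have tc: "t * c > 0" using t c by simp
      note gauss = has_bochner_integral_gaussian[OF tc]
      have "(LINT \<theta>|lborel. norm (indicator {-pi..pi} \<theta> *\<^sub>R h \<theta>)) \<le> (LINT \<theta>|lborel. 6 / 5 * E * exp (- (t * c * \<theta>\<^sup>2)))"
      proof (rule integral_mono')
        show "integrable lborel (\<lambda>\<theta>. 6 / 5 * E * exp (- (t * c * \<theta>\<^sup>2)))"
          using gauss by (intro integrable_mult_right) (simp add: has_bochner_integral_iff)
        show "norm (indicator {-pi..pi} \<theta> *\<^sub>R h \<theta>) \<le> 6 / 5 * E * exp (- (t * c * \<theta>\<^sup>2))" for \<theta>
          using bnd[of \<theta>] E by (auto simp: indicator_def split: if_splits)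
      qed (use E in auto)
      also have "\<dots> = 6 / 5 * E * sqrt (pi / (t * c))"
        using gauss by (simp add: has_bochner_integral_iff)
      finally have "\<bar>lag_sum n t\<bar> \<le> 1 / (2 * pi) * (6 / 5 * E * sqrt (pi / (t * c)))"
        using Lh by (meson mult_left_mono order_trans pi_ge_zero zero_le_divide_1_iff zero_le_mult_iff zero_le_numeral)
      then have "\<bar>lag_sum n t\<bar> * sqrt t \<le> 1 / (2 * pi) * (6 / 5 * E * sqrt (pi / (t * c))) * sqrt t"
        using t by (intro mult_right_mono) auto
      also have "\<dots> = 6 / 5 * (1 / (2 * pi)) * (sqrt (pi / (t * c)) * sqrt t) * E" by (simp add: mult_ac)
      also have "sqrt (pi / (t * c)) * sqrt t = sqrt (pi / c)"
        unfolding real_sqrt_mult[symmetric] using False by simp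
      also have "6 / 5 * (1 / (2 * pi)) * sqrt (pi / c) * E \<le> K * E"
        using E by (intro mult_right_mono) (auto simp: K_def)
      finally show ?thesis by (simp add: E_def)
    qed
  qed
qed

lemma exp_le_quadratic:
  fixes x :: real
  assumes "x \<le> 1 / 2"
  shows "exp x \<le> 1 + x + 2 * x\<^sup>2"
proof -
  have "1 - x \<le> exp (- x)" using exp_ge_add_one_self[of "- x"] by simp
  then have "(1 - x) * exp x \<le> 1"
    using mult_right_mono[of "1 - x" "exp (- x)" "exp x"] by (simp add: exp_add[symmetric])
  then have "exp x \<le> 1 / (1 - x)" using assms by (simp add: field_simps)
  also have "\<dots> \<le> 1 + x + 2 * x\<^sup>2"
  proof -
    have "(1 + x + 2 * x\<^sup>2) * (1 - x) = 1 + x\<^sup>2 * (1 - 2 * x)"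
      by (simp add: algebra_simps power2_eq_square)
    also have "\<dots> \<ge> 1" using assms by simp
    finally show ?thesis using assms by (simp add: divide_le_eq)
  qed
  finally show ?thesis .
qed

text \<open>As a function of \<open>v = exp \<eta> - 1\<close> the left side is
  \<open>alpha v\<close> minus a nonnegative term. Dropping that term leaves a bound on
  \<open>exp \<eta>\<close>.\<close>

lemma tilt_bound:
  fixes \<eta> :: real
  assumes "\<eta> \<le> 1 / 2"
  shows "rho * exp \<eta> / (1 + rho * exp \<eta>) - 1 / d \<le> alpha * (\<eta> + 2 * \<eta>\<^sup>2)"
proof -
  define v where "v = exp \<eta> - 1"
  have v: "v > -1" by (simp add: v_def)
  have pos: "1 + rho + rho * v > 0"
    using rho v mult_strict_left_mono[of "-1" v rho] by auto
  have "rho * exp \<eta> / (1 + rho * exp \<eta>) - 1 / d = rho * (1 + v) / (1 + rho + rho * v) - rho / (1 + rho)"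
    using rho by (simp add: v_def algebra_simps)
  also have "\<dots> = alpha * v - (rho * v)\<^sup>2 / ((1 + rho)\<^sup>2 * (1 + rho + rho * v))"
    using rho pos by (simp add: alpha_def divide_simps) (simp add: algebra_simps power2_eq_square)
  also have "\<dots> \<le> alpha * v" using pos by simp
  also have "\<dots> \<le> alpha * (\<eta> + 2 * \<eta>\<^sup>2)"
    using exp_le_quadratic[OF assms] alpha_pos by (intro mult_left_mono) (auto simp: v_def)
  finally show ?thesis .
qed

text \<open>The radius is tilted by a factor \<open>exp (\<plusminus>1 / (4 \<surd>n))\<close>, which turns the bound on the circle
  of radius \<open>rho\<close> into exponential decay in \<open>s\<close>.\<close>

lemma tilted_bound: "\<exists>K>0. \<forall>n>0. \<forall>s. \<bar>tilted n s\<bar> \<le> K * exp (- (alpha / 16 * \<bar>s\<bar>))"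
proof -
  obtain K where K: "K > 0" and KL: "\<And>n t r. n > 0 \<Longrightarrow> t \<ge> 0 \<Longrightarrow> 3 * rho / 4 \<le> r \<Longrightarrow> r \<le> 2 / 3 \<Longrightarrow>
      \<bar>lag_sum n t\<bar> \<le> K * (exp (t * (r / (1 + r))) / r ^ n) \<and>
      \<bar>lag_sum n t\<bar> * sqrt t \<le> K * (exp (t * (r / (1 + r))) / r ^ n)"
    using lag_sum_bound by blast
  obtain M where M: "M > 0" "\<And>s::real. (1 + \<bar>s\<bar>) ^ 1 \<le> M * exp (alpha / 16 * \<bar>s\<bar>)"
    using power_le_exp_abs[of "alpha / 16" 1] alpha_pos by auto
  \<comment> \<open>\<open>sqrt (2 * alpha)\<close> pays for large \<open>t\<close> and
    \<open>2 * alpha * M\<close> for small \<open>t\<close>; \<open>exp (1/8)\<close> is the loss in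
    the exponent.\<close>
  define K' where "K' = (sqrt (2 * alpha) + 2 * alpha * M) * (K * exp (1/8))"
  have K': "K' > 0" using K M alpha_pos by (simp add: K'_def add_pos_pos)
  have "\<bar>tilted n s\<bar> \<le> K' * exp (- (alpha / 16 * \<bar>s\<bar>))" if n: "n > 0" for n s
  proof (cases "stretch n s \<ge> 0")
    case False
    then show ?thesis using K' by (simp add: tilted_def)
  next
    case True
    define t where "t = stretch n s"
    have t: "t \<ge> 0" using True by (simp add: t_def)
    have sn: "sqrt n > 0" "sqrt n \<ge> 1" "sqrt n * sqrt n = n" using n by auto
    \<comment> \<open>The sign is opposite to that of \<open>s\<close>, which makes
      \<open>s * sqrt n * \<eta>\<close> equal to \<open>- |s| / 4\<close>. The size at most
      \<open>1/4\<close> keeps the tilted radius within the range of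
      \<open>lag_sum_bound\<close>.\<close>
    define \<eta> where "\<eta> = (if s \<ge> 0 then - 1 else 1) / (4 * sqrt n)"
    have \<eta>: "\<bar>\<eta>\<bar> \<le> 1 / 4" "s * sqrt n * \<eta> = - \<bar>s\<bar> / 4" "\<eta>\<^sup>2 = 1 / (16 * n)"
      using sn by (auto simp: \<eta>_def power_divide power_mult_distrib field_simps)
    define r where "r = rho * exp \<eta>"
    have "1 + (-1/4) \<le> exp (-1/4::real)" by (rule exp_ge_add_one_self)
    also have "\<dots> \<le> exp \<eta>" using \<eta>(1) by simp
    finally have r1: "3 * rho / 4 \<le> r" using rho by (simp add: r_def)
    have "1 + (-1/4) \<le> exp (-1/4::real)" by (rule exp_ge_add_one_self)
    then have "exp (1/4::real) \<le> 4/3"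
      by (simp add: exp_minus field_simps)
    then have "exp \<eta> \<le> 4/3"
      using \<eta>(1) by (smt (verit) exp_le_cancel_iff)
    then have "rho * exp \<eta> \<le> 1 / 2 * (4/3)" using rho by (intro mult_mono) auto
    then have r2: "r \<le> 2 / 3" by (simp add: r_def)
    have r0: "r > 0" using rho by (simp add: r_def)
    define Q where "Q = rho ^ n * exp (- (t / d)) * \<bar>lag_sum n t\<bar>"
    have Q0: "Q \<ge> 0" using rho by (simp add: Q_def)
    define E where "E = rho ^ n * exp (- (t / d)) * (exp (t * (r / (1 + r))) / r ^ n)"
    have w: "rho ^ n * exp (- (t / d)) \<ge> 0" using rho by simp
    have QE: "Q \<le> K * E" "Q * sqrt t \<le> K * E"
      using mult_left_mono[OF conjunct1[OF KL[OF n t r1 r2]] w] mult_left_mono[OF conjunct2[OF KL[OF n t r1 r2]] w]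
      by (simp_all add: Q_def E_def mult_ac)
    have "E = exp (- (n * \<eta>)) * exp (t * (r / (1 + r) - 1 / d))"
    proof -
      have "r ^ n = rho ^ n * exp (n * \<eta>)"
        by (simp add: r_def power_mult_distrib exp_of_nat_mult[symmetric])
      then have "E = exp (- (t / d)) * exp (t * (r / (1 + r))) * exp (- (n * \<eta>))"
        using rho by (simp add: E_def exp_minus field_simps)
      also have "\<dots> = exp (- (t / d) + t * (r / (1 + r))) * exp (- (n * \<eta>))"
        by (simp only: exp_add)
      also have "- (t / d) + t * (r / (1 + r)) = t * (r / (1 + r) - 1 / d)"
        by (simp add: right_diff_distrib)
      finally show ?thesis by (simp only: mult.commute)
    qed
    also have "\<dots> = exp (- (n * \<eta>) + t * (r / (1 + r) - 1 / d))" by (simp only: exp_add)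
    also have "\<dots> \<le> exp (1/8 - alpha / 8 * \<bar>s\<bar>)"
    proof -
      \<comment> \<open>Since \<open>t = n / alpha + s sqrt n\<close>, the linear term yields
        \<open>n \<eta> - alpha |s| / 4\<close>, and \<open>n \<eta>\<close> cancels the
        contribution of \<open>r ^ n\<close>. The quadratic term is at most
        \<open>(1 + alpha |s|) / 8\<close> and so consumes only half of the gain.\<close>
      have "t * (r / (1 + r) - 1 / d) \<le> t * (alpha * (\<eta> + 2 * \<eta>\<^sup>2))"
        using t \<eta>(1) unfolding r_def by (intro mult_left_mono tilt_bound) auto
      also have "\<dots> = n * \<eta> + alpha * (s * sqrt n * \<eta>) + 2 * alpha * t * \<eta>\<^sup>2"
        using alpha_pos by (simp add: t_def stretch_def algebra_simps)
      also have "\<dots> = n * \<eta> - alpha * \<bar>s\<bar> / 4 + alpha * (t / n) / 8"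
        unfolding \<eta>(2,3) by (simp add: mult_ac)
      finally have A: "- (n * \<eta>) + t * (r / (1 + r) - 1 / d) \<le> - (alpha * \<bar>s\<bar> / 4) + alpha * (t / n) / 8"
        by simp
      have tn: "t / n = 1 / alpha + s / sqrt n"
        using n sn by (simp add: t_def stretch_def add_divide_distrib) (simp add: field_simps)
      have "s / sqrt n \<le> \<bar>s\<bar> / 1"
        using sn by (intro frac_le) auto
      then have "alpha * (s / sqrt n) \<le> alpha * (\<bar>s\<bar> / 1)"
        using alpha_pos by (intro mult_left_mono) auto
      then have "alpha * (t / n) \<le> 1 + alpha * \<bar>s\<bar>"
        using alpha_pos unfolding tn distrib_left by simp
      moreover have "A \<le> 1/8 - u/8" if "A \<le> - (u/4) + v/8" "v \<le> 1 + u" for A u v :: real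
        using that by linarith
      ultimately have "- (n * \<eta>) + t * (r / (1 + r) - 1 / d) \<le> 1/8 - alpha * \<bar>s\<bar> / 8"
        using A by blast
      then show ?thesis by (simp only: exp_le_cancel_iff times_divide_eq_left)
    qed
    also have "\<dots> = exp (1/8) * exp (- (alpha / 8 * \<bar>s\<bar>))" by (simp add: exp_add[symmetric])
    finally have "K * E \<le> K * exp (1/8) * exp (- (alpha / 8 * \<bar>s\<bar>))"
      using K by simp
    with QE have Q1: "Q \<le> K * exp (1/8) * exp (- (alpha / 8 * \<bar>s\<bar>))"
      and Q2: "Q * sqrt t \<le> K * exp (1/8) * exp (- (alpha / 8 * \<bar>s\<bar>))" by auto
    let ?e = "K * exp (1/8)"
    have XQ: "\<bar>tilted n s\<bar> = sqrt n * Q"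
      using True rho by (simp add: tilted_def Q_def t_def abs_mult)
    have e2: "exp (- (alpha / 8 * \<bar>s\<bar>)) = exp (- (alpha / 16 * \<bar>s\<bar>)) * exp (- (alpha / 16 * \<bar>s\<bar>))"
      by (simp add: exp_add[symmetric])
    have e3: "exp (- (alpha / 8 * \<bar>s\<bar>)) \<le> exp (- (alpha / 16 * \<bar>s\<bar>))"
      using alpha_pos by simp
    show ?thesis
    \<comment> \<open>The factor \<open>sqrt n\<close> must be absorbed. For large \<open>t\<close>
      it is at most a multiple of \<open>sqrt t\<close>; otherwise \<open>s\<close> is negative with
      \<open>sqrt n < 2 alpha |s|\<close>, and half of the exponential decay pays for it.\<close>
    proof (cases "t \<ge> n / (2 * alpha)")
      case True
      have "sqrt n \<le> sqrt (2 * alpha * t)"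
        using True alpha_pos by (simp add: field_simps)
      then have "sqrt n * Q \<le> sqrt (2 * alpha) * sqrt t * Q"
        using Q0 by (intro mult_right_mono) (auto simp: real_sqrt_mult)
      also have "\<dots> = sqrt (2 * alpha) * (Q * sqrt t)" by simp
      also have "\<dots> \<le> sqrt (2 * alpha) * (?e * exp (- (alpha / 16 * \<bar>s\<bar>)))"
        using K alpha_pos e3 by (intro mult_left_mono order_trans[OF Q2]) auto
      also have "\<dots> \<le> (sqrt (2 * alpha) + 2 * alpha * M) * (?e * exp (- (alpha / 16 * \<bar>s\<bar>)))"
        using K alpha_pos M by (intro mult_right_mono) auto
      finally show ?thesis by (simp add: XQ K'_def mult_ac)
    next
      case False
      then have "n / (2 * alpha) < - s * sqrt n"
        using alpha_pos by (simp add: t_def stretch_def field_simps)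
      then have "sqrt n * sqrt n < sqrt n * (2 * alpha * (- s))"
        using alpha_pos sn(3) by (simp add: field_simps)
      then have "sqrt n < 2 * alpha * (- s)"
        by (rule mult_left_less_imp_less) simp
      also have "\<dots> \<le> 2 * alpha * (M * exp (alpha / 16 * \<bar>s\<bar>))"
        using M(2)[of s] alpha_pos by (intro mult_left_mono) auto
      finally have "sqrt n * Q \<le> 2 * alpha * (M * exp (alpha / 16 * \<bar>s\<bar>)) * (?e * exp (- (alpha / 8 * \<bar>s\<bar>)))"
        using Q0 Q1 M(1) alpha_pos by (intro mult_mono) (auto intro: less_imp_le)
      also have "\<dots> = 2 * alpha * M * (?e * exp (- (alpha / 16 * \<bar>s\<bar>))) * (exp (alpha / 16 * \<bar>s\<bar>) * exp (- (alpha / 16 * \<bar>s\<bar>)))"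
        unfolding e2 by (simp only: mult_ac)
      also have "\<dots> = 2 * alpha * M * (?e * exp (- (alpha / 16 * \<bar>s\<bar>)))"
        by (simp add: exp_add[symmetric])
      also have "\<dots> \<le> (sqrt (2 * alpha) + 2 * alpha * M) * (?e * exp (- (alpha / 16 * \<bar>s\<bar>)))"
        using K alpha_pos M by (intro mult_right_mono) auto
      finally show ?thesis by (simp add: XQ K'_def mult_ac)
    qed
  qed
  then show ?thesis using K' by blast
qed

end

subsection \<open>Expansion to first order in \<open>1 / \<surd>n\<close>\<close>

text \<open>\<open>\<delta>\<close> bounds quantities of order \<open>n^(-1/2)\<close> and
  \<open>\<epsilon>\<close> those of order \<open>1 / n\<close>, so the total is of order
  \<open>1 / n\<close>. The identity \<open>eq\<close> splits the error into the linearisation of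
  \<open>exp\<close>, the second-order errors of exponent and amplitude, and the product of their
  first-order terms.\<close>

lemma exp_perturbation_bound:
  fixes w w0 e1 g g0 h1 :: complex
  assumes B: "norm (exp w) \<le> B" "norm (exp w0) \<le> B"
    and \<delta>: "norm (w - w0) \<le> \<delta>" "norm e1 \<le> \<delta>" "norm h1 \<le> \<delta>"
    and \<epsilon>: "norm (w - w0 - e1) \<le> \<epsilon>" "norm (g - g0 - h1) \<le> \<epsilon>"
    and g: "norm g \<le> \<Gamma>"
  shows "norm (g * exp w - (g0 + (g0 * e1 + h1)) * exp w0) \<le> B * (\<Gamma> * \<delta>\<^sup>2 + \<Gamma> * \<epsilon> + \<epsilon> * (1 + \<delta>) + \<delta>\<^sup>2)"
proof -
  have B0: "B \<ge> 0" using B(1) norm_ge_zero order_trans by blast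
  have \<delta>0: "\<delta> \<ge> 0" using \<delta>(1) norm_ge_zero order_trans by blast
  have \<epsilon>0: "\<epsilon> \<ge> 0" using \<epsilon>(1) norm_ge_zero order_trans by blast
  have \<Gamma>0: "\<Gamma> \<ge> 0" using g norm_ge_zero order_trans by blast
  have eq: "g * exp w - (g0 + (g0 * e1 + h1)) * exp w0
      = g * (exp w - exp w0 - (w - w0) * exp w0) + g * (w - w0 - e1) * exp w0
        + ((g - g0 - h1) * (1 + e1) + h1 * e1) * exp w0"
    by (simp add: algebra_simps)
  have "norm (exp w - exp w0 - (w - w0) * exp w0) \<le> B * (norm (w - w0))\<^sup>2"
    by (rule exp_second_order_bound[OF B])
  also have "\<dots> \<le> B * \<delta>\<^sup>2" using B0 \<delta> by (intro mult_left_mono power_mono) auto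
  finally have 1: "norm (g * (exp w - exp w0 - (w - w0) * exp w0)) \<le> \<Gamma> * (B * \<delta>\<^sup>2)"
    using g \<Gamma>0 unfolding norm_mult by (intro mult_mono) auto
  have 2: "norm (g * (w - w0 - e1) * exp w0) \<le> \<Gamma> * \<epsilon> * B"
    unfolding norm_mult using g \<epsilon> B \<Gamma>0 \<epsilon>0 by (intro mult_mono mult_nonneg_nonneg) (auto simp del: norm_exp_eq_Re)
  have "norm (1 + e1) \<le> 1 + \<delta>" using norm_triangle_le[of 1 e1 "1 + \<delta>"] \<delta> by simp
  then have "norm ((g - g0 - h1) * (1 + e1)) \<le> \<epsilon> * (1 + \<delta>)"
    unfolding norm_mult using \<epsilon> \<epsilon>0 by (intro mult_mono) auto
  moreover have "norm (h1 * e1) \<le> \<delta> * \<delta>"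
    unfolding norm_mult using \<delta> \<delta>0 by (intro mult_mono) auto
  ultimately have "norm ((g - g0 - h1) * (1 + e1) + h1 * e1) \<le> \<epsilon> * (1 + \<delta>) + \<delta> * \<delta>"
    by (rule norm_triangle_mono)
  then have 3: "norm (((g - g0 - h1) * (1 + e1) + h1 * e1) * exp w0) \<le> (\<epsilon> * (1 + \<delta>) + \<delta> * \<delta>) * B"
    unfolding norm_mult using B \<epsilon>0 \<delta>0 by (intro mult_mono) (auto simp del: norm_exp_eq_Re)
  have "norm (g * exp w - (g0 + (g0 * e1 + h1)) * exp w0)
      \<le> \<Gamma> * (B * \<delta>\<^sup>2) + \<Gamma> * \<epsilon> * B + (\<epsilon> * (1 + \<delta>) + \<delta> * \<delta>) * B"
    unfolding eq by (intro norm_triangle_mono 1 2 3)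
  also have "\<dots> = B * (\<Gamma> * \<delta>\<^sup>2 + \<Gamma> * \<epsilon> + \<epsilon> * (1 + \<delta>) + \<delta>\<^sup>2)"
    by (simp add: algebra_simps power2_eq_square)
  finally show ?thesis .
qed

section \<open>The integrand near the saddle point\<close>

context cubical
begin

text \<open>In the logarithmic coordinate \<open>z\<close> the circle of radius \<open>rho\<close>
  becomes a segment of the imaginary axis; subtracting \<open>1 / d\<close> gives
  \<open>Phi 0 = 0\<close>.\<close>

definition Phi :: "complex \<Rightarrow> complex" where
  "Phi z = of_real rho * exp z / (1 + of_real rho * exp z) - of_real (1 / d)"

definition Gam :: "complex \<Rightarrow> complex" where
  "Gam z = of_real rho * exp z / (1 - (of_real rho * exp z)\<^sup>2)"

definition gam :: real where "gam = rho / (1 - rho\<^sup>2)"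

definition kap :: real where "kap = rho * (1 - rho) / (1 + rho) ^ 3"

text \<open>At \<open>t = n / alpha\<close> and angle \<open>y / sqrt n\<close> the quadratic term
  of \<open>t * Phi\<close> is \<open>- beta y^2 / 2\<close>, as \<open>kap\<close> is the second
  derivative of \<open>Phi\<close> at 0.\<close>

definition beta :: real where "beta = kap / alpha"

text \<open>The preimage of the open unit disc under \<open>z -> rho * exp z\<close>; the poles of
  \<open>Phi\<close> and \<open>Gam\<close> lie outside.\<close>

definition strip :: "complex set" where "strip = {z. Re z < ln (1 / rho)}"

lemma strip: "open strip" "closed_segment (- (\<i> * of_real pi)) (\<i> * of_real pi) \<subseteq> strip" "0 \<in> strip"
proof -
  show "open strip" unfolding strip_def by (rule open_halfspace_Re_lt)
  have "ln (1 / rho) > 0" using rho by simp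
  then show "closed_segment (- (\<i> * of_real pi)) (\<i> * of_real pi) \<subseteq> strip" "0 \<in> strip"
    unfolding strip_def by (simp_all add: closed_segment_subset convex_halfspace_Re_lt)
qed

lemma norm_rho_exp: "z \<in> strip \<Longrightarrow> norm (of_real rho * exp z) < 1"
proof -
  assume "z \<in> strip"
  then have "exp (Re z) < exp (ln (1 / rho))" by (simp add: strip_def)
  then show ?thesis using rho by (simp add: norm_mult field_simps)
qed

lemma strip_nonzero:
  assumes "z \<in> strip"
  shows "1 + of_real rho * exp z \<noteq> 0" "1 - (of_real rho * exp z)\<^sup>2 \<noteq> 0"
proof -
  let ?q = "of_real rho * exp z"
  have q: "norm ?q < 1" by (rule norm_rho_exp[OF assms])
  then show "1 + ?q \<noteq> 0" by (metis add_eq_0_iff norm_minus_cancel norm_one order_less_irrefl)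
  have "norm (?q\<^sup>2) < 1" using q by (simp add: norm_power power_less_one_iff del: power_mult_distrib)
  then show "1 - ?q\<^sup>2 \<noteq> 0" by (metis eq_iff_diff_eq_0 norm_one order_less_irrefl)
qed

lemma Phi_holomorphic: "Phi holomorphic_on strip"
  unfolding Phi_def using strip_nonzero by (intro holomorphic_intros) auto

lemma Gam_holomorphic: "Gam holomorphic_on strip"
  unfolding Gam_def using strip_nonzero by (intro holomorphic_intros) auto

lemma deriv_Phi:
  assumes "z \<in> strip"
  shows "deriv Phi z = of_real rho * exp z / (1 + of_real rho * exp z)\<^sup>2"
  unfolding Phi_def
  by (rule DERIV_imp_deriv) (use strip_nonzero[OF assms] in \<open>auto intro!: derivative_eq_intros simp: field_simps power2_eq_square\<close>)

lemma deriv2_Phi: "deriv (deriv Phi) 0 = of_real kap"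
proof -
  have nz: "1 + complex_of_real rho \<noteq> 0" using strip_nonzero(1)[OF strip(3)] by simp
  have "((\<lambda>z::complex. of_real rho * exp z / (1 + of_real rho * exp z)\<^sup>2) has_field_derivative of_real kap) (at 0)"
    using nz unfolding kap_def
    by (auto intro!: derivative_eq_intros simp: divide_simps) algebra
  then have "(deriv Phi has_field_derivative of_real kap) (at 0)"
    by (rule DERIV_cong_ev[THEN iffD1, rotated -1, OF _ refl _ refl])
      (auto intro!: eventually_mono[OF eventually_nhds_in_open[OF strip(1,3)]] simp: deriv_Phi)
  then show ?thesis by (rule DERIV_imp_deriv)
qed

text \<open>\<open>Phi\<close> gets multiplied by \<open>t\<close> of order \<open>n\<close> at
  angles \<open>y / sqrt n\<close>: the cubic term contributes at order \<open>n^(-1/2)\<close>, the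
  quartic remainder at order \<open>1 / n\<close>. The value of \<open>ka\<close> can stay
  unspecified because it enters only through an odd function of \<open>s\<close>.\<close>

lemma Phi_expansion:
  "\<exists>M\<ge>0. \<exists>ka. \<forall>\<theta>. \<bar>\<theta>\<bar> \<le> pi \<longrightarrow>
    norm (Phi (\<i> * of_real \<theta>) - (\<i> * of_real (alpha * \<theta>) - of_real (kap * \<theta>\<^sup>2 / 2) + ka * of_real (\<theta> ^ 3))) \<le> M * \<bar>\<theta>\<bar> ^ 4"
proof -
  define ka where "ka = (deriv ^^ 3) Phi 0 * \<i> ^ 3 / 6"
  obtain M where M: "M \<ge> 0" "\<And>\<theta>. \<bar>\<theta>\<bar> \<le> pi \<Longrightarrow>
    norm (Phi (\<i> * of_real \<theta>) - (\<Sum>k\<le>3. (deriv ^^ k) Phi 0 * (\<i> * of_real \<theta>) ^ k / fact k)) \<le> M * \<bar>\<theta>\<bar> ^ Suc 3"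
    using Taylor_imaginary_axis[OF Phi_holomorphic strip(1,2), of 3] by auto
  have "(\<Sum>k\<le>3. (deriv ^^ k) Phi 0 * (\<i> * of_real \<theta>) ^ k / fact k)
      = \<i> * of_real (alpha * \<theta>) - of_real (kap * \<theta>\<^sup>2 / 2) + ka * of_real (\<theta> ^ 3)" for \<theta>
  proof -
    have "Phi 0 = 0" using rho(4) by (simp add: Phi_def) (metis of_real_1 of_real_add of_real_divide of_real_of_nat_eq right_minus_eq)
    moreover have "deriv Phi 0 = of_real alpha"
      using deriv_Phi[OF strip(3)] by (simp add: alpha_def)
    moreover have "fact 3 = (6::complex)" "fact 2 = (2::complex)" by (simp_all add: eval_nat_numeral)
    ultimately show ?thesis
      using deriv2_Phi
      by (simp add: eval_nat_numeral(2) numeral_2_eq_2 numeral_3_eq_3 ka_def) (simp add: field_simps power2_eq_square)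
  qed
  with M show ?thesis by (intro exI[of _ M]) auto
qed

lemma Gam_expansion:
  "\<exists>M\<ge>0. \<exists>g1. \<forall>\<theta>. \<bar>\<theta>\<bar> \<le> pi \<longrightarrow>
    norm (Gam (\<i> * of_real \<theta>) - of_real gam - g1 * of_real \<theta>) \<le> M * \<theta>\<^sup>2"
proof -
  obtain M where M: "M \<ge> 0" "\<And>\<theta>. \<bar>\<theta>\<bar> \<le> pi \<Longrightarrow>
    norm (Gam (\<i> * of_real \<theta>) - (\<Sum>k\<le>1. (deriv ^^ k) Gam 0 * (\<i> * of_real \<theta>) ^ k / fact k)) \<le> M * \<bar>\<theta>\<bar> ^ Suc 1"
    using Taylor_imaginary_axis[OF Gam_holomorphic strip(1,2), of 1] by auto
  moreover have "Gam 0 = of_real gam" by (simp add: Gam_def gam_def)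
  ultimately show ?thesis
    by (intro exI[of _ M] conjI exI[of _ "deriv Gam 0 * \<i>"])
      (auto simp: algebra_simps numeral_2_eq_2)
qed

lemma norm_Gam_le: "norm (Gam (\<i> * of_real \<theta>)) \<le> gam"
proof -
  define z where "z = of_real rho * exp (\<i> * of_real \<theta>)"
  have z: "norm z = rho" using rho by (simp add: z_def norm_mult)
  have "1 - rho\<^sup>2 \<le> norm (1 - z\<^sup>2)"
    using norm_triangle_ineq2[of 1 "z\<^sup>2"] z by (simp add: norm_power)
  moreover have "rho\<^sup>2 < 1" using rho by (simp add: power_less_one_iff)
  ultimately show ?thesis
    unfolding Gam_def z_def[symmetric] norm_divide z gam_def using rho by (intro frac_le) auto
qed

definition cphi :: real where "cphi = 2 * rho * (1 - rho) / ((1 + rho) ^ 3 * pi\<^sup>2)"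

lemma Re_Phi_le:
  assumes "\<bar>\<theta>\<bar> \<le> pi"
  shows "Re (Phi (\<i> * of_real \<theta>)) \<le> - (cphi * \<theta>\<^sup>2)"
  using Re_div_one_plus_cis[of rho \<theta>] rho assms
  by (simp add: Phi_def cphi_def cis_conv_exp)

lemma pos: "cphi > 0" "kap > 0" "beta > 0" "gam > 0"
proof -
  have "rho\<^sup>2 < 1" using rho by (simp add: power_less_one_iff)
  then show "cphi > 0" "kap > 0" "beta > 0" "gam > 0"
    using rho alpha_pos by (auto simp: cphi_def kap_def beta_def gam_def)
qed

text \<open>The integrand of the circle integral at angle \<open>y / sqrt n\<close>; the last term
  of the exponent comes from \<open>z ^ n\<close> in the denominator, and the indicator restricts
  the angle to \<open>[-pi, pi]\<close>.\<close>

definition saddle :: "nat \<Rightarrow> real \<Rightarrow> real \<Rightarrow> complex" where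
  "saddle n s y = indicator {- (pi * sqrt n)..pi * sqrt n} y *\<^sub>R
     (Gam (\<i> * of_real (y / sqrt n)) *
      exp (of_real (stretch n s) * Phi (\<i> * of_real (y / sqrt n)) - \<i> * of_real (sqrt n * y)))"

text \<open>The normalisation of \<open>tilted\<close> is used up exactly: \<open>sqrt n\<close>
  against the Jacobian, \<open>rho ^ n\<close> against the modulus of \<open>z ^ n\<close>, and
  \<open>exp (- t / d)\<close> in the constant term of \<open>Phi\<close>.\<close>

lemma tilted_integral:
  assumes n: "n > 0" and Ts: "stretch n s \<ge> 0"
  shows "complex_of_real (tilted n s) = of_real (1 / (2 * pi)) * (LINT y|lborel. saddle n s y)"
proof -
  define t where "t = stretch n s"
  have sn: "sqrt n > 0" "sqrt n * sqrt n = n" using n by auto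
  define h where "h \<theta> = (let z = of_real rho * cis \<theta> in exp (of_real t * (z / (1 + z))) * (z / (1 - z\<^sup>2)) / z ^ n)" for \<theta>
  have hI: "of_real (rho ^ n * exp (- (t / d))) * (indicator {-pi..pi} (0 + 1 / sqrt n * y) *\<^sub>R h (0 + 1 / sqrt n * y)) = saddle n s y" for y
  proof -
    define \<theta> where "\<theta> = y / sqrt n"
    have ind: "indicator {-pi..pi} \<theta> = (indicator {- (pi * sqrt n)..pi * sqrt n} y :: real)"
      using sn by (simp add: \<theta>_def indicator_def field_simps)
    define z where "z = of_real rho * exp (\<i> * of_real \<theta>)"
    have zc: "z = of_real rho * cis \<theta>" by (simp add: z_def cis_conv_exp)
    have y: "sqrt n * y = n * \<theta>" using sn by (simp add: \<theta>_def field_simps)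
    have zn: "z ^ n = of_real (rho ^ n) * exp (\<i> * of_real (n * \<theta>))"
      by (simp add: z_def power_mult_distrib exp_of_nat_mult[symmetric] mult_ac)
    have "of_real (rho ^ n * exp (- (t / d))) * h \<theta>
        = exp (of_real (- (t / d))) * exp (of_real t * (z / (1 + z))) * exp (- (\<i> * of_real (n * \<theta>))) * (z / (1 - z\<^sup>2))"
    proof -
      have "of_real (p * q) * (A * B / (of_real p * E)) = of_real q * A * inverse E * B"
        if "p > 0" for p q :: real and A B E :: complex
        using that by (simp add: field_simps)
      note * = this
      have e: "exp (of_real (- (t / d))) = complex_of_real (exp (- (t / d)))"
        by (simp only: exp_of_real)
      show ?thesis
        unfolding h_def Let_def zc[symmetric] zn e exp_minus[of "\<i> * of_real (n * \<theta>)"]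
        by (rule *) (use rho in simp)
    qed
    also have "exp (of_real (- (t / d))) * exp (of_real t * (z / (1 + z))) * exp (- (\<i> * of_real (n * \<theta>)))
        = exp (of_real t * (z / (1 + z) - of_real (1 / d)) - \<i> * of_real (n * \<theta>))"
      unfolding exp_add[symmetric] by (simp add: algebra_simps)
    finally have "of_real (rho ^ n * exp (- (t / d))) * h \<theta>
        = Gam (\<i> * of_real \<theta>) * exp (of_real t * Phi (\<i> * of_real \<theta>) - \<i> * of_real (sqrt n * y))"
      by (simp add: Gam_def Phi_def z_def[symmetric] y)
    then show ?thesis
      unfolding saddle_def \<theta>_def[symmetric] t_def[symmetric] ind[symmetric]
      by (simp add: \<theta>_def scaleR_conv_of_real mult_ac)
  qed
  have "complex_of_real (tilted n s) = of_real (sqrt n * (rho ^ n * exp (- (t / d)))) * of_real (lag_sum n t)"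
    using Ts by (simp add: tilted_def t_def)
  also have "of_real (lag_sum n t) = of_real (1 / (2 * pi)) * (LINT \<theta>|lborel. indicator {-pi..pi} \<theta> *\<^sub>R h \<theta>)"
    unfolding lag_sum_def laguerre_sum_integral[OF rho(1) rho(3) n] h_def set_lebesgue_integral_def by simp
  also have "(LINT \<theta>|lborel. indicator {-pi..pi} \<theta> *\<^sub>R h \<theta>)
      = \<bar>1 / sqrt n\<bar> *\<^sub>R (LINT y|lborel. indicator {-pi..pi} (0 + 1 / sqrt n * y) *\<^sub>R h (0 + 1 / sqrt n * y))"
    using sn by (intro lborel_integral_real_affine) auto
  finally have "complex_of_real (tilted n s) = of_real (1 / (2 * pi)) * (of_real (rho ^ n * exp (- (t / d))) *
      (LINT y|lborel. indicator {-pi..pi} (0 + 1 / sqrt n * y) *\<^sub>R h (0 + 1 / sqrt n * y)))"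
    using sn by (simp add: scaleR_conv_of_real field_simps)
  also have "of_real (rho ^ n * exp (- (t / d))) *
      (LINT y|lborel. indicator {-pi..pi} (0 + 1 / sqrt n * y) *\<^sub>R h (0 + 1 / sqrt n * y)) = (LINT y|lborel. saddle n s y)"
    unfolding hI[symmetric] by (rule integral_mult_right_zero[symmetric])
  finally show ?thesis .
qed


text \<open>The limit of the exponent in \<open>saddle\<close> as \<open>n\<close> tends to infinity
  with \<open>s\<close> and \<open>y\<close> fixed; \<open>gauss\<close> is the corresponding limit
  of \<open>tilted\<close>.\<close>

definition gauss_exponent :: "real \<Rightarrow> real \<Rightarrow> complex" where
  "gauss_exponent s y = \<i> * of_real (alpha * s * y) - of_real (beta * y\<^sup>2 / 2)"

definition gauss :: "real \<Rightarrow> real" where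
  "gauss s = gam / sqrt (2 * pi * beta) * exp (- (alpha * s)\<^sup>2 / (2 * beta))"

lemma norm_exp_W: "norm (exp (gauss_exponent s y)) = exp (- (beta / 2 * y\<^sup>2))"
  by (simp add: gauss_exponent_def)

lemma gauss_integral: "complex_of_real (gauss s) = of_real (1 / (2 * pi)) * (LINT y|lborel. of_real gam * exp (gauss_exponent s y))"
proof -
  have "(LINT y|lborel. of_real gam * exp (gauss_exponent s y)) = of_real gam * of_real (sqrt (2 * pi / beta) * exp (- (alpha * s)\<^sup>2 / (2 * beta)))"
    using gaussian_fourier[OF pos(3), of "alpha * s"] by (simp add: gauss_exponent_def)
  moreover have "1 / (2 * pi) * sqrt (2 * pi / beta) = 1 / sqrt (2 * pi * beta)"
    using pos by (simp add: real_sqrt_divide real_sqrt_mult field_simps)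
  then have "1 / (2 * pi) * (gam * (sqrt (2 * pi / beta) * exp (- (alpha * s)\<^sup>2 / (2 * beta)))) = gauss s"
    by (simp add: gauss_def field_simps)
  ultimately show ?thesis by (metis of_real_mult)
qed

text \<open>The coefficient of \<open>1 / sqrt n\<close> in the exponent of \<open>saddle\<close>:
  the shift of \<open>t\<close> by \<open>s sqrt n\<close> acts on the quadratic term, and the
  central value \<open>n / alpha\<close> on the cubic one.\<close>

definition skew_exponent :: "complex \<Rightarrow> real \<Rightarrow> real \<Rightarrow> complex" where
  "skew_exponent ka s y = - of_real (s * kap * y\<^sup>2 / 2) + ka * of_real (y ^ 3 / alpha)"

definition skew_integrand :: "complex \<Rightarrow> complex \<Rightarrow> real \<Rightarrow> real \<Rightarrow> complex" where
  "skew_integrand ka g1 s y = (of_real gam * skew_exponent ka s y + g1 * of_real y) * exp (gauss_exponent s y)"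

definition skew :: "complex \<Rightarrow> complex \<Rightarrow> real \<Rightarrow> complex" where
  "skew ka g1 s = of_real (1 / (2 * pi)) * (LINT y|lborel. skew_integrand ka g1 s y)"

text \<open>Under \<open>(s, y) -> (-s, -y)\<close> the terms \<open>s y^2\<close>,
  \<open>y^3\<close> and \<open>y\<close> change sign, while \<open>gauss_exponent\<close> depends
  on \<open>s y\<close> and \<open>y^2\<close> only.\<close>

lemma skew_odd: "skew ka g1 (- s) = - skew ka g1 s"
proof -
  have "(LINT y|lborel. skew_integrand ka g1 (- s) y) = \<bar>- 1\<bar> *\<^sub>R (LINT y|lborel. skew_integrand ka g1 (- s) (0 + (- 1) * y))"
    by (rule lborel_integral_real_affine) simp
  also have "(\<lambda>y. skew_integrand ka g1 (- s) (0 + (- 1) * y)) = (\<lambda>y. - skew_integrand ka g1 s y)"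
    by (rule ext) (simp add: skew_integrand_def skew_exponent_def gauss_exponent_def algebra_simps)
  finally show ?thesis by (simp add: skew_def)
qed

lemma skew_exponent_bound: "norm (skew_exponent ka s y) \<le> (kap / 2 + norm ka / alpha) * ((1 + \<bar>s\<bar>) * (1 + \<bar>y\<bar>) ^ 3)"
proof -
  have 1: "\<bar>s\<bar> * \<bar>y\<bar> ^ 2 \<le> (1 + \<bar>s\<bar>) * (1 + \<bar>y\<bar>) ^ 3"
    using power_mono[of "\<bar>y\<bar>" "1 + \<bar>y\<bar>" 2] power_increasing[of 2 3 "1 + \<bar>y\<bar>"]
    by (intro mult_mono) auto
  have 2: "1 * \<bar>y\<bar> ^ 3 \<le> (1 + \<bar>s\<bar>) * (1 + \<bar>y\<bar>) ^ 3"
    by (intro mult_mono power_mono) auto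
  have "norm (skew_exponent ka s y) \<le> norm (complex_of_real (s * kap * y\<^sup>2 / 2)) + norm (ka * of_real (y ^ 3 / alpha))"
    unfolding skew_exponent_def by (rule order_trans[OF norm_triangle_ineq]) simp
  also have "\<dots> = kap / 2 * (\<bar>s\<bar> * \<bar>y\<bar> ^ 2) + norm ka / alpha * (1 * \<bar>y\<bar> ^ 3)"
    using pos alpha_pos by (simp add: norm_mult abs_mult power_abs norm_divide norm_power mult_ac)
  also have "\<dots> \<le> kap / 2 * ((1 + \<bar>s\<bar>) * (1 + \<bar>y\<bar>) ^ 3) + norm ka / alpha * ((1 + \<bar>s\<bar>) * (1 + \<bar>y\<bar>) ^ 3)"
    using pos alpha_pos by (intro add_mono mult_left_mono 1 2) auto
  finally show ?thesis by (simp add: distrib_right)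
qed

lemma first_order_bound:
  "norm (of_real gam * skew_exponent ka s y + g1 * of_real y)
    \<le> (gam * (kap / 2 + norm ka / alpha) + norm g1) * ((1 + \<bar>s\<bar>) * (1 + \<bar>y\<bar>) ^ 3)"
proof -
  have "1 * \<bar>y\<bar> ^ 1 \<le> (1 + \<bar>s\<bar>) * (1 + \<bar>y\<bar>) ^ 3"
    using power_mono[of "\<bar>y\<bar>" "1 + \<bar>y\<bar>" 1] power_increasing[of 1 3 "1 + \<bar>y\<bar>"]
    by (intro mult_mono) auto
  then have 1: "norm g1 * \<bar>y\<bar> \<le> norm g1 * ((1 + \<bar>s\<bar>) * (1 + \<bar>y\<bar>) ^ 3)"
    by (intro mult_left_mono) auto
  have 2: "gam * norm (skew_exponent ka s y) \<le> gam * ((kap / 2 + norm ka / alpha) * ((1 + \<bar>s\<bar>) * (1 + \<bar>y\<bar>) ^ 3))"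
    using pos by (intro mult_left_mono skew_exponent_bound) auto
  have "norm (of_real gam * skew_exponent ka s y) + norm (g1 * of_real y)
      \<le> gam * ((kap / 2 + norm ka / alpha) * ((1 + \<bar>s\<bar>) * (1 + \<bar>y\<bar>) ^ 3)) + norm g1 * ((1 + \<bar>s\<bar>) * (1 + \<bar>y\<bar>) ^ 3)"
  proof -
    have "norm (of_real gam * skew_exponent ka s y) = gam * norm (skew_exponent ka s y)" "norm (g1 * of_real y) = norm g1 * \<bar>y\<bar>"
      using pos by (simp_all add: norm_mult)
    then show ?thesis using 1 2 by (simp only: add_mono)
  qed
  also have "\<dots> = (gam * (kap / 2 + norm ka / alpha) + norm g1) * ((1 + \<bar>s\<bar>) * (1 + \<bar>y\<bar>) ^ 3)"
    by (simp add: distrib_right)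
  finally show ?thesis by (rule order_trans[OF norm_triangle_ineq])
qed

lemma skew_integrand_bound:
  "norm (skew_integrand ka g1 s y) \<le> (gam * (kap / 2 + norm ka / alpha) + norm g1) * (1 + \<bar>s\<bar>) * ((1 + \<bar>y\<bar>) ^ 3 * exp (- (beta / 2 * y\<^sup>2)))"
  using mult_right_mono[OF first_order_bound[of ka s y g1], of "exp (- (beta / 2 * y\<^sup>2))"]
  by (simp add: skew_integrand_def norm_mult norm_exp_W mult_ac del: norm_exp_eq_Re)

lemma skew_integrand_measurable [measurable]: "skew_integrand ka g1 s \<in> borel_measurable borel"
  unfolding skew_integrand_def gauss_exponent_def skew_exponent_def using alpha_pos by (intro borel_measurable_continuous_onI continuous_intros) auto

lemma integrable_Z: "integrable lborel (skew_integrand ka g1 s)"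
proof (rule Bochner_Integration.integrable_bound)
  show "integrable lborel (\<lambda>y. (gam * (kap / 2 + norm ka / alpha) + norm g1) * (1 + \<bar>s\<bar>) * ((1 + \<bar>y\<bar>) ^ 3 * exp (- (beta / 2 * y\<^sup>2))))"
    using pos by (intro integrable_mult_right integrable_power_gaussian) auto
  show "AE y in lborel. norm (skew_integrand ka g1 s y) \<le> norm ((gam * (kap / 2 + norm ka / alpha) + norm g1) * (1 + \<bar>s\<bar>) * ((1 + \<bar>y\<bar>) ^ 3 * exp (- (beta / 2 * y\<^sup>2))))"
    by (intro AE_I2 order_trans[OF skew_integrand_bound]) (simp only: real_norm_def abs_ge_self)
qed simp

lemma integrable_exp_W: "integrable lborel (\<lambda>y. exp (gauss_exponent s y))"
proof (rule Bochner_Integration.integrable_bound)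
  show "integrable lborel (\<lambda>y. (1 + \<bar>y\<bar>) ^ 0 * exp (- (beta / 2 * y\<^sup>2)))"
    using pos by (intro integrable_power_gaussian) auto
  show "AE y in lborel. norm (exp (gauss_exponent s y)) \<le> norm ((1 + \<bar>y\<bar>) ^ 0 * exp (- (beta / 2 * y\<^sup>2)))"
    unfolding norm_exp_W by simp
  show "(\<lambda>y. exp (gauss_exponent s y)) \<in> borel_measurable lborel"
    unfolding gauss_exponent_def measurable_lborel2 by (intro borel_measurable_continuous_onI continuous_intros) auto
qed

lemma skew_bound: "\<exists>K\<ge>0. \<forall>s. norm (skew ka g1 s) \<le> K * (1 + \<bar>s\<bar>)"
proof -
  define A where "A = gam * (kap / 2 + norm ka / alpha) + norm g1"
  have A: "A \<ge> 0" using pos alpha_pos by (simp add: A_def)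
  define J where "J = (LINT y|lborel. (1 + \<bar>y\<bar>) ^ 3 * exp (- (beta / 2 * y\<^sup>2)))"
  have J: "J \<ge> 0" unfolding J_def by (intro integral_nonneg_AE) simp
  have "norm (skew ka g1 s) \<le> (1 / (2 * pi) * A * J) * (1 + \<bar>s\<bar>)" for s
  proof -
    have "norm (LINT y|lborel. skew_integrand ka g1 s y) \<le> (LINT y|lborel. norm (skew_integrand ka g1 s y))"
      by (rule integral_norm_bound)
    also have "\<dots> \<le> (LINT y|lborel. A * (1 + \<bar>s\<bar>) * ((1 + \<bar>y\<bar>) ^ 3 * exp (- (beta / 2 * y\<^sup>2))))"
      unfolding A_def using pos skew_integrand_bound
      by (intro integral_mono integrable_norm integrable_Z integrable_mult_right integrable_power_gaussian) auto
    also have "\<dots> = A * (1 + \<bar>s\<bar>) * J" by (simp add: J_def)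
    finally have "1 / (2 * pi) * norm (LINT y|lborel. skew_integrand ka g1 s y) \<le> 1 / (2 * pi) * (A * (1 + \<bar>s\<bar>) * J)"
      by (intro mult_left_mono) auto
    then show ?thesis by (simp add: skew_def norm_mult norm_divide mult_ac)
  qed
  moreover have "1 / (2 * pi) * A * J \<ge> 0" using A J by simp
  ultimately show ?thesis by blast
qed

text \<open>The range of \<open>s\<close> keeps \<open>stretch n s\<close> between
  \<open>n / (2 alpha)\<close> and \<open>3 n / (2 alpha)\<close>. Inside
  \<open>|y| <= pi sqrt n\<close> the perturbation bound applies; outside, \<open>saddle\<close>
  vanishes and the Gaussian terms alone are small enough. The powers 2 and 7 stem from a
  second-order error \<open>S Y^4\<close> times a first-order one \<open>S Y^3\<close>.\<close>

lemma pointwise_bound: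
  "\<exists>ka g1. \<exists>c>0. \<exists>K\<ge>0. \<forall>n>0. \<forall>s. \<bar>s\<bar> \<le> sqrt n / (2 * alpha) \<longrightarrow> (\<forall>y.
     norm (saddle n s y - of_real gam * exp (gauss_exponent s y) - skew_integrand ka g1 s y / of_real (sqrt n))
       \<le> K * (1 + \<bar>s\<bar>)\<^sup>2 / n * ((1 + \<bar>y\<bar>) ^ 7 * exp (- (c * y\<^sup>2))))"
proof -
  obtain M1 ka where M1: "M1 \<ge> 0" and Phi: "\<And>\<theta>. \<bar>\<theta>\<bar> \<le> pi \<Longrightarrow>
    norm (Phi (\<i> * of_real \<theta>) - (\<i> * of_real (alpha * \<theta>) - of_real (kap * \<theta>\<^sup>2 / 2) + ka * of_real (\<theta> ^ 3))) \<le> M1 * \<bar>\<theta>\<bar> ^ 4"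
    using Phi_expansion by blast
  obtain M2 g1 where M2: "M2 \<ge> 0" and Gam: "\<And>\<theta>. \<bar>\<theta>\<bar> \<le> pi \<Longrightarrow>
    norm (Gam (\<i> * of_real \<theta>) - of_real gam - g1 * of_real \<theta>) \<le> M2 * \<theta>\<^sup>2"
    using Gam_expansion by blast
  \<comment> \<open>The smaller of the decay rates of the true exponential and of its Gaussian
    limit.\<close>
  define c where "c = min (cphi / (2 * alpha)) (beta / 2)"
  have c: "c > 0" "c \<le> cphi / (2 * alpha)" "c \<le> beta / 2" using pos alpha_pos by (auto simp: c_def)
  \<comment> \<open>Second-order errors: the shift of \<open>t\<close> times the cubic term, the
    Taylor remainder times \<open>t <= 3 n / (2 alpha)\<close>, and the remainder of
    \<open>Gam\<close>. \<open>K1\<close> below covers all first-order quantities.\<close>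
  define K2 where "K2 = norm ka + 3 * M1 / (2 * alpha) + M2"
  define K0 where "K0 = kap / 2 + norm ka / alpha"
  define K1 where "K1 = K0 + 5 * K2 + norm g1"
  have K: "K0 \<ge> 0" "K2 \<ge> 0" "K1 \<ge> 0" "K1 \<ge> K0" "K1 \<ge> norm g1" "K1 \<ge> K0 + 5 * K2"
    using pos alpha_pos M1 M2 by (auto simp: K0_def K1_def K2_def)
  define K where "K = (gam + 1) * K1\<^sup>2 + gam * K2 + K2 * (1 + K1) + (gam + (gam * K0 + norm g1))"
  have K': "K \<ge> 0" using pos K by (simp add: K_def)
  have "norm (saddle n s y - of_real gam * exp (gauss_exponent s y) - skew_integrand ka g1 s y / of_real (sqrt n))
       \<le> K * (1 + \<bar>s\<bar>)\<^sup>2 / n * ((1 + \<bar>y\<bar>) ^ 7 * exp (- (c * y\<^sup>2)))"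
    if n: "n > 0" and s: "\<bar>s\<bar> \<le> sqrt n / (2 * alpha)" for n s y
  proof -
    define S where "S = 1 + \<bar>s\<bar>"
    define Y where "Y = 1 + \<bar>y\<bar>"
    define N where "N = sqrt (real n)"
    have N: "N \<ge> 1" "N > 0" "N * N = n" "N\<^sup>2 = n" using n by (auto simp: N_def)
    have S: "S \<ge> 1" "\<bar>s\<bar> \<le> S" and Y: "Y \<ge> 1" "\<bar>y\<bar> \<le> Y" by (auto simp: S_def Y_def)
    define B where "B = exp (- (c * y\<^sup>2))"
    have B: "B > 0" by (simp add: B_def)
    have BW: "norm (exp (gauss_exponent s y)) \<le> B"
      unfolding norm_exp_W B_def using mult_right_mono[OF c(3), of "y\<^sup>2"] by simp
    have S2: "1 \<le> S\<^sup>2" "S \<le> S\<^sup>2" using S one_le_power[of S 2] power_increasing[of 1 2 S] by auto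
    show ?thesis
    proof (cases "\<bar>y\<bar> \<le> pi * N")
      case False
      then have I0: "saddle n s y = 0" by (auto simp: saddle_def N_def indicator_def abs_if split: if_splits)
      \<comment> \<open>Here \<open>|y| > pi sqrt n\<close>, so two more powers of \<open>Y\<close>
        buy the factor \<open>1 / n\<close>.\<close>
      have "1 \<le> Y\<^sup>2 / n"
      proof -
        have "1 * N \<le> pi * N" using N pi_gt3 by (intro mult_right_mono) auto
        then have "N \<le> Y" using False Y by linarith
        then have "N\<^sup>2 \<le> Y\<^sup>2" using N by (intro power_mono) auto
        then show ?thesis using n N by (simp add: field_simps)
      qed
      have "norm (of_real gam * exp (gauss_exponent s y)) \<le> gam * B"
        using pos BW by (simp add: norm_mult mult_left_mono del: norm_exp_eq_Re)
      moreover have "norm (skew_integrand ka g1 s y / of_real N) \<le> (gam * K0 + norm g1) * (S * Y ^ 3) * B"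
      proof -
        have "norm (skew_integrand ka g1 s y) \<le> (gam * K0 + norm g1) * (S * Y ^ 3) * B"
          unfolding skew_integrand_def norm_mult K0_def S_def Y_def using B
          by (intro mult_mono first_order_bound BW order_trans[OF norm_ge_zero first_order_bound]) auto
        moreover have "norm (skew_integrand ka g1 s y / of_real N) \<le> norm (skew_integrand ka g1 s y) / 1"
          unfolding norm_divide using N by (intro frac_le) auto
        ultimately show ?thesis by simp
      qed
      ultimately have "norm (of_real gam * exp (gauss_exponent s y) + skew_integrand ka g1 s y / of_real N)
          \<le> gam * B + (gam * K0 + norm g1) * (S * Y ^ 3) * B"
        by (rule norm_triangle_mono)
      also have "\<dots> = (gam * 1 + (gam * K0 + norm g1) * (S * Y ^ 3)) * B" by (simp add: algebra_simps)
      also have "\<dots> \<le> (gam * (S\<^sup>2 * Y ^ 5) + (gam * K0 + norm g1) * (S\<^sup>2 * Y ^ 5)) * B"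
      proof -
        have "1 * 1 \<le> S\<^sup>2 * Y ^ 5" using S2 Y by (intro mult_mono) auto
        moreover have "S * Y ^ 3 \<le> S\<^sup>2 * Y ^ 5" using S S2 Y by (intro mult_mono power_increasing) auto
        ultimately show ?thesis
          using pos K B by (intro mult_right_mono add_mono mult_left_mono) auto
      qed
      also have "\<dots> = (gam + (gam * K0 + norm g1)) * (S\<^sup>2 * Y ^ 5 * B) * 1" by (simp add: algebra_simps)
      also have "\<dots> \<le> K * (S\<^sup>2 * Y ^ 5 * B) * (Y\<^sup>2 / n)"
        using \<open>1 \<le> Y\<^sup>2 / n\<close> pos K K' B S Y by (intro mult_mono) (auto simp: K_def)
      also have "\<dots> = K * S\<^sup>2 / n * (Y ^ 7 * B)" 
        by (simp add: power_add[symmetric] mult_ac)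
      finally have "norm (- (of_real gam * exp (gauss_exponent s y) + skew_integrand ka g1 s y / of_real N)) \<le> K * S\<^sup>2 / n * (Y ^ 7 * B)"
        by (simp only: norm_minus_cancel)
      then show ?thesis unfolding I0 S_def Y_def B_def N_def by (simp add: algebra_simps)
    next
      case True
      define \<theta> where "\<theta> = y / N"
      have \<theta>: "\<bar>\<theta>\<bar> \<le> pi" using True N by (simp add: \<theta>_def field_simps)
      have y: "y = \<theta> * N" using N by (simp add: \<theta>_def)
      define t where "t = stretch n s"
      have t: "t = N\<^sup>2 / alpha + s * N" by (simp add: t_def stretch_def N_def)
      have sN: "\<bar>s * N\<bar> \<le> N\<^sup>2 / (2 * alpha)"
        using mult_right_mono[OF s, of N] N by (simp add: abs_mult N_def[symmetric] power2_eq_square)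
      have t_bounds: "N\<^sup>2 / (2 * alpha) \<le> t" "t \<le> 3 * N\<^sup>2 / (2 * alpha)"
      proof -
        have "N\<^sup>2 / alpha = 2 * (N\<^sup>2 / (2 * alpha))" "3 * N\<^sup>2 / (2 * alpha) = 3 * (N\<^sup>2 / (2 * alpha))"
          by simp_all
        then show "N\<^sup>2 / (2 * alpha) \<le> t" "t \<le> 3 * N\<^sup>2 / (2 * alpha)"
          using sN unfolding t by linarith+
      qed
      define w where "w = of_real t * Phi (\<i> * of_real \<theta>) - \<i> * of_real (N * y)"
      define g where "g = Gam (\<i> * of_real \<theta>)"
      define R where "R = Phi (\<i> * of_real \<theta>) - (\<i> * of_real (alpha * \<theta>) - of_real (kap * \<theta>\<^sup>2 / 2) + ka * of_real (\<theta> ^ 3))"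
      have Iw: "saddle n s y = g * exp w"
        using True by (simp add: saddle_def N_def[symmetric] \<theta>_def[symmetric] g_def w_def t_def indicator_def abs_le_iff)
      have Bw: "norm (exp w) \<le> B"
      proof -
        have "Re w = t * Re (Phi (\<i> * of_real \<theta>))" by (simp add: w_def)
        also have "\<dots> \<le> t * (- (cphi * \<theta>\<^sup>2))"
          using t_bounds alpha_pos by (intro mult_left_mono Re_Phi_le \<theta>) (auto intro: order_trans[rotated])
        also have "\<dots> \<le> (N\<^sup>2 / (2 * alpha)) * (- (cphi * \<theta>\<^sup>2))"
          using t_bounds pos by (intro mult_right_mono_neg) auto
        also have "\<dots> = - (cphi / (2 * alpha) * y\<^sup>2)" by (simp add: y power_mult_distrib)
        also have "\<dots> \<le> - (c * y\<^sup>2)" using mult_right_mono[OF c(2), of "y\<^sup>2"] by simp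
        finally show ?thesis by (simp add: B_def)
      qed
      have D: "w - gauss_exponent s y - skew_exponent ka s y / of_real N = of_real s * ka * of_real (y ^ 3) / of_real (N\<^sup>2) + of_real t * R"
      proof -
        define q where "q = 1 / alpha"
        have tq: "t = N\<^sup>2 * q + s * N" "beta = kap * q" by (simp_all add: t q_def beta_def)
        have "t * alpha = N\<^sup>2 + s * N * alpha" using alpha_pos by (simp add: t distrib_right)
        then have "t * (alpha * \<theta>) = N * y + alpha * s * y"
          by (simp add: y power2_eq_square algebra_simps)
        then have 1: "of_real t * (\<i> * of_real (alpha * \<theta>)) = \<i> * of_real (N * y) + \<i> * of_real (alpha * s * y)"
          unfolding mult.left_commute[of _ \<i>] by (metis distrib_left of_real_add of_real_mult)
        have 2: "skew_exponent ka s y / of_real N = - of_real (s * kap * \<theta>\<^sup>2 * N / 2) + ka * of_real (\<theta> ^ 3 * N\<^sup>2 * q)"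
          using N(2) by (simp add: skew_exponent_def y q_def field_simps power2_eq_square power3_eq_cube)
        have 3: "of_real s * ka * of_real (y ^ 3) / of_real (N\<^sup>2) = of_real s * ka * of_real (\<theta> ^ 3 * N)"
          using N(2) by (simp add: y field_simps power2_eq_square power3_eq_cube)
        have "w = of_real t * (\<i> * of_real (alpha * \<theta>)) - of_real (t * kap * \<theta>\<^sup>2 / 2) + ka * of_real (t * \<theta> ^ 3) + of_real t * R - \<i> * of_real (N * y)"
          by (simp add: w_def R_def algebra_simps)
        then have w: "w = \<i> * of_real (alpha * s * y) - of_real (t * kap * \<theta>\<^sup>2 / 2) + ka * of_real (t * \<theta> ^ 3) + of_real t * R"
          unfolding 1 by simp
        show ?thesis
          unfolding 2 3 unfolding w gauss_exponent_def
          by (simp add: tq y algebra_simps power2_eq_square power3_eq_cube add_divide_distrib)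
      qed
      define \<epsilon> where "\<epsilon> = K2 * (S * Y ^ 4) / N\<^sup>2"
      define \<delta> where "\<delta> = K1 * (S * Y ^ 3) / N"
      have y3: "\<bar>y\<bar> ^ 3 \<le> Y ^ 4"
        using order_trans[OF power_mono[of "\<bar>y\<bar>" Y 3] power_increasing[of 3 4 Y]] Y by simp
      have y4: "\<bar>y\<bar> ^ 4 \<le> S * Y ^ 4" "\<bar>y\<bar>\<^sup>2 \<le> S * Y ^ 4" "\<bar>s\<bar> * \<bar>y\<bar> ^ 3 \<le> S * Y ^ 4" "\<bar>y\<bar> \<le> S * Y ^ 3"
        using S Y y3 mult_mono[of 1 S "\<bar>y\<bar> ^ 4" "Y ^ 4"] mult_mono[of 1 S "\<bar>y\<bar> ^ 2" "Y ^ 4"]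
          mult_mono[of "\<bar>s\<bar>" S "\<bar>y\<bar> ^ 3" "Y ^ 4"] mult_mono[of 1 S "\<bar>y\<bar>" "Y ^ 3"]
          power_mono[of "\<bar>y\<bar>" Y 4] power_mono[of "\<bar>y\<bar>" Y 2] power_mono[of "\<bar>y\<bar>" Y 3]
          power_increasing[of 2 4 Y] power_increasing[of 3 4 Y] power_increasing[of 1 3 Y]
        by auto
      have \<epsilon>1: "norm (w - gauss_exponent s y - skew_exponent ka s y / of_real N) \<le> \<epsilon>"
      proof -
        have "norm (of_real s * ka * of_real (y ^ 3) / of_real (N\<^sup>2)) = norm ka * (\<bar>s\<bar> * \<bar>y\<bar> ^ 3) / N\<^sup>2"
          by (simp add: norm_mult norm_divide norm_power power_abs)
        also have "\<dots> \<le> norm ka * (S * Y ^ 4) / N\<^sup>2"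
          by (intro divide_right_mono mult_left_mono y4) auto
        finally have 1: "norm (of_real s * ka * of_real (y ^ 3) / of_real (N\<^sup>2)) \<le> norm ka * (S * Y ^ 4) / N\<^sup>2" .
        have t0: "t \<ge> 0" using t_bounds(1) alpha_pos by (auto intro: order_trans[rotated])
        have "norm (of_real t * R) \<le> (3 * N\<^sup>2 / (2 * alpha)) * (M1 * \<bar>\<theta>\<bar> ^ 4)"
          unfolding norm_mult R_def using t0 t_bounds Phi[OF \<theta>] M1 by (intro mult_mono) auto
        also have "\<dots> = (3 * M1 / (2 * alpha)) * \<bar>y\<bar> ^ 4 / N\<^sup>2"
          using N(2) by (simp add: y abs_mult power_mult_distrib power4_eq_xxxx power2_eq_square)
        also have "\<dots> \<le> (3 * M1 / (2 * alpha)) * (S * Y ^ 4) / N\<^sup>2"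
          using M1 alpha_pos by (intro divide_right_mono mult_left_mono y4) auto
        finally have 2: "norm (of_real t * R) \<le> (3 * M1 / (2 * alpha)) * (S * Y ^ 4) / N\<^sup>2" .
        have "norm (w - gauss_exponent s y - skew_exponent ka s y / of_real N) \<le> norm ka * (S * Y ^ 4) / N\<^sup>2 + (3 * M1 / (2 * alpha)) * (S * Y ^ 4) / N\<^sup>2"
          unfolding D by (rule norm_triangle_mono[OF 1 2])
        also have "\<dots> = (norm ka + 3 * M1 / (2 * alpha)) * (S * Y ^ 4) / N\<^sup>2"
          by (simp add: distrib_right add_divide_distrib)
        also have "\<dots> \<le> \<epsilon>"
          unfolding \<epsilon>_def K2_def using M2 S Y by (intro divide_right_mono mult_right_mono) auto
        finally show ?thesis .
      qed
      have \<epsilon>2: "norm (g - of_real gam - g1 * of_real \<theta>) \<le> \<epsilon>"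
      proof -
        have "norm (g - of_real gam - g1 * of_real \<theta>) \<le> M2 * \<theta>\<^sup>2"
          unfolding g_def by (rule Gam[OF \<theta>])
        also have "\<dots> = M2 * \<bar>y\<bar>\<^sup>2 / N\<^sup>2" using N(2) by (simp add: y power_mult_distrib)
        also have "\<dots> \<le> M2 * (S * Y ^ 4) / N\<^sup>2"
          using M2 by (intro divide_right_mono mult_left_mono y4) auto
        also have "\<dots> \<le> \<epsilon>"
          unfolding \<epsilon>_def K2_def using M1 alpha_pos S Y by (intro divide_right_mono mult_right_mono) auto
        finally show ?thesis .
      qed
      have e1d: "norm (skew_exponent ka s y / of_real N) \<le> K0 * (S * Y ^ 3) / N"
        unfolding norm_divide using skew_exponent_bound[of ka s y] N by (simp add: K0_def S_def Y_def divide_right_mono)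
      have \<delta>2: "norm (skew_exponent ka s y / of_real N) \<le> \<delta>"
        using e1d K S Y N unfolding \<delta>_def by (elim order_trans) (intro divide_right_mono mult_right_mono, auto)
      have \<epsilon>\<delta>: "\<epsilon> \<le> 5 * K2 * (S * Y ^ 3) / N"
      proof -
        \<comment> \<open>As \<open>pi < 4\<close> and \<open>N >= 1\<close>. One power of
          \<open>Y\<close> is traded for \<open>N\<close>, which shows that the second-order error
          is also at most of first order; hence \<open>5 * K2\<close> in \<open>K1\<close>.\<close>
        have "Y \<le> 5 * N" using True N pi_less_4 mult_right_mono[of pi 4 N] unfolding Y_def by linarith
        then have "\<epsilon> \<le> K2 * (S * (Y ^ 3 * (5 * N))) / N\<^sup>2"
          unfolding \<epsilon>_def power_Suc2[of Y 3, simplified] using K S Y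
          by (intro divide_right_mono mult_left_mono) (auto simp: power_numeral_reduce mult_ac intro!: mult_left_mono)
        also have "\<dots> = 5 * K2 * (S * Y ^ 3) / N" using N(2) by (simp add: power2_eq_square)
        finally show ?thesis .
      qed
      have \<delta>1: "norm (w - gauss_exponent s y) \<le> \<delta>"
      proof -
        have "norm (w - gauss_exponent s y) \<le> norm (w - gauss_exponent s y - skew_exponent ka s y / of_real N) + norm (skew_exponent ka s y / of_real N)"
          by (metis diff_add_cancel norm_triangle_ineq)
        also have "\<dots> \<le> 5 * K2 * (S * Y ^ 3) / N + K0 * (S * Y ^ 3) / N"
          using \<epsilon>1 \<epsilon>\<delta> e1d by (intro add_mono) auto
        also have "\<dots> = (K0 + 5 * K2) * (S * Y ^ 3) / N" by (simp add: algebra_simps add_divide_distrib)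
        also have "\<dots> \<le> \<delta>" unfolding \<delta>_def using K S Y N by (intro divide_right_mono mult_right_mono) auto
        finally show ?thesis .
      qed
      have \<delta>3: "norm (g1 * of_real \<theta>) \<le> \<delta>"
      proof -
        have "norm (g1 * of_real \<theta>) = norm g1 * \<bar>y\<bar> / N" using N by (simp add: \<theta>_def norm_mult norm_divide)
        also have "\<dots> \<le> K1 * (S * Y ^ 3) / N" using y4 K N by (intro divide_right_mono mult_mono) auto
        finally show ?thesis by (simp add: \<delta>_def)
      qed
      have "norm (g * exp w - (of_real gam + (of_real gam * (skew_exponent ka s y / of_real N) + g1 * of_real \<theta>)) * exp (gauss_exponent s y))
          \<le> B * (gam * \<delta>\<^sup>2 + gam * \<epsilon> + \<epsilon> * (1 + \<delta>) + \<delta>\<^sup>2)"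
        by (rule exp_perturbation_bound[OF Bw BW \<delta>1 \<delta>2 \<delta>3 \<epsilon>1 \<epsilon>2]) (simp add: g_def norm_Gam_le)
      also have "g * exp w - (of_real gam + (of_real gam * (skew_exponent ka s y / of_real N) + g1 * of_real \<theta>)) * exp (gauss_exponent s y)
          = saddle n s y - of_real gam * exp (gauss_exponent s y) - skew_integrand ka g1 s y / of_real N"
        using N unfolding Iw skew_integrand_def \<theta>_def by (simp add: field_simps)
      also have "B * (gam * \<delta>\<^sup>2 + gam * \<epsilon> + \<epsilon> * (1 + \<delta>) + \<delta>\<^sup>2) \<le> B * (K * (S\<^sup>2 * Y ^ 7) / N\<^sup>2)"
      proof -
        define U where "U = S\<^sup>2 * Y ^ 7 / N\<^sup>2"
        have \<delta>sq: "\<delta>\<^sup>2 \<le> K1\<^sup>2 * U"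
        proof -
          have "\<delta>\<^sup>2 = K1\<^sup>2 * (S\<^sup>2 * Y ^ 6 / N\<^sup>2)"
            by (simp add: \<delta>_def power_divide power_mult_distrib power_mult[symmetric])
          also have "\<dots> \<le> K1\<^sup>2 * U"
            unfolding U_def using Y by (intro mult_left_mono divide_right_mono power_increasing) auto
          finally show ?thesis .
        qed
        have \<epsilon>U: "\<epsilon> \<le> K2 * U"
        proof -
          have "S * Y ^ 4 \<le> S\<^sup>2 * Y ^ 7" using S S2 Y by (intro mult_mono power_increasing) auto
          then show ?thesis unfolding \<epsilon>_def U_def using K
            by (simp add: mult_left_mono divide_right_mono)
        qed
        have \<epsilon>\<delta>U: "\<epsilon> * (1 + \<delta>) \<le> K2 * (1 + K1) * U"
        proof -
          have "1 * 1 \<le> S * Y ^ 3" using S Y by (intro mult_mono) auto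
          moreover have "\<delta> \<le> K1 * (S * Y ^ 3) / 1"
            unfolding \<delta>_def using K S Y N by (intro frac_le) auto
          ultimately have "1 + \<delta> \<le> (1 + K1) * (S * Y ^ 3)" by (simp add: distrib_right)
          then have "\<epsilon> * (1 + \<delta>) \<le> \<epsilon> * ((1 + K1) * (S * Y ^ 3))"
            using K S Y by (intro mult_left_mono) (auto simp: \<epsilon>_def)
          also have "\<dots> = K2 * (1 + K1) * (S\<^sup>2 * (Y ^ 4 * Y ^ 3) / N\<^sup>2)"
            by (simp add: \<epsilon>_def power2_eq_square mult_ac)
          also have "\<dots> = K2 * (1 + K1) * U" by (simp add: U_def power_add[symmetric])
          finally show ?thesis .
        qed
        have U0: "U \<ge> 0" using S Y by (simp add: U_def)
        have "gam * \<delta>\<^sup>2 + gam * \<epsilon> + \<epsilon> * (1 + \<delta>) + \<delta>\<^sup>2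
            \<le> gam * (K1\<^sup>2 * U) + gam * (K2 * U) + K2 * (1 + K1) * U + K1\<^sup>2 * U"
          using pos by (intro add_mono mult_left_mono \<delta>sq \<epsilon>U \<epsilon>\<delta>U) auto
        also have "\<dots> = ((gam + 1) * K1\<^sup>2 + gam * K2 + K2 * (1 + K1)) * U" by (simp add: algebra_simps)
        also have "\<dots> \<le> K * U" using U0 pos K by (intro mult_right_mono) (auto simp: K_def)
        finally have "gam * \<delta>\<^sup>2 + gam * \<epsilon> + \<epsilon> * (1 + \<delta>) + \<delta>\<^sup>2 \<le> K * (S\<^sup>2 * Y ^ 7) / N\<^sup>2"
          by (simp add: U_def)
        then show ?thesis using B by (intro mult_left_mono) auto
      qed
      also have "\<dots> = K * S\<^sup>2 / n * (Y ^ 7 * B)" by (simp add: N(4) mult_ac)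
      finally show ?thesis unfolding S_def Y_def B_def N_def .
    qed
  qed
  then show ?thesis using c(1) K' by blast
qed

end

subsection \<open>Integration of the expansion\<close>

text \<open>The remainder \<open>E\<close> of one exponent yields that of the next as
  \<open>x * E\<close> plus \<open>(k + 2) y^(k+1) (x - y)^2\<close>; the squared constant makes the
  induction close. The factor \<open>m ^ k\<close> is kept because it carries the exponential
  decay.\<close>

lemma power_linearization_bound:
  fixes x y m :: real
  assumes "\<bar>x\<bar> \<le> m" "\<bar>y\<bar> \<le> m"
  shows "\<bar>x ^ (k + 2) - y ^ (k + 2) - real (k + 2) * y ^ (k + 1) * (x - y)\<bar> \<le> (real (k + 2))\<^sup>2 * m ^ k * (x - y)\<^sup>2"
proof (induction k)
  case 0
  have "x ^ (0 + 2) - y ^ (0 + 2) - real (0 + 2) * y ^ (0 + 1) * (x - y) = (x - y)\<^sup>2"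
    by (simp add: power2_eq_square algebra_simps)
  then show ?case by simp
next
  case (Suc k)
  define E where "E = x ^ (k + 2) - y ^ (k + 2) - real (k + 2) * y ^ (k + 1) * (x - y)"
  have m: "m \<ge> 0" using assms by linarith
  have "x ^ (Suc k + 2) - y ^ (Suc k + 2) - real (Suc k + 2) * y ^ (Suc k + 1) * (x - y)
      = x * E + real (k + 2) * y ^ (k + 1) * (x - y)\<^sup>2"
    by (simp add: E_def algebra_simps power2_eq_square)
  also have "\<bar>\<dots>\<bar> \<le> \<bar>x\<bar> * \<bar>E\<bar> + real (k + 2) * \<bar>y\<bar> ^ (k + 1) * (x - y)\<^sup>2"
    by (rule order_trans[OF abs_triangle_ineq]) (simp add: abs_mult power_abs)
  also have "\<dots> \<le> m * ((real (k + 2))\<^sup>2 * m ^ k * (x - y)\<^sup>2) + real (k + 2) * m ^ (k + 1) * (x - y)\<^sup>2"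
    using Suc.IH assms m unfolding E_def
    by (intro add_mono mult_mono mult_left_mono mult_right_mono power_mono) auto
  also have "\<dots> = ((real (k + 2))\<^sup>2 + real (k + 2)) * (m ^ (k + 1) * (x - y)\<^sup>2)"
    by (simp add: algebra_simps)
  also have "\<dots> \<le> (real (Suc k + 2))\<^sup>2 * (m ^ (k + 1) * (x - y)\<^sup>2)"
  proof (rule mult_right_mono)
    show "(real (k + 2))\<^sup>2 + real (k + 2) \<le> (real (Suc k + 2))\<^sup>2"
      by (simp add: power2_eq_square algebra_simps)
  qed (use m in simp)
  finally show ?case by (simp add: mult_ac)
qed

context cubical
begin

lemma tilted_expansion:
  "\<exists>ka g1. \<exists>K\<ge>0. \<forall>n>0. \<forall>s. \<bar>s\<bar> \<le> sqrt n / (2 * alpha) \<longrightarrow>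
     norm (of_real (tilted n s) - of_real (gauss s) - skew ka g1 s / of_real (sqrt n)) \<le> K * ((1 + \<bar>s\<bar>)\<^sup>2 / n)"
proof -
  obtain ka g1 c K where c: "c > 0" and K: "K \<ge> 0" and bound: "\<forall>n>0. \<forall>s. \<bar>s\<bar> \<le> sqrt n / (2 * alpha) \<longrightarrow> (\<forall>y.
     norm (saddle n s y - of_real gam * exp (gauss_exponent s y) - skew_integrand ka g1 s y / of_real (sqrt n))
       \<le> K * (1 + \<bar>s\<bar>)\<^sup>2 / n * ((1 + \<bar>y\<bar>) ^ 7 * exp (- (c * y\<^sup>2))))"
    using pointwise_bound by (elim exE conjE) (rule that, assumption+)
  define J where "J = (LINT y|lborel. (1 + \<bar>y\<bar>) ^ 7 * exp (- (c * y\<^sup>2)))"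
  have J: "J \<ge> 0" unfolding J_def by (intro integral_nonneg_AE) simp
  have "norm (of_real (tilted n s) - of_real (gauss s) - skew ka g1 s / of_real (sqrt n)) \<le> (1 / (2 * pi) * K * J) * ((1 + \<bar>s\<bar>)\<^sup>2 / n)"
    if n: "n > 0" and s: "\<bar>s\<bar> \<le> sqrt n / (2 * alpha)" for n s
  proof -
    \<comment> \<open>In this range \<open>stretch n s\<close> is nonnegative, so
      \<open>tilted\<close> is given by its integral and not by the default value 0.\<close>
    have "\<bar>s * sqrt n\<bar> \<le> n / (2 * alpha)"
      using mult_right_mono[OF s, of "sqrt n"] by (simp add: abs_mult)
    moreover have "n / (2 * alpha) \<le> n / alpha" using alpha_pos by (intro divide_left_mono) auto
    ultimately have Ts: "stretch n s \<ge> 0" unfolding stretch_def by linarith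
    have intI: "integrable lborel (saddle n s)"
      unfolding saddle_def
    proof (intro borel_integrable_compact continuous_intros)
      have "continuous_on {- (pi * sqrt n)..pi * sqrt n} (\<lambda>x. F (\<i> * of_real (x / sqrt n)))"
        if F: "F holomorphic_on strip" for F
      proof (rule continuous_on_compose2[OF holomorphic_on_imp_continuous_on[OF F]])
        have "ln (1 / rho) > 0" using rho by simp
        then show "(\<lambda>x. \<i> * complex_of_real (x / sqrt n)) ` {- (pi * sqrt n)..pi * sqrt n} \<subseteq> strip"
          by (auto simp: strip_def)
      qed (intro continuous_intros, use n in auto)
      then show "continuous_on {- (pi * sqrt n)..pi * sqrt n} (\<lambda>x. Gam (\<i> * of_real (x / sqrt n)))"
        "continuous_on {- (pi * sqrt n)..pi * sqrt n} (\<lambda>x. Phi (\<i> * of_real (x / sqrt n)))"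
        using Gam_holomorphic Phi_holomorphic by blast+
    qed auto
    have intW: "integrable lborel (\<lambda>y. of_real gam * exp (gauss_exponent s y))"
      by (intro integrable_mult_right integrable_exp_W)
    have intZ: "integrable lborel (\<lambda>y. skew_integrand ka g1 s y / of_real (sqrt n))"
      by (intro integrable_divide integrable_Z)
    have "of_real (tilted n s) - of_real (gauss s) - skew ka g1 s / of_real (sqrt n)
        = of_real (1 / (2 * pi)) * (LINT y|lborel. saddle n s y - of_real gam * exp (gauss_exponent s y) - skew_integrand ka g1 s y / of_real (sqrt n))"
      unfolding tilted_integral[OF n Ts] gauss_integral skew_def
      using intI intW intZ by (simp add: right_diff_distrib)
    then have "norm (of_real (tilted n s) - of_real (gauss s) - skew ka g1 s / of_real (sqrt n))
        = 1 / (2 * pi) * norm (LINT y|lborel. saddle n s y - of_real gam * exp (gauss_exponent s y) - skew_integrand ka g1 s y / of_real (sqrt n))"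
      by (simp add: norm_mult norm_divide)
    also have "\<dots> \<le> 1 / (2 * pi) * (K * (1 + \<bar>s\<bar>)\<^sup>2 / n * J)"
    proof (rule mult_left_mono)
      have "norm (LINT y|lborel. saddle n s y - of_real gam * exp (gauss_exponent s y) - skew_integrand ka g1 s y / of_real (sqrt n))
          \<le> (LINT y|lborel. norm (saddle n s y - of_real gam * exp (gauss_exponent s y) - skew_integrand ka g1 s y / of_real (sqrt n)))"
        by (rule integral_norm_bound)
      also have "\<dots> \<le> (LINT y|lborel. K * (1 + \<bar>s\<bar>)\<^sup>2 / n * ((1 + \<bar>y\<bar>) ^ 7 * exp (- (c * y\<^sup>2))))"
        using bound[rule_format, OF n s] c intI intW intZ integrable_exp_W[of s]
        by (intro integral_mono integrable_norm Bochner_Integration.integrable_diff integrable_mult_right integrable_power_gaussian) auto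
      also have "\<dots> = K * (1 + \<bar>s\<bar>)\<^sup>2 / n * J" by (simp add: J_def)
      finally show "norm (LINT y|lborel. saddle n s y - of_real gam * exp (gauss_exponent s y) - skew_integrand ka g1 s y / of_real (sqrt n))
          \<le> K * (1 + \<bar>s\<bar>)\<^sup>2 / n * J" .
    qed simp
    finally show ?thesis by (simp add: mult_ac)
  qed
  moreover have "1 / (2 * pi) * K * J \<ge> 0" using K J by simp
  ultimately show ?thesis by blast
qed

text \<open>A Gaussian decays faster; the rate \<open>alpha / 16\<close> is that of
  \<open>tilted_bound\<close>, so that both functions share one majorant.\<close>

lemma gauss_bound: "\<exists>K>0. \<forall>s. \<bar>gauss s\<bar> \<le> K * exp (- (alpha / 16 * \<bar>s\<bar>))"
proof -
  define k where "k = alpha\<^sup>2 / (2 * beta)"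
  have k: "k > 0" using alpha_pos pos by (simp add: k_def)
  define A where "A = gam / sqrt (2 * pi * beta)"
  define D where "D = exp ((alpha / 16)\<^sup>2 / (4 * k))"
  have A: "A > 0" "D > 0" using pos by (simp_all add: A_def D_def)
  have "\<bar>gauss s\<bar> \<le> (A * D) * exp (- (alpha / 16 * \<bar>s\<bar>))" for s
  proof -
    have "\<bar>gauss s\<bar> = A * exp (- (k * s\<^sup>2))"
      using A by (simp add: gauss_def k_def power_mult_distrib A_def[symmetric] abs_mult)
    also have "\<dots> \<le> A * (D * exp (- (alpha / 16 * \<bar>s\<bar>)))"
      unfolding D_def using A alpha_pos by (intro mult_left_mono exp_neg_square_le_exp_neg_abs k) auto
    finally show ?thesis by (simp only: mult.assoc)
  qed
  moreover have "A * D > 0" using A by simp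
  ultimately show ?thesis by blast
qed

lemma gauss_even: "gauss (- s) = gauss s"
  by (simp add: gauss_def)

text \<open>Adding the values at \<open>s\<close> and \<open>- s\<close> cancels the odd term of order \<open>n\<^sup>-\<^sup>1\<^sup>/\<^sup>2\<close>.\<close>

lemma symmetrized_power_bound:
  "\<exists>K\<ge>0. \<forall>n>0. \<forall>s. \<bar>(tilted n s ^ d - gauss s ^ d) + (tilted n (- s) ^ d - gauss (- s) ^ d)\<bar>
      \<le> K / n * ((1 + \<bar>s\<bar>) ^ 4 * exp (- (alpha / 16 * \<bar>s\<bar>)))"
proof -
  obtain ka g1 K0 where K0: "K0 \<ge> 0" and exp0: "\<And>n s. n > 0 \<Longrightarrow> \<bar>s\<bar> \<le> sqrt n / (2 * alpha) \<Longrightarrow>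
     norm (of_real (tilted n s) - of_real (gauss s) - skew ka g1 s / of_real (sqrt n)) \<le> K0 * ((1 + \<bar>s\<bar>)\<^sup>2 / n)"
    using tilted_expansion by blast
  obtain K1 where K1: "K1 \<ge> 0" "\<And>s. norm (skew ka g1 s) \<le> K1 * (1 + \<bar>s\<bar>)"
    using skew_bound by blast
  obtain KX where KX: "KX > 0" "\<And>n s. n > 0 \<Longrightarrow> \<bar>tilted n s\<bar> \<le> KX * exp (- (alpha / 16 * \<bar>s\<bar>))"
    using tilted_bound by blast
  obtain KG where KG: "KG > 0" "\<And>s. \<bar>gauss s\<bar> \<le> KG * exp (- (alpha / 16 * \<bar>s\<bar>))"
    using gauss_bound by blast
  define M where "M = max KX KG"
  define e where "e s = exp (- (alpha / 16 * \<bar>s\<bar>))" for s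
  have M: "M > 0" using KX by (simp add: M_def)
  have e: "0 < e s" "e s \<le> 1" "e (- s) = e s" for s using alpha_pos by (auto simp: e_def)
  have bX: "\<bar>tilted n s\<bar> \<le> M * e s" if "n > 0" for n s
  proof -
    have "KX * e s \<le> M * e s" using e(1)[of s] by (intro mult_right_mono) (auto simp: M_def less_imp_le)
    then show ?thesis using KX(2)[OF that, of s] unfolding e_def by linarith
  qed
  have bG: "\<bar>gauss s\<bar> \<le> M * e s" for s
  proof -
    have "KG * e s \<le> M * e s" using e(1)[of s] by (intro mult_right_mono) (auto simp: M_def less_imp_le)
    then show ?thesis using KG(2)[of s] unfolding e_def by linarith
  qed
  \<comment> \<open>One factor \<open>e s\<close> is kept for integrability, the others are bounded
    by 1. Among the exponents used is \<open>d - 2\<close>, positive because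
    \<open>d >= 3\<close>.\<close>
  have ek: "(M * e s) ^ k \<le> M ^ k * e s" if "k > 0" for s k
    using power_decreasing[of 1 k "e s"] e[of s] that M by (simp add: power_mult_distrib)
  define k where "k = d - 2"
  have k: "d = k + 2" "k > 0" using d by (auto simp: k_def)
  \<comment> \<open>The quadratic remainders at \<open>s\<close> and \<open>- s\<close>, plus the
    linear term that is left after cancellation.\<close>
  define A where "A = 2 * ((real d)\<^sup>2 * M ^ k * (K1 + K0)\<^sup>2) + real d * M ^ (k + 1) * (2 * K0)"
  have A0: "A \<ge> 0" using M K0 by (simp add: A_def)
  define B where "B = 16 * alpha\<^sup>2 * M ^ d"
  have B0: "B \<ge> 0" using M by (simp add: B_def)
  have "\<bar>(tilted n s ^ d - gauss s ^ d) + (tilted n (- s) ^ d - gauss (- s) ^ d)\<bar> \<le> (A + B) / n * ((1 + \<bar>s\<bar>) ^ 4 * e s)" if n: "n > 0" for n s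
  proof (cases "\<bar>s\<bar> \<le> sqrt n / (2 * alpha)")
    case True
    define S where "S = 1 + \<bar>s\<bar>"
    have S: "S \<ge> 1" by (simp add: S_def)
    have n1: "sqrt n \<ge> 1" "real n \<ge> 1" "sqrt n \<le> n" using n by (auto simp: real_le_lsqrt power2_eq_square)
    have diff: "\<bar>tilted n u - gauss u\<bar> \<le> (K1 + K0) * (S\<^sup>2 / sqrt n)" if "\<bar>u\<bar> = \<bar>s\<bar>" for u
    proof -
      have "norm (complex_of_real (tilted n u) - of_real (gauss u)) \<le> norm (skew ka g1 u / of_real (sqrt n)) + norm (of_real (tilted n u) - of_real (gauss u) - skew ka g1 u / of_real (sqrt n))"
        using norm_triangle_ineq[of "skew ka g1 u / of_real (sqrt n)" "of_real (tilted n u) - of_real (gauss u) - skew ka g1 u / of_real (sqrt n)"]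
        by simp
      also have "\<dots> \<le> K1 * S / sqrt n + K0 * (S\<^sup>2 / n)"
        using K1(2)[of u] exp0[OF n, of u] True that by (intro add_mono) (auto simp: norm_divide S_def divide_right_mono)
      also have "\<dots> \<le> K1 * (S\<^sup>2 / sqrt n) + K0 * (S\<^sup>2 / sqrt n)"
      proof (rule add_mono)
        have "S \<le> S\<^sup>2" using S power_increasing[of 1 2 S] by simp
        then show "K1 * S / sqrt n \<le> K1 * (S\<^sup>2 / sqrt n)"
          using K1(1) by (simp add: mult_left_mono divide_right_mono)
        have "S\<^sup>2 / n \<le> S\<^sup>2 / sqrt n" using n1 by (intro divide_left_mono) auto
        then show "K0 * (S\<^sup>2 / n) \<le> K0 * (S\<^sup>2 / sqrt n)" using K0 by (rule mult_left_mono)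
      qed
      also have "norm (complex_of_real (tilted n u) - of_real (gauss u)) = \<bar>tilted n u - gauss u\<bar>"
        by (simp only: of_real_diff[symmetric] norm_of_real)
      finally show ?thesis by (simp add: distrib_right add_divide_distrib)
    qed
    have quad: "\<bar>tilted n u ^ d - gauss u ^ d - real d * gauss u ^ (k + 1) * (tilted n u - gauss u)\<bar> \<le> (real d)\<^sup>2 * M ^ k * (K1 + K0)\<^sup>2 * (S ^ 4 / n) * e s"
      if u: "\<bar>u\<bar> = \<bar>s\<bar>" for u
    proof -
      have eu: "e u = e s" using u by (simp add: e_def)
      have "\<bar>tilted n u ^ d - gauss u ^ d - real d * gauss u ^ (k + 1) * (tilted n u - gauss u)\<bar> \<le> (real d)\<^sup>2 * (M * e s) ^ k * (tilted n u - gauss u)\<^sup>2"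
        using power_linearization_bound[OF bX[OF n, of u] bG[of u], of k] unfolding k(1)[symmetric] eu .
      also have "\<dots> \<le> (real d)\<^sup>2 * (M * e s) ^ k * ((K1 + K0) * (S\<^sup>2 / sqrt n))\<^sup>2"
        using power_mono[OF diff[OF u], of 2] M e(1)[of s] by (intro mult_left_mono) auto
      also have "((K1 + K0) * (S\<^sup>2 / sqrt n))\<^sup>2 = (K1 + K0)\<^sup>2 * (S ^ 4 / n)"
        by (simp add: power_mult_distrib power_divide power_mult[symmetric])
      also have "(real d)\<^sup>2 * (M * e s) ^ k * ((K1 + K0)\<^sup>2 * (S ^ 4 / n)) \<le> (real d)\<^sup>2 * (M ^ k * e s) * ((K1 + K0)\<^sup>2 * (S ^ 4 / n))"
        by (intro mult_right_mono mult_left_mono ek k) auto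
      finally show ?thesis by (simp only: mult_ac)
    qed
    \<comment> \<open>\<open>skew\<close> is odd, so its two contributions of order
      \<open>n^(-1/2)\<close> cancel and only the errors of order \<open>1 / n\<close>
      remain.\<close>
    have lin: "\<bar>(tilted n s - gauss s) + (tilted n (- s) - gauss (- s))\<bar> \<le> 2 * K0 * (S ^ 4 / n)"
    proof -
      have "\<bar>(tilted n s - gauss s) + (tilted n (- s) - gauss (- s))\<bar> = norm (complex_of_real ((tilted n s - gauss s) + (tilted n (- s) - gauss (- s))))"
        by (simp only: norm_of_real)
      also have "complex_of_real ((tilted n s - gauss s) + (tilted n (- s) - gauss (- s)))
          = (of_real (tilted n s) - of_real (gauss s) - skew ka g1 s / of_real (sqrt n))
            + (of_real (tilted n (- s)) - of_real (gauss (- s)) - skew ka g1 (- s) / of_real (sqrt n))"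
        by (simp add: skew_odd)
      finally have eq: "\<bar>(tilted n s - gauss s) + (tilted n (- s) - gauss (- s))\<bar> = norm ((of_real (tilted n s) - of_real (gauss s) - skew ka g1 s / of_real (sqrt n))
            + (of_real (tilted n (- s)) - of_real (gauss (- s)) - skew ka g1 (- s) / of_real (sqrt n)))" .
      have "\<bar>(tilted n s - gauss s) + (tilted n (- s) - gauss (- s))\<bar> \<le> norm (of_real (tilted n s) - of_real (gauss s) - skew ka g1 s / of_real (sqrt n))
            + norm (of_real (tilted n (- s)) - of_real (gauss (- s)) - skew ka g1 (- s) / of_real (sqrt n))"
        unfolding eq by (rule norm_triangle_ineq)
      also have "\<dots> \<le> K0 * (S\<^sup>2 / n) + K0 * (S\<^sup>2 / n)"
        using exp0[OF n, of s] exp0[OF n, of "- s"] True by (intro add_mono) (auto simp: S_def)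
      also have "\<dots> = 2 * K0 * (S\<^sup>2 / n)" by simp
      also have "\<dots> \<le> 2 * K0 * (S ^ 4 / n)"
        using K0 S by (intro mult_left_mono divide_right_mono power_increasing) auto
      finally show ?thesis .
    qed
    have eq: "(tilted n s ^ d - gauss s ^ d) + (tilted n (- s) ^ d - gauss (- s) ^ d)
        = (tilted n s ^ d - gauss s ^ d - real d * gauss s ^ (k + 1) * (tilted n s - gauss s))
        + (tilted n (- s) ^ d - gauss (- s) ^ d - real d * gauss (- s) ^ (k + 1) * (tilted n (- s) - gauss (- s)))
        + real d * gauss s ^ (k + 1) * ((tilted n s - gauss s) + (tilted n (- s) - gauss (- s)))"
      by (simp add: gauss_even algebra_simps)
    have "\<bar>(tilted n s ^ d - gauss s ^ d) + (tilted n (- s) ^ d - gauss (- s) ^ d)\<bar> \<le> (real d)\<^sup>2 * M ^ k * (K1 + K0)\<^sup>2 * (S ^ 4 / n) * e s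
        + (real d)\<^sup>2 * M ^ k * (K1 + K0)\<^sup>2 * (S ^ 4 / n) * e s + real d * (M ^ (k + 1) * e s) * (2 * K0 * (S ^ 4 / n))"
      unfolding eq
    proof (intro order_trans[OF abs_triangle_ineq] add_mono quad)
      have "\<bar>gauss s\<bar> ^ (k + 1) \<le> (M * e s) ^ (k + 1)" using bG by (intro power_mono) auto
      also have "\<dots> \<le> M ^ (k + 1) * e s" by (rule ek) simp
      finally have "\<bar>gauss s\<bar> ^ (k + 1) \<le> M ^ (k + 1) * e s" .
      then have "real d * \<bar>gauss s\<bar> ^ (k + 1) * \<bar>(tilted n s - gauss s) + (tilted n (- s) - gauss (- s))\<bar>
          \<le> real d * (M ^ (k + 1) * e s) * (2 * K0 * (S ^ 4 / n))"
        using M e[of s] by (intro mult_mono mult_left_mono lin) auto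
      then show "\<bar>real d * gauss s ^ (k + 1) * ((tilted n s - gauss s) + (tilted n (- s) - gauss (- s)))\<bar>
          \<le> real d * (M ^ (k + 1) * e s) * (2 * K0 * (S ^ 4 / n))"
        by (simp add: abs_mult power_abs)
    qed simp_all
    also have "\<dots> = A * (S ^ 4 / n * e s)"
    proof -
      have "P * x * f + P * x * f + D * (Q * f) * (R * x) = (2 * P + D * Q * R) * (x * f)" for P x f D Q R :: real
        by (simp add: algebra_simps)
      then show ?thesis unfolding A_def .
    qed
    also have "\<dots> = A / n * (S ^ 4 * e s)" by simp
    also have "\<dots> \<le> (A + B) / n * (S ^ 4 * e s)"
      using B0 e[of s] by (intro mult_right_mono divide_right_mono) (auto simp: less_imp_le)
    finally show ?thesis by (simp add: S_def)
  next
    case False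
    have one: "1 \<le> 4 * alpha\<^sup>2 * ((1 + \<bar>s\<bar>) ^ 4 / n)"
    proof -
      have "sqrt n \<le> 2 * alpha * (1 + \<bar>s\<bar>)" using False alpha_pos by (simp add: field_simps)
      then have "(sqrt n)\<^sup>2 \<le> (2 * alpha * (1 + \<bar>s\<bar>))\<^sup>2" by (intro power_mono) auto
      also have "\<dots> = 4 * alpha\<^sup>2 * (1 + \<bar>s\<bar>)\<^sup>2" by (simp add: power_mult_distrib)
      also have "\<dots> \<le> 4 * alpha\<^sup>2 * (1 + \<bar>s\<bar>) ^ 4" by (intro mult_left_mono power_increasing) auto
      finally show ?thesis using n by (simp add: field_simps)
    qed
    have pd: "\<bar>x ^ d\<bar> \<le> M ^ d * e s" if "\<bar>x\<bar> \<le> M * e s" for x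
      using power_mono[OF that, of d] ek[of d s] d by (simp add: power_abs)
    have "\<bar>(tilted n s ^ d - gauss s ^ d) + (tilted n (- s) ^ d - gauss (- s) ^ d)\<bar> \<le> 4 * (M ^ d * e s)"
      using pd[OF bX[OF n, of s]] pd[OF bG[of s]] pd[of "tilted n (- s)"] pd[of "gauss (- s)"]
        bX[OF n, of "- s"] bG[of "- s"] unfolding e(3) by linarith
    also have "\<dots> = 4 * (M ^ d * e s) * 1" by simp
    also have "\<dots> \<le> 4 * (M ^ d * e s) * (4 * alpha\<^sup>2 * ((1 + \<bar>s\<bar>) ^ 4 / n))"
      using M e[of s] by (intro mult_left_mono one) auto
    also have "\<dots> = B / n * ((1 + \<bar>s\<bar>) ^ 4 * e s)" by (simp add: B_def)
    also have "\<dots> \<le> (A + B) / n * ((1 + \<bar>s\<bar>) ^ 4 * e s)"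
      using A0 e[of s] by (intro mult_right_mono divide_right_mono) (auto simp: less_imp_le)
    finally show ?thesis .
  qed
  then show ?thesis using A0 B0 unfolding e_def by (intro exI[of _ "A + B"]) auto
qed


lemma tilted_measurable [measurable]: "tilted n \<in> borel_measurable borel"
proof -
  have [measurable]: "lag_sum n \<in> borel_measurable borel"
    unfolding lag_sum_def by (intro borel_measurable_continuous_onI continuous_intros)
  have [measurable]: "stretch n \<in> borel_measurable borel"
    unfolding stretch_def by measurable
  show ?thesis unfolding tilted_def by measurable
qed

lemma gauss_measurable [measurable]: "gauss \<in> borel_measurable borel"
  unfolding gauss_def by measurable

lemma integrable_power_of_exp_bound:
  assumes [measurable]: "f \<in> borel_measurable borel" and "\<And>s::real. \<bar>f s\<bar> \<le> K * exp (- (alpha / 16 * \<bar>s\<bar>))"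
  shows "integrable lborel (\<lambda>s. f s ^ d)"
proof (rule Bochner_Integration.integrable_bound)
  show "integrable lborel (\<lambda>s. K ^ d * exp (- (alpha / 16 * \<bar>s\<bar>)))"
    using alpha_pos by (intro integrable_mult_right integrable_exp_neg_abs) auto
  show "AE s in lborel. norm (f s ^ d) \<le> norm (K ^ d * exp (- (alpha / 16 * \<bar>s\<bar>)))"
  proof (rule AE_I2)
    fix s :: real
    define e where "e = exp (- (alpha / 16 * \<bar>s\<bar>))"
    have e: "0 < e" "e \<le> 1" using alpha_pos by (auto simp: e_def)
    have "0 \<le> K * e" using assms(2)[of s] unfolding e_def by linarith
    then have K: "K \<ge> 0" using e by (simp add: zero_le_mult_iff)
    have "\<bar>f s\<bar> ^ d \<le> (K * e) ^ d" using assms(2)[of s] unfolding e_def by (intro power_mono) auto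
    also have "\<dots> \<le> K ^ d * e"
      using power_decreasing[of 1 d e] e K d by (simp add: power_mult_distrib mult_left_mono)
    also have "\<dots> \<le> \<bar>K ^ d * e\<bar>" by (rule abs_ge_self)
    finally show "norm (f s ^ d) \<le> norm (K ^ d * exp (- (alpha / 16 * \<bar>s\<bar>)))"
      unfolding e_def real_norm_def power_abs .
  qed
qed simp

text \<open>By the reflection \<open>s -> - s\<close>, twice the integral of the difference is the
  integral of its symmetrisation, to which the bound of order \<open>1 / n\<close> applies.\<close>

lemma power_integral_difference:
  "\<exists>K\<ge>0. \<forall>n>0. \<bar>(LINT s|lborel. tilted n s ^ d) - (LINT s|lborel. gauss s ^ d)\<bar> \<le> K / n"
proof -
  obtain K where K: "K \<ge> 0" and bound: "\<forall>n>0. \<forall>s. \<bar>(tilted n s ^ d - gauss s ^ d) + (tilted n (- s) ^ d - gauss (- s) ^ d)\<bar>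
      \<le> K / n * ((1 + \<bar>s\<bar>) ^ 4 * exp (- (alpha / 16 * \<bar>s\<bar>)))"
    using symmetrized_power_bound by (elim exE conjE) (rule that, assumption+)
  define J where "J = (LINT s|lborel. (1 + \<bar>s\<bar>) ^ 4 * exp (- (alpha / 16 * \<bar>s\<bar>)))"
  have J: "J \<ge> 0" unfolding J_def by (intro integral_nonneg_AE) simp
  have intG: "integrable lborel (\<lambda>s. gauss s ^ d)"
    using gauss_bound integrable_power_of_exp_bound[OF gauss_measurable] by blast
  have "\<bar>(LINT s|lborel. tilted n s ^ d) - (LINT s|lborel. gauss s ^ d)\<bar> \<le> (K * J / 2) / n" if n: "n > 0" for n
  proof -
    have intX: "integrable lborel (\<lambda>s. tilted n s ^ d)"
      using tilted_bound n integrable_power_of_exp_bound[OF tilted_measurable] by blast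
    define D where "D s = tilted n s ^ d - gauss s ^ d" for s
    have intD: "integrable lborel D" unfolding D_def using intX intG by simp
    have intD': "integrable lborel (\<lambda>s. D (- s))"
      using lborel_integrable_real_affine[OF intD, of "- 1" 0] by simp
    have "(LINT s|lborel. D s) = (LINT s|lborel. D (- s))"
      using lborel_integral_real_affine[of "- 1" D 0] by simp
    then have "2 * (LINT s|lborel. D s) = (LINT s|lborel. D s + D (- s))"
      using intD intD' by simp
    also have "\<bar>\<dots>\<bar> \<le> (LINT s|lborel. K / n * ((1 + \<bar>s\<bar>) ^ 4 * exp (- (alpha / 16 * \<bar>s\<bar>))))"
    proof -
      have "\<bar>LINT s|lborel. D s + D (- s)\<bar> \<le> (LINT s|lborel. \<bar>D s + D (- s)\<bar>)"
        using integral_norm_bound[of lborel "\<lambda>s. D s + D (- s)"] by simp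
      also have "\<dots> \<le> (LINT s|lborel. K / n * ((1 + \<bar>s\<bar>) ^ 4 * exp (- (alpha / 16 * \<bar>s\<bar>))))"
      proof (rule integral_mono)
        show "integrable lborel (\<lambda>s. \<bar>D s + D (- s)\<bar>)" using intD intD' by simp
        show "integrable lborel (\<lambda>s. K / n * ((1 + \<bar>s\<bar>) ^ 4 * exp (- (alpha / 16 * \<bar>s\<bar>))))"
          using alpha_pos by (intro integrable_mult_right integrable_power_exp_neg_abs) auto
        show "\<bar>D s + D (- s)\<bar> \<le> K / n * ((1 + \<bar>s\<bar>) ^ 4 * exp (- (alpha / 16 * \<bar>s\<bar>)))" for s
          unfolding D_def by (rule bound[rule_format, OF n])
      qed
      finally show ?thesis .
    qed
    also have "\<dots> = K / n * J" by (simp add: J_def)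
    finally have "2 * \<bar>LINT s|lborel. D s\<bar> \<le> K / n * J" by (simp add: abs_mult)
    moreover have "K / n * J = 2 * ((K * J / 2) / n)" by simp
    ultimately have "\<bar>LINT s|lborel. D s\<bar> \<le> (K * J / 2) / n" by linarith
    then show ?thesis unfolding D_def using intX intG by simp
  qed
  then show ?thesis using K J by (intro exI[of _ "K * J / 2"]) auto
qed

section \<open>The leading constant and the return to the coefficients\<close>

definition amp :: real where
  "amp = (real d - 1) ^ (d - 1) /
              ((2 * pi) powr ((real d - 1) / 2) * real d powr ((real d - 2) / 2) *
               (real d - 2) powr ((3 * real d - 1) / 2))"

lemma amp_pos: "amp > 0"
  using d by (simp add: amp_def)

lemma constants: "gam = (real d - 1) / (real d * (real d - 2))" "alpha = (real d - 1) / (real d)\<^sup>2"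
  "beta = (real d - 2) / real d"
proof -
  define p where "p = real d - 1"
  have p: "p \<ge> 2" using d by (simp add: p_def)
  have r: "rho = 1 / p" and dp: "real d = p + 1" by (simp_all add: rho_def p_def)
  have "p\<^sup>2 - 1 = (p + 1) * (p - 1)" by (simp add: power2_eq_square algebra_simps)
  moreover have "1 - (1 / p)\<^sup>2 = (p\<^sup>2 - 1) / p\<^sup>2" using p by (simp add: field_simps power_divide)
  ultimately show "gam = (real d - 1) / (real d * (real d - 2))"
    unfolding gam_def r dp using p by (simp add: power2_eq_square)
  have q: "1 + 1 / p = (p + 1) / p" "1 - 1 / p = (p - 1) / p" using p by (simp_all add: field_simps)
  show a: "alpha = (real d - 1) / (real d)\<^sup>2"
    unfolding alpha_def r dp q using p by (simp add: power2_eq_square)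
  show "beta = (real d - 2) / real d"
    unfolding beta_def kap_def a unfolding r q dp using p
    by (simp add: divide_simps power2_eq_square power3_eq_cube)
qed

text \<open>The \<open>d\<close>-th power is again a Gaussian. Its integral is compared with
  \<open>amp\<close> through logarithms, which turn the half-integral exponents into linear
  combinations of \<open>ln (2 pi)\<close>, \<open>ln d\<close>, \<open>ln (d - 1)\<close> and
  \<open>ln (d - 2)\<close>.\<close>

lemma gauss_power_integral: "(LINT s|lborel. gauss s ^ d) = amp"
proof -
  define A where "A = gam / sqrt (2 * pi * beta)"
  define k where "k = d * alpha\<^sup>2 / (2 * beta)"
  have k: "k > 0" using d alpha_pos pos by (simp add: k_def)
  have "gauss s ^ d = A ^ d * exp (- (k * s\<^sup>2))" for s
  proof -
    have "gauss s = A * exp (- (alpha * s)\<^sup>2 / (2 * beta))" unfolding gauss_def A_def ..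
    moreover have "d * (- (alpha * s)\<^sup>2 / (2 * beta)) = - (k * s\<^sup>2)"
      by (simp add: k_def power_mult_distrib)
    ultimately show ?thesis by (simp only: power_mult_distrib exp_of_nat_mult[symmetric])
  qed
  then have "(LINT s|lborel. gauss s ^ d) = A ^ d * sqrt (pi / k)"
    using has_bochner_integral_gaussian[OF k] by (simp add: has_bochner_integral_iff)
  also have "\<dots> = amp"
  proof -
    have d0: "real d > 0" "real d - 1 > 0" "real d - 2 > 0" using d by auto
    have A: "A > 0" using pos by (simp add: A_def)
    have 1: "ln A = ln (real d - 1) - ln (real d) - ln (real d - 2) - (ln (2 * pi) + ln (real d - 2) - ln (real d)) / 2"
      unfolding A_def constants using d0 by (simp add: ln_div ln_mult ln_sqrt)
    have 2: "ln (pi / k) = ln (2 * pi) + ln (real d - 2) - 2 * ln (real d - 1) + 2 * ln (real d)"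
    proof -
      have "pi / k = 2 * pi * (real d - 2) * (real d)\<^sup>2 / (real d - 1)\<^sup>2"
        unfolding k_def constants using d0 by (simp add: divide_simps power2_eq_square)
      then show ?thesis using d0 by (simp add: ln_div ln_mult ln_realpow)
    qed
    have "ln (A ^ d * sqrt (pi / k)) = d * ln A + ln (pi / k) / 2"
      using A k by (simp add: ln_mult ln_realpow ln_sqrt)
    also have "\<dots> = ln amp"
      unfolding 1 2 amp_def using d0 d
      by (simp add: ln_div ln_mult ln_realpow ln_powr of_nat_diff) (simp add: field_simps)
    finally show ?thesis using A k amp_pos by simp
  qed
  finally show ?thesis .
qed

text \<open>Substitute \<open>t = stretch n s\<close>, with Jacobian \<open>sqrt n\<close>. The
  \<open>d\<close>-th power of \<open>exp (- t / d)\<close> restores the weight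
  \<open>exp (- t)\<close>, and \<open>rho ^ (n d)\<close> is the reciprocal of the growth factor
  \<open>((d - 1)^d)^n\<close>.\<close>

lemma C_eq_integral:
  assumes n: "n > 0"
  shows "C d n = ((real d - 1) ^ d) ^ n * (sqrt n / sqrt n ^ d) * (LINT s|lborel. tilted n s ^ d)"
proof -
  define p where "p = real d - 1"
  have p: "p > 0" "rho = 1 / p" using d by (simp_all add: p_def rho_def)
  have sn: "sqrt n > 0" using n by simp
  have "C d n = (LINT t|lborel. indicator {0..} t * (exp (- t) * lag_sum n t ^ d))"
    unfolding C_eq_expint expint_def lag_sum_def by simp
  also have "\<dots> = sqrt n * (LINT s|lborel. indicator {0..} (n / alpha + sqrt n * s) * (exp (- (n / alpha + sqrt n * s)) * lag_sum n (n / alpha + sqrt n * s) ^ d))"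
    using lborel_integral_real_affine[of "sqrt n" "\<lambda>t. indicator {0..} t * (exp (- t) * lag_sum n t ^ d)" "n / alpha"] sn by simp
  also have "(\<lambda>s. indicator {0..} (n / alpha + sqrt n * s) * (exp (- (n / alpha + sqrt n * s)) * lag_sum n (n / alpha + sqrt n * s) ^ d))
      = (\<lambda>s. (p ^ d) ^ n / sqrt n ^ d * tilted n s ^ d)"
  proof
    fix s :: real
    have stretch: "n / alpha + sqrt n * s = stretch n s" by (simp add: stretch_def mult.commute)
    show "indicator {0..} (n / alpha + sqrt n * s) * (exp (- (n / alpha + sqrt n * s)) * lag_sum n (n / alpha + sqrt n * s) ^ d)
        = (p ^ d) ^ n / sqrt n ^ d * tilted n s ^ d"
    proof (cases "stretch n s \<ge> 0")
      case True
      have "exp (- (stretch n s / d)) ^ d = exp (- stretch n s)"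
        using d by (simp add: exp_of_nat_mult[symmetric])
      moreover have "(p ^ d) ^ n * (rho ^ n) ^ d = 1"
        using p by (simp add: power_mult[symmetric] mult.commute power_mult_distrib[symmetric])
      ultimately have "(p ^ d) ^ n / sqrt n ^ d * tilted n s ^ d = exp (- stretch n s) * lag_sum n (stretch n s) ^ d"
        using True sn by (simp add: tilted_def power_mult_distrib field_simps)
      then show ?thesis using True unfolding stretch by simp
    \<comment> \<open>For negative \<open>t\<close> the indicator is 0 on the left, and the right
      side is \<open>0 ^ d = 0\<close> since \<open>d > 0\<close>.\<close>
    qed (use d in \<open>auto simp: stretch tilted_def\<close>)
  qed
  finally show ?thesis by (simp add: p_def)
qed

lemma powr_eq_sqrt_power:
  assumes "n > 0"
  shows "real n powr ((1 - real d) / 2) = sqrt n / sqrt n ^ d"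
proof -
  have "sqrt n / sqrt n ^ d = n powr (1/2) / (n powr (1/2)) powr d"
    using assms by (simp add: powr_half_sqrt powr_realpow)
  also have "\<dots> = n powr (1/2 - 1/2 * d)" by (simp add: powr_powr powr_diff)
  finally show ?thesis by (simp add: diff_divide_distrib)
qed

lemma C_asymptotics:
  "(\<lambda>n. C d n - amp * ((real d - 1) ^ d) ^ n * real n powr ((1 - real d) / 2))
     \<in> O(\<lambda>n. amp * ((real d - 1) ^ d) ^ n * real n powr ((1 - real d) / 2) / real n)"
proof -
  obtain K where K: "K \<ge> 0" "\<forall>n>0. \<bar>(LINT s|lborel. tilted n s ^ d) - amp\<bar> \<le> K / n"
    using power_integral_difference unfolding gauss_power_integral by (elim exE conjE) (rule that, assumption+)
  show ?thesis
  \<comment> \<open>The comparison function contains \<open>amp\<close>, hence the quotient.\<close>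
  proof (rule bigoI[where c = "K / amp"], rule eventually_mono[OF eventually_gt_at_top[of 0]])
    fix n :: nat assume n: "0 < n"
    define E where "E = ((real d - 1) ^ d) ^ n * (sqrt n / sqrt n ^ d)"
    have E: "E \<ge> 0" using d by (simp add: E_def)
    have "norm (C d n - amp * ((real d - 1) ^ d) ^ n * real n powr ((1 - real d) / 2))
        = \<bar>E * ((LINT s|lborel. tilted n s ^ d) - amp)\<bar>"
    proof -
      have "amp * ((real d - 1) ^ d) ^ n * real n powr ((1 - real d) / 2) = E * amp"
        unfolding powr_eq_sqrt_power[OF n] E_def by simp
      moreover have "C d n = E * (LINT s|lborel. tilted n s ^ d)"
        unfolding C_eq_integral[OF n] E_def ..
      ultimately show ?thesis by (simp only: right_diff_distrib real_norm_def)
    qed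
    also have "\<dots> \<le> E * (K / n)"
      unfolding abs_mult using K n E by (intro mult_mono) auto
    also have "\<dots> = K / amp * norm (amp * ((real d - 1) ^ d) ^ n * real n powr ((1 - real d) / 2) / real n)"
    proof -
      have eq: "amp * ((real d - 1) ^ d) ^ n * real n powr ((1 - real d) / 2) / real n = amp * (E / n)"
        unfolding powr_eq_sqrt_power[OF n] E_def by simp
      show ?thesis unfolding eq using E amp_pos by (simp add: abs_mult)
    qed
    finally show "norm (C d n - amp * ((real d - 1) ^ d) ^ n * real n powr ((1 - real d) / 2))
      \<le> K / amp * norm (amp * ((real d - 1) ^ d) ^ n * real n powr ((1 - real d) / 2) / real n)" .
  qed
qed

end

theorem theorem3:
  fixes d :: nat
  assumes "d \<ge> 3"
  shows "(\<lambda>n. C d n -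
            ((real d - 1) ^ (d - 1) /
              ((2 * pi) powr ((real d - 1) / 2) * real d powr ((real d - 2) / 2) *
               (real d - 2) powr ((3 * real d - 1) / 2)))
            * ((real d - 1) ^ d) ^ n * real n powr ((1 - real d) / 2))
         \<in> O(\<lambda>n. ((real d - 1) ^ (d - 1) /
              ((2 * pi) powr ((real d - 1) / 2) * real d powr ((real d - 2) / 2) *
               (real d - 2) powr ((3 * real d - 1) / 2)))
            * ((real d - 1) ^ d) ^ n * real n powr ((1 - real d) / 2) / real n)"
proof -
  interpret cubical d by unfold_locales (rule assms)
  show ?thesis using C_asymptotics unfolding amp_def .
qed

end
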